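(* Let $n$ and $t$ be positive integers, $q$ a prime power, $\Delta\in \mathrm{M}_n(\mathbb{F}_q)$, and let $m$ be a nonnegative integer with $m(t+1)\le n$. Then the number of $t$-fold $\Delta$-anti-invariant subspaces of $\mathbb{F}_q^n$ of dimension $m$ is $$(-1)^{mt}\,q^{t\binom{m}{2}}\, \langle \omega F_\Delta,\,P_{((t+1)^m,\,1^{n-m(t+1)})}(x;q) \rangle .$$
   Context: A subspace $W\subseteq\mathbb{F}_q^n$ is $t$-fold $\Delta$-anti-invariant if $\dim(W+\Delta W+\cdots+\Delta^tW)=(t+1)\dim W$. Invariant flag generating function: for a weak composition $\alpha=(\alpha_1,\ldots,\alpha_\ell)$ of $n$ (a finite sequence of nonnegative integers with sum $n$, trailing zeros ignored), $X_\alpha(\Delta)$ is the number of flags $(0)=W_0\subseteq W_1\subseteq\cdots\subseteq W_\ell=\mathbb{F}_q^n$ of $\Delta$-invariant subspaces with $\dim W_i/W_{i-1}=\alpha_i$ for $1\le i\le\ell$. $F_\Delta(x)=\sum_\alpha X_\alpha(\Delta)x^\alpha$, sum over all weak compositions $\alpha$ of $n$ up to trailing zeros; it is a symmetric function in $x=(x_1,x_2,\ldots)$. $\langle\cdot,\cdot\rangle$ is the Hall scalar product (monomial functions $m_\lambda$ dual to complete homogeneous functions $h_\lambda$); $\omega$ is the involution with $\omega e_\lambda=h_\lambda$. $P_\lambda(x;q)$ is the Hall-Littlewood symmetric function (Macdonald's normalization, coefficient of $m_\lambda$ equal to $1$) with parameter specialized to $q$: in $N\ge\ell(\lambda)$ variables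 it is the scalar multiple of $\sum_{w\in S_N}w\big(x^\lambda\prod_{i<j}\frac{x_i-qx_j}{x_i-x_j}\big)$ in which $x^\lambda$ has coefficient $1$. $((t+1)^m,1^{n-m(t+1)})$ is the partition with $m$ parts equal to $t+1$ and $n-m(t+1)$ parts equal to $1$. Here $t$ is the integer in the statement, not the Hall-Littlewood parameter. *)

theory Defs
  imports
    "HOL-Analysis.Cartesian_Space"
    "HOL-Library.Set_Algebras"
    "HOL-Library.Poly_Mapping"
    "HOL-Combinatorics.Permutations"
    "HOL-Computational_Algebra.Polynomial_Factorial"
begin

text \<open>
  A monomial in the variables \<open>x\<^sub>0, x\<^sub>1, \<dots>\<close> is its exponent vector, of type
  \<^typ>\<open>nat \<Rightarrow>\<^sub>0 nat\<close>; the product of monomials is the sum of exponent vectors. For a list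
  \<open>\<alpha>\<close>, \<open>Poly_Mapping.nth \<alpha>\<close> is the exponent vector of \<open>x\<^sup>\<alpha>\<close>; it does not depend on
  trailing zeros of \<open>\<alpha>\<close>.
\<close>

abbreviation xpow :: "nat list \<Rightarrow> (nat \<Rightarrow>\<^sub>0 nat)"
  where "xpow \<equiv> Poly_Mapping.nth"

definition total_degree :: "(nat \<Rightarrow>\<^sub>0 nat) \<Rightarrow> nat"
  where "total_degree \<gamma> = (\<Sum>i\<in>Poly_Mapping.keys \<gamma>. Poly_Mapping.lookup \<gamma> i)"

lemma total_degree_superset:
  assumes "finite A" "Poly_Mapping.keys \<gamma> \<subseteq> A"
  shows "total_degree \<gamma> = (\<Sum>i\<in>A. Poly_Mapping.lookup \<gamma> i)"
  unfolding total_degree_def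
  by (rule sum.mono_neutral_left) (use assms in \<open>auto simp: in_keys_iff\<close>)

lemma total_degree_add: "total_degree (\<alpha> + \<beta>) = total_degree \<alpha> + total_degree \<beta>"
proof -
  let ?A = "Poly_Mapping.keys \<alpha> \<union> Poly_Mapping.keys \<beta>"
  have "Poly_Mapping.keys (\<alpha> + \<beta>) \<subseteq> ?A" by (rule Poly_Mapping.keys_add)
  then show ?thesis
    by (simp add: total_degree_superset[of ?A] lookup_add sum.distrib)
qed

lemma total_degree_0 [simp]: "total_degree 0 = 0"
  by (simp add: total_degree_def)

lemma lookup_map_key:
  "inj \<pi> \<Longrightarrow> Poly_Mapping.lookup (Poly_Mapping.map_key \<pi> \<gamma>) i = Poly_Mapping.lookup \<gamma> (\<pi> i)"
  by (simp add: Poly_Mapping.map_key.rep_eq)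

lemma total_degree_map_key:
  assumes "bij \<pi>"
  shows "total_degree (Poly_Mapping.map_key \<pi> \<gamma>) = total_degree \<gamma>"
proof -
  have inj: "inj \<pi>" using assms by (rule bij_is_inj)
  show ?thesis
    unfolding total_degree_def keys_map_key[OF inj]
  proof (rule sum.reindex_bij_witness[of _ "inv \<pi>" \<pi>])
    fix i
    show "inv \<pi> (\<pi> i) = i" using inj by (rule inv_f_f)
    show "Poly_Mapping.lookup \<gamma> (\<pi> i) = Poly_Mapping.lookup (Poly_Mapping.map_key \<pi> \<gamma>) i"
      by (rule lookup_map_key[OF inj, symmetric])
  next
    fix i assume "i \<in> Poly_Mapping.keys \<gamma>"
    show eq: "\<pi> (inv \<pi> i) = i" using bij_is_surj[OF assms] by (rule surj_f_inv_f)
    show "inv \<pi> i \<in> \<pi> -` Poly_Mapping.keys \<gamma>"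
      using \<open>i \<in> Poly_Mapping.keys \<gamma>\<close> by (simp only: vimage_eq eq)
  qed simp
qed

lemma finite_splittings: "finite {(\<alpha>, \<beta>). \<alpha> + \<beta> = (\<gamma> :: nat \<Rightarrow>\<^sub>0 nat)}"
proof -
  let ?K = "Poly_Mapping.keys \<gamma>"
  let ?M = "\<Sum>i\<in>?K. Poly_Mapping.lookup \<gamma> i"
  let ?F = "{f. \<forall>i. (i \<in> ?K \<longrightarrow> f i \<in> {..?M}) \<and> (i \<notin> ?K \<longrightarrow> f i = (0::nat))}"
  have fin: "finite ?F" by (rule finite_set_of_finite_funs) auto
  have bound: "Poly_Mapping.lookup \<alpha> \<in> ?F" if "\<alpha> + \<beta> = \<gamma>" for \<alpha> \<beta>
  proof -
    have le: "Poly_Mapping.lookup \<alpha> i \<le> Poly_Mapping.lookup \<gamma> i" for i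
      unfolding that[symmetric] lookup_add by simp
    have "Poly_Mapping.lookup \<alpha> i \<le> ?M" if "i \<in> ?K" for i
      using le[of i] member_le_sum[of i ?K "Poly_Mapping.lookup \<gamma>"] that by simp
    moreover have "Poly_Mapping.lookup \<alpha> i = 0" if "i \<notin> ?K" for i
      using le[of i] that by (simp add: in_keys_iff)
    ultimately show ?thesis by simp
  qed
  define A where "A = (Poly_Mapping.lookup -` ?F :: (nat \<Rightarrow>\<^sub>0 nat) set)"
  have "finite A"
    unfolding A_def by (rule finite_vimageI[OF fin], rule injI, rule poly_mapping_eqI) simp
  then have "finite (A \<times> A)" by (rule finite_cartesian_product) fact
  moreover have "{(\<alpha>, \<beta>). \<alpha> + \<beta> = \<gamma>} \<subseteq> A \<times> A"
  proof clarify
    fix \<alpha> \<beta> assume eq: "\<gamma> = \<alpha> + \<beta>"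
    have "\<alpha> \<in> A" unfolding A_def by (rule vimageI2, rule bound) (rule eq[symmetric])
    moreover have "\<beta> \<in> A"
      unfolding A_def by (rule vimageI2, rule bound[of _ \<alpha>]) (use eq in \<open>simp add: add.commute\<close>)
    ultimately show "\<alpha> \<in> A \<and> \<beta> \<in> A" ..
  qed
  ultimately show ?thesis by (rule rev_finite_subset)
qed

definition conv ::
  "((nat \<Rightarrow>\<^sub>0 nat) \<Rightarrow> rat) \<Rightarrow> ((nat \<Rightarrow>\<^sub>0 nat) \<Rightarrow> rat) \<Rightarrow> (nat \<Rightarrow>\<^sub>0 nat) \<Rightarrow> rat"
  where "conv f g \<gamma> = (\<Sum>(\<alpha>, \<beta>)\<in>{(\<alpha>, \<beta>). \<alpha> + \<beta> = \<gamma>}. f \<alpha> * g \<beta>)"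

lemma conv_commute: "conv f g = conv g f"
proof
  fix \<gamma>
  show "conv f g \<gamma> = conv g f \<gamma>"
    unfolding conv_def
    by (rule sum.reindex_bij_witness[of _ prod.swap prod.swap]) (auto simp: add.commute)
qed

lemma conv_assoc: "conv (conv f g) h = conv f (conv g h)"
proof
  fix \<gamma>
  let ?S = "\<lambda>\<gamma>. {p. fst p + snd p = (\<gamma> :: nat \<Rightarrow>\<^sub>0 nat)}"
  have fin: "finite (?S \<gamma>)" for \<gamma>
    using finite_splittings[of \<gamma>] by (simp add: case_prod_unfold)
  have "conv (conv f g) h \<gamma> = (\<Sum>p\<in>?S \<gamma>. \<Sum>r\<in>?S (fst p). f (fst r) * g (snd r) * h (snd p))"
    by (simp add: conv_def case_prod_unfold sum_distrib_right)
  also have "\<dots> = (\<Sum>(p, r)\<in>(SIGMA p:?S \<gamma>. ?S (fst p)). f (fst r) * g (snd r) * h (snd p))"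
    by (rule sum.Sigma) (simp_all add: fin)
  also have "\<dots> = (\<Sum>(p, r)\<in>(SIGMA p:?S \<gamma>. ?S (snd p)). f (fst p) * (g (fst r) * h (snd r)))"
    by (rule sum.reindex_bij_witness[of _
          "\<lambda>(p, r). ((fst p + fst r, snd r), (fst p, fst r))"
          "\<lambda>(p, r). ((fst r, snd r + snd p), (snd r, snd p))"])
       (auto simp: add.assoc mult.assoc)
  also have "\<dots> = (\<Sum>p\<in>?S \<gamma>. \<Sum>r\<in>?S (snd p). f (fst p) * (g (fst r) * h (snd r)))"
    by (rule sum.Sigma[symmetric]) (simp_all add: fin)
  also have "\<dots> = conv f (conv g h) \<gamma>"
    by (simp add: conv_def case_prod_unfold sum_distrib_left)
  finally show "conv (conv f g) h \<gamma> = conv f (conv g h) \<gamma>" .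
qed

lemma conv_one: "conv (\<lambda>\<gamma>. if \<gamma> = 0 then 1 else 0) f = f"
proof
  fix \<gamma>
  have "conv (\<lambda>\<gamma>. if \<gamma> = 0 then 1 else 0) f \<gamma>
      = (\<Sum>p\<in>{(0 :: nat \<Rightarrow>\<^sub>0 nat, \<gamma>)}. (if fst p = 0 then 1 else 0) * f (snd p))"
    unfolding conv_def case_prod_unfold
    by (rule sum.mono_neutral_right) (use finite_splittings[of \<gamma>] in \<open>auto simp: case_prod_unfold\<close>)
  then show "conv (\<lambda>\<gamma>. if \<gamma> = 0 then 1 else 0) f \<gamma> = f \<gamma>" by simp
qed

lemma conv_add_left: "conv (\<lambda>\<gamma>. f \<gamma> + g \<gamma>) h = (\<lambda>\<gamma>. conv f h \<gamma> + conv g h \<gamma>)"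
  by (rule ext) (simp add: conv_def case_prod_unfold distrib_right sum.distrib)

lemma conv_map_key:
  assumes "bij \<pi>"
    and "\<And>\<gamma>. f (Poly_Mapping.map_key \<pi> \<gamma>) = f \<gamma>"
    and "\<And>\<gamma>. g (Poly_Mapping.map_key \<pi> \<gamma>) = g \<gamma>"
  shows "conv f g (Poly_Mapping.map_key \<pi> \<gamma>) = conv f g \<gamma>"
proof -
  let ?m = "Poly_Mapping.map_key \<pi> :: (nat \<Rightarrow>\<^sub>0 nat) \<Rightarrow> _"
  let ?i = "Poly_Mapping.map_key (inv \<pi>) :: (nat \<Rightarrow>\<^sub>0 nat) \<Rightarrow> _"
  have inj: "inj \<pi>" "inj (inv \<pi>)"
    using assms(1) by (auto simp: bij_is_inj bij_imp_bij_inv)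
  have mi: "?m (?i \<gamma>) = \<gamma>" "?i (?m \<gamma>) = \<gamma>" for \<gamma>
    using bij_is_surj[OF assms(1)]
    by (auto intro!: poly_mapping_eqI simp: lookup_map_key inj surj_f_inv_f)
  show ?thesis
    unfolding conv_def case_prod_unfold
  proof (rule sum.reindex_bij_witness[of _ "map_prod ?m ?m" "map_prod ?i ?i"])
    fix p assume p: "p \<in> {p. fst p + snd p = ?m \<gamma>}"
    show "map_prod ?m ?m (map_prod ?i ?i p) = p"
      by (simp add: mi prod_eq_iff)
    show "map_prod ?i ?i p \<in> {p. fst p + snd p = \<gamma>}"
      using p by (simp add: map_key_plus[OF inj(2), symmetric] mi)
    show "f (fst (map_prod ?i ?i p)) * g (snd (map_prod ?i ?i p)) = f (fst p) * g (snd p)"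
      using assms(2)[of "?i (fst p)"] assms(3)[of "?i (snd p)"] by (simp add: mi)
  next
    fix p assume p: "p \<in> {p. fst p + snd p = \<gamma>}"
    show "map_prod ?i ?i (map_prod ?m ?m p) = p"
      by (simp add: mi prod_eq_iff)
    show "map_prod ?m ?m p \<in> {p. fst p + snd p = ?m \<gamma>}"
      using p by (simp add: map_key_plus[OF inj(1), symmetric])
  qed
qed

text \<open>
  A symmetric function is a formal power series in \<open>x\<^sub>0, x\<^sub>1, \<dots>\<close> of bounded degree whose
  coefficients are invariant under permutations of the variables.
\<close>

typedef symfun = "{f :: (nat \<Rightarrow>\<^sub>0 nat) \<Rightarrow> rat.
    (\<exists>d. \<forall>\<gamma>. f \<gamma> \<noteq> 0 \<longrightarrow> total_degree \<gamma> \<le> d) \<and>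
    (\<forall>\<pi> \<gamma>. bij \<pi> \<longrightarrow> f (Poly_Mapping.map_key \<pi> \<gamma>) = f \<gamma>)}"
  morphisms scoeff Abs_symfun
  by (rule exI[of _ "\<lambda>_. 0"]) simp

setup_lifting type_definition_symfun

lift_definition sscale :: "rat \<Rightarrow> symfun \<Rightarrow> symfun"
  is "\<lambda>c f \<gamma>. c * f \<gamma>"
  by auto

instantiation symfun :: comm_ring_1
begin

lift_definition zero_symfun :: symfun is "\<lambda>_. 0" by simp

lift_definition one_symfun :: symfun is "\<lambda>\<gamma>. if \<gamma> = 0 then 1 else 0"
proof (intro conjI allI impI)
  show "\<exists>d. \<forall>\<gamma>. (if \<gamma> = 0 then 1 else 0) \<noteq> (0::rat) \<longrightarrow> total_degree \<gamma> \<le> d"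
    by (rule exI[of _ 0]) simp
  fix \<pi> :: "nat \<Rightarrow> nat" and \<gamma> :: "nat \<Rightarrow>\<^sub>0 nat"
  assume \<pi>: "bij \<pi>"
  have "Poly_Mapping.map_key \<pi> \<gamma> = 0 \<longleftrightarrow> \<gamma> = 0"
    by (metis \<pi> bij_is_inj bij_is_surj lookup_map_key lookup_zero poly_mapping_eqI surj_def)
  then show "(if Poly_Mapping.map_key \<pi> \<gamma> = 0 then 1 else 0) = (if \<gamma> = 0 then 1 else (0::rat))"
    by simp
qed

lift_definition uminus_symfun :: "symfun \<Rightarrow> symfun" is "\<lambda>f \<gamma>. - f \<gamma>" by auto

lift_definition plus_symfun :: "symfun \<Rightarrow> symfun \<Rightarrow> symfun" is "\<lambda>f g \<gamma>. f \<gamma> + g \<gamma>"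
proof (elim conjE exE, intro conjI allI impI)
  fix f g :: "(nat \<Rightarrow>\<^sub>0 nat) \<Rightarrow> rat" and d e
  assume "\<forall>\<gamma>. f \<gamma> \<noteq> 0 \<longrightarrow> total_degree \<gamma> \<le> d" "\<forall>\<gamma>. g \<gamma> \<noteq> 0 \<longrightarrow> total_degree \<gamma> \<le> e"
  then have "total_degree \<gamma> \<le> max d e" if "f \<gamma> + g \<gamma> \<noteq> 0" for \<gamma>
    using that by (cases "f \<gamma> = 0") (auto simp: le_max_iff_disj)
  then show "\<exists>d. \<forall>\<gamma>. f \<gamma> + g \<gamma> \<noteq> 0 \<longrightarrow> total_degree \<gamma> \<le> d" by blast
qed auto

lift_definition minus_symfun :: "symfun \<Rightarrow> symfun \<Rightarrow> symfun" is "\<lambda>f g \<gamma>. f \<gamma> - g \<gamma>"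
proof (elim conjE exE, intro conjI allI impI)
  fix f g :: "(nat \<Rightarrow>\<^sub>0 nat) \<Rightarrow> rat" and d e
  assume "\<forall>\<gamma>. f \<gamma> \<noteq> 0 \<longrightarrow> total_degree \<gamma> \<le> d" "\<forall>\<gamma>. g \<gamma> \<noteq> 0 \<longrightarrow> total_degree \<gamma> \<le> e"
  then have "total_degree \<gamma> \<le> max d e" if "f \<gamma> - g \<gamma> \<noteq> 0" for \<gamma>
    using that by (cases "f \<gamma> = 0") (auto simp: le_max_iff_disj)
  then show "\<exists>d. \<forall>\<gamma>. f \<gamma> - g \<gamma> \<noteq> 0 \<longrightarrow> total_degree \<gamma> \<le> d" by blast
qed auto

lift_definition times_symfun :: "symfun \<Rightarrow> symfun \<Rightarrow> symfun" is conv
proof (elim conjE exE, intro conjI allI impI)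
  fix f g :: "(nat \<Rightarrow>\<^sub>0 nat) \<Rightarrow> rat" and d e
  assume bounds: "\<forall>\<gamma>. f \<gamma> \<noteq> 0 \<longrightarrow> total_degree \<gamma> \<le> d" "\<forall>\<gamma>. g \<gamma> \<noteq> 0 \<longrightarrow> total_degree \<gamma> \<le> e"
  have "total_degree \<gamma> \<le> d + e" if nz: "conv f g \<gamma> \<noteq> 0" for \<gamma>
  proof -
    obtain p where p: "fst p + snd p = \<gamma>" "f (fst p) * g (snd p) \<noteq> 0"
      using nz unfolding conv_def case_prod_unfold
      by (rule sum.not_neutral_contains_not_neutral) simp
    then have "total_degree (fst p) \<le> d" "total_degree (snd p) \<le> e"
      using bounds by auto
    then show ?thesis
      using p(1) total_degree_add[of "fst p" "snd p"] by simp
  qed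
  then show "\<exists>d. \<forall>\<gamma>. conv f g \<gamma> \<noteq> 0 \<longrightarrow> total_degree \<gamma> \<le> d" by blast
qed (simp add: conv_map_key)

instance
proof
  fix a b c :: symfun
  show "a * b * c = a * (b * c)" by transfer (rule conv_assoc)
  show "a * b = b * a" by transfer (rule conv_commute)
  show "1 * a = a" by transfer (rule conv_one)
  show "(a + b) * c = a * c + b * c" by transfer (rule conv_add_left)
  show "(0::symfun) \<noteq> 1" by transfer (auto simp: fun_eq_iff)
qed (transfer; auto simp: fun_eq_iff)+

end

interpretation symfun: vector_space sscale
  by unfold_locales (transfer; auto simp: fun_eq_iff algebra_simps)+

definition is_partition :: "nat list \<Rightarrow> bool"
  where "is_partition \<mu> \<longleftrightarrow> sorted_wrt (\<ge>) \<mu> \<and> 0 \<notin> set \<mu>"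

lift_definition sym_m :: "nat list \<Rightarrow> symfun"
  is "\<lambda>\<mu> \<gamma>. if \<exists>\<pi>. bij \<pi> \<and> \<gamma> = Poly_Mapping.map_key \<pi> (xpow \<mu>) then 1 else 0"
proof (intro conjI allI impI)
  fix \<mu> :: "nat list"
  show "\<exists>d. \<forall>\<gamma>. (if \<exists>\<pi>. bij \<pi> \<and> \<gamma> = Poly_Mapping.map_key \<pi> (xpow \<mu>) then 1 else 0) \<noteq> (0::rat)
      \<longrightarrow> total_degree \<gamma> \<le> d"
    by (rule exI[of _ "total_degree (xpow \<mu>)"]) (auto simp: total_degree_map_key)
  fix \<sigma> :: "nat \<Rightarrow> nat" and \<gamma> :: "nat \<Rightarrow>\<^sub>0 nat"
  assume \<sigma>: "bij \<sigma>"
  have "(\<exists>\<pi>. bij \<pi> \<and> Poly_Mapping.map_key \<sigma> \<gamma> = Poly_Mapping.map_key \<pi> (xpow \<mu>)) \<longleftrightarrow>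
        (\<exists>\<pi>. bij \<pi> \<and> \<gamma> = Poly_Mapping.map_key \<pi> (xpow \<mu>))"
  proof
    assume "\<exists>\<pi>. bij \<pi> \<and> Poly_Mapping.map_key \<sigma> \<gamma> = Poly_Mapping.map_key \<pi> (xpow \<mu>)"
    then obtain \<pi> where \<pi>: "bij \<pi>" "Poly_Mapping.map_key \<sigma> \<gamma> = Poly_Mapping.map_key \<pi> (xpow \<mu>)"
      by blast
    have inv: "bij (inv \<sigma>)" using \<sigma> by (rule bij_imp_bij_inv)
    have "\<gamma> = Poly_Mapping.map_key (inv \<sigma>) (Poly_Mapping.map_key \<sigma> \<gamma>)"
      using bij_is_surj[OF \<sigma>] bij_is_inj[OF \<sigma>] bij_is_inj[OF inv]
      by (auto intro!: poly_mapping_eqI simp: lookup_map_key surj_f_inv_f)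
    also have "\<dots> = Poly_Mapping.map_key (\<pi> \<circ> inv \<sigma>) (xpow \<mu>)"
      using \<pi> inv by (simp add: map_key_compose bij_is_inj)
    finally show "\<exists>\<pi>. bij \<pi> \<and> \<gamma> = Poly_Mapping.map_key \<pi> (xpow \<mu>)"
      using \<pi> inv bij_comp by blast
  next
    assume "\<exists>\<pi>. bij \<pi> \<and> \<gamma> = Poly_Mapping.map_key \<pi> (xpow \<mu>)"
    then obtain \<pi> where \<pi>: "bij \<pi>" "\<gamma> = Poly_Mapping.map_key \<pi> (xpow \<mu>)" by blast
    then have "Poly_Mapping.map_key \<sigma> \<gamma> = Poly_Mapping.map_key (\<pi> \<circ> \<sigma>) (xpow \<mu>)"
      using \<sigma> by (simp add: map_key_compose bij_is_inj)
    then show "\<exists>\<pi>. bij \<pi> \<and> Poly_Mapping.map_key \<sigma> \<gamma> = Poly_Mapping.map_key \<pi> (xpow \<mu>)"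
      using \<sigma> \<pi> bij_comp by blast
  qed
  then show "(if \<exists>\<pi>. bij \<pi> \<and> Poly_Mapping.map_key \<sigma> \<gamma> = Poly_Mapping.map_key \<pi> (xpow \<mu>) then 1 else 0)
    = (if \<exists>\<pi>. bij \<pi> \<and> \<gamma> = Poly_Mapping.map_key \<pi> (xpow \<mu>) then 1 else (0::rat))"
    by simp
qed

text \<open>\<open>h\<^sub>r\<close> is the sum of all monomials of degree \<open>r\<close>, \<open>e\<^sub>r\<close> that of the squarefree ones.\<close>

lift_definition complete_homogeneous :: "nat \<Rightarrow> symfun"
  is "\<lambda>r \<gamma>. if total_degree \<gamma> = r then 1 else 0"
  by (auto simp: total_degree_map_key)

lift_definition elementary :: "nat \<Rightarrow> symfun"
  is "\<lambda>r \<gamma>. if total_degree \<gamma> = r \<and> (\<forall>i. Poly_Mapping.lookup \<gamma> i \<le> 1) then 1 else 0"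
proof (intro conjI allI impI)
  fix r
  show "\<exists>d. \<forall>\<gamma>. (if total_degree \<gamma> = r \<and> (\<forall>i. Poly_Mapping.lookup \<gamma> i \<le> 1) then 1 else 0) \<noteq> (0::rat)
      \<longrightarrow> total_degree \<gamma> \<le> d"
    by (rule exI[of _ r]) simp
  fix \<pi> :: "nat \<Rightarrow> nat" and \<gamma> :: "nat \<Rightarrow>\<^sub>0 nat"
  assume \<pi>: "bij \<pi>"
  have "(\<forall>i. Poly_Mapping.lookup \<gamma> (\<pi> i) \<le> 1) \<longleftrightarrow> (\<forall>i. Poly_Mapping.lookup \<gamma> i \<le> 1)"
    using \<pi> by (metis bij_pointE)
  then show "(if total_degree (Poly_Mapping.map_key \<pi> \<gamma>) = r \<and>
        (\<forall>i. Poly_Mapping.lookup (Poly_Mapping.map_key \<pi> \<gamma>) i \<le> 1) then 1 else 0)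
      = (if total_degree \<gamma> = r \<and> (\<forall>i. Poly_Mapping.lookup \<gamma> i \<le> 1) then 1 else (0::rat))"
    using \<pi> by (simp add: lookup_map_key bij_is_inj total_degree_map_key)
qed

definition sym_h :: "nat list \<Rightarrow> symfun"
  where "sym_h \<mu> = (\<Prod>r\<leftarrow>\<mu>. complete_homogeneous r)"

definition sym_e :: "nat list \<Rightarrow> symfun"
  where "sym_e \<mu> = (\<Prod>r\<leftarrow>\<mu>. elementary r)"

text \<open>
  Both descriptions below are unique on the rational symmetric functions because each of the
  families \<open>e\<^sub>\<mu>\<close>, \<open>h\<^sub>\<mu>\<close>, \<open>m\<^sub>\<mu>\<close>, with \<open>\<mu>\<close> ranging over all partitions, is a basis.
\<close>

definition omega :: "symfun \<Rightarrow> symfun"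
  where "omega = (THE \<phi>. Vector_Spaces.linear sscale sscale \<phi> \<and>
    (\<forall>\<mu>. is_partition \<mu> \<longrightarrow> \<phi> (sym_e \<mu>) = sym_h \<mu>))"

definition hall :: "symfun \<Rightarrow> symfun \<Rightarrow> rat"
  where "hall = (THE B.
    (\<forall>g. Vector_Spaces.linear sscale (*) (\<lambda>f. B f g)) \<and>
    (\<forall>f. Vector_Spaces.linear sscale (*) (B f)) \<and>
    (\<forall>\<mu> \<nu>. is_partition \<mu> \<longrightarrow> is_partition \<nu> \<longrightarrow>
      B (sym_m \<mu>) (sym_h \<nu>) = (if \<mu> = \<nu> then 1 else 0)))"

type_synonym mpoly = "(nat \<Rightarrow>\<^sub>0 nat) \<Rightarrow>\<^sub>0 rat"

definition const :: "rat \<Rightarrow> mpoly fract"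
  where "const c = to_fract (Poly_Mapping.single 0 c)"

definition var :: "nat \<Rightarrow> mpoly fract"
  where "var i = to_fract (Poly_Mapping.single (Poly_Mapping.single i 1) 1)"

text \<open>The unnormalized sum over \<open>S\<^sub>N\<close> of the permuted rational functions, for variables \<open>x\<^sub>0, \<dots>, x\<^sub>N\<^sub>-\<^sub>1\<close> and
  \<open>N \<ge> length \<mu>\<close>; the permutation \<open>w\<close> acts by replacing \<open>x\<^sub>i\<close> by \<open>x\<^bsub>w i\<^esub>\<close>.\<close>

definition hall_littlewood_sum :: "nat \<Rightarrow> rat \<Rightarrow> nat list \<Rightarrow> mpoly fract"
  where "hall_littlewood_sum N q \<mu> = (\<Sum>w | w permutes {..<N}.
    (\<Prod>i<length \<mu>. var (w i) ^ (\<mu> ! i)) *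
    (\<Prod>j<N. \<Prod>i<j. (var (w i) - const q * var (w j)) / (var (w i) - var (w j))))"

definition hall_littlewood_poly :: "nat \<Rightarrow> rat \<Rightarrow> nat list \<Rightarrow> mpoly"
  where "hall_littlewood_poly N q \<mu> = (THE p.
    (\<exists>c. to_fract p = const c * hall_littlewood_sum N q \<mu>) \<and>
    Poly_Mapping.lookup p (xpow \<mu>) = 1)"

text \<open>By stability, there is a unique symmetric function that becomes \<open>P\<^sub>\<mu>(x\<^sub>0, \<dots>, x\<^sub>N\<^sub>-\<^sub>1; q)\<close> on setting all variables \<open>x\<^sub>i\<close>
  with \<open>i \<ge> N\<close> to zero, for every \<open>N \<ge> length \<mu>\<close>.\<close>

definition hall_littlewood :: "rat \<Rightarrow> nat list \<Rightarrow> symfun"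
  where "hall_littlewood q \<mu> = (THE P. \<forall>N\<ge>length \<mu>. \<forall>\<gamma>. Poly_Mapping.keys \<gamma> \<subseteq> {..<N} \<longrightarrow>
    scoeff P \<gamma> = Poly_Mapping.lookup (hall_littlewood_poly N q \<mu>) \<gamma>)"

definition invariant_subspace :: "'k::field ^ 'n ^ 'n \<Rightarrow> ('k ^ 'n::finite) set \<Rightarrow> bool"
  where "invariant_subspace \<Delta> W \<longleftrightarrow> vec.subspace W \<and> (*v) \<Delta> ` W \<subseteq> W"

definition invariant_flags :: "'k::field ^ 'n ^ 'n \<Rightarrow> nat list \<Rightarrow> ('k ^ 'n::finite) set list set"
  where "invariant_flags \<Delta> \<alpha> = {W. length W = length \<alpha> + 1 \<and>
    W ! 0 = {0} \<and> W ! length \<alpha> = UNIV \<and>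
    (\<forall>i\<le>length \<alpha>. invariant_subspace \<Delta> (W ! i)) \<and>
    (\<forall>i<length \<alpha>. W ! i \<subseteq> W ! (i + 1) \<and> vec.dim (W ! (i + 1)) = vec.dim (W ! i) + \<alpha> ! i)}"

text \<open>
  \<open>F\<^sub>\<Delta>\<close>: the coefficient of \<open>x\<^sup>\<alpha>\<close> is the number \<open>X\<^sub>\<alpha>(\<Delta>)\<close> of flags for every weak composition
  \<open>\<alpha>\<close> of \<open>n\<close>, with any number of trailing zeros, and \<open>0\<close> for every other \<open>\<alpha>\<close>.
  Such a symmetric function exists because \<open>X\<^sub>\<alpha>(\<Delta>)\<close> is invariant under permuting \<open>\<alpha>\<close>.
\<close>

definition flag_gf :: "'k::{field, finite} ^ 'n ^ 'n::finite \<Rightarrow> symfun"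
  where "flag_gf \<Delta> = (THE F. \<forall>\<alpha>. scoeff F (xpow \<alpha>) =
    (if sum_list \<alpha> = CARD('n) then of_nat (card (invariant_flags \<Delta> \<alpha>)) else 0))"

text \<open>The sum \<open>W + \<Delta>W + \<dots> + \<Delta>\<^sup>tW\<close> is the elementwise sum of sets.\<close>

definition anti_invariant :: "nat \<Rightarrow> 'k::field ^ 'n ^ 'n \<Rightarrow> ('k ^ 'n::finite) set \<Rightarrow> bool"
  where "anti_invariant t \<Delta> W \<longleftrightarrow> vec.subspace W \<and>
    vec.dim (\<Sum>i\<le>t. ((*v) \<Delta> ^^ i) ` W) = (t + 1) * vec.dim W"

end

theory Submission
  imports Defs
begin

text \<open>
  Describe a partition by its list \<open>\<nu>\<close> of columns and write \<open>p\<^sub>\<nu>\<close> for its Hall--Littlewood function; the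
  partition of the theorem has the columns \<open>n - m t, m, \<dots>, m\<close>. For a subspace \<open>D\<close>, let \<open>core D\<close> be the set of
  all \<open>x\<close> in \<open>D\<close> with \<open>\<Delta> x\<close> in \<open>D\<close>. For an invariant subspace \<open>U\<close>, count the subspaces \<open>D\<close> of codimension
  \<open>\<nu>\<^sub>0\<close> in \<open>U\<close> for which the dimensions of \<open>D, core D, core (core D), \<dots>\<close> drop by \<open>\<nu>\<^sub>1, \<nu>\<^sub>2, \<dots>\<close> down to
  zero. For the columns above and \<open>U\<close> the whole space, these \<open>D\<close> are the sums \<open>W + \<dots> + \<Delta>\<^sup>t\<^sup>-\<^sup>1 W\<close>
  with \<open>W\<close> anti-invariant of dimension \<open>m\<close>.

  Let \<open>L\<^sub>U\<close> be the pairing with \<open>\<omega> F\<close> for the flag generating function \<open>F\<close> of \<open>\<Delta>\<close> restricted to \<open>U\<close>. Then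
  \<open>L\<^sub>U e\<^sub>\<mu>\<close> counts flags of type \<open>\<mu>\<close>, hence \<open>L\<^sub>U (e\<^sub>r g)\<close> is the sum of \<open>L\<^sub>U\<^sub>' g\<close> over the invariant subspaces \<open>U'\<close>
  of codimension \<open>r\<close> in \<open>U\<close>. Up to the factor \<open>signed_weight\<close>, \<open>L\<^sub>U p\<^sub>\<nu>\<close> is the number of subspaces \<open>D\<close> as above:
  both satisfy the recursion given by the Pieri rule for \<open>e\<^sub>r p\<^sub>\<kappa>\<close>, the counts by Moebius inversion over the
  subspaces \<open>A\<close> containing \<open>D\<close> with \<open>core A\<close> inside \<open>D\<close>. Since \<open>r, \<kappa>\<close> is the term with the shortest first column in this rule,
  the recursion determines both sides.
\<close>

section \<open>Gaussian binomial coefficients\<close>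

text \<open>The pairing is computed for all invariant \<open>U\<close> at once because
  multiplication by e_r leads from \<open>U\<close> to its invariant subspaces. Columns are the
  natural index: e_r adds a vertical strip, with coefficients that are products of Gaussian
  binomials in differences of columns, the numbers that also count subspaces in prescribed position.
  \<open>signed_weight\<close> absorbs the signs and powers of q of the Moebius inversion; the
  constant of the theorem is its inverse on t columns of length m. The objects of the statement are
  given by unique descriptions, so existence has to be proved as well. For the flag generating
  function it is the symmetry of the flag counts, which comes from the same Moebius formula and the
  symmetry of Gaussian binomials. For the Hall-Littlewood functions, polynomiality and stability in
  the number of variables come from the Pieri rule: it is proved for sums over permutations as
  rational functions, its coefficients after normalization do not depend on the number of variables,
  and solving it for the term with the shortest first column constructs the function.\<close>

fun qbinomial :: "'a::comm_semiring_1 \<Rightarrow> nat \<Rightarrow> nat \<Rightarrow> 'a" where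
  "qbinomial q n 0 = 1"
| "qbinomial q 0 (Suc k) = 0"
| "qbinomial q (Suc n) (Suc k) = qbinomial q n (Suc k) + q ^ (n - k) * qbinomial q n k"

definition qfact :: "'a::comm_semiring_1 \<Rightarrow> nat \<Rightarrow> 'a"
  where "qfact q n = (\<Prod>i<n. \<Sum>j\<le>i. q ^ j)"

lemma qbinomial_eq_0: "n < k \<Longrightarrow> qbinomial q n k = 0"
proof (induction n arbitrary: k)
  case 0
  then show ?case by (cases k) auto
next
  case (Suc n)
  then show ?case by (cases k) auto
qed

lemma qbinomial_self [simp]: "qbinomial q n n = 1"
  by (induction n) (auto simp: qbinomial_eq_0)

lemma qfact_0 [simp]: "qfact q 0 = 1"
  by (simp add: qfact_def)

lemma qfact_Suc: "qfact q (Suc n) = qfact q n * (\<Sum>j\<le>n. q ^ j)"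
  by (simp add: qfact_def)

lemma qfact_pos: "0 < q \<Longrightarrow> 0 < qfact (q::rat) n"
  unfolding qfact_def by (intro prod_pos ballI sum_pos) auto

text \<open>The q-integer of n + 1 splits as [n - k] + q^(n - k) [k + 1]; this is the Pascal step in
  \<open>qbinomial_qfact\<close>.\<close>

lemma sum_powers_split:
  assumes "k \<le> n"
  shows "(\<Sum>j\<le>n. (q::'a::comm_semiring_1) ^ j) = (\<Sum>j<n - k. q ^ j) + q ^ (n - k) * (\<Sum>j\<le>k. q ^ j)"
proof -
  have "{..n} = {..<n - k} \<union> {n - k..n}" using assms by auto
  then have "(\<Sum>j\<le>n. q ^ j) = (\<Sum>j<n - k. q ^ j) + (\<Sum>j=n - k..n. q ^ j)"
    by (simp add: sum.union_disjoint ivl_disj_int)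
  also have "(\<Sum>j=n - k..n. q ^ j) = (\<Sum>j\<le>k. q ^ (n - k + j))"
    by (rule sum.reindex_bij_witness[of _ "\<lambda>j. n - k + j" "\<lambda>j. j - (n - k)"]) (use assms in auto)
  also have "\<dots> = q ^ (n - k) * (\<Sum>j\<le>k. q ^ j)"
    by (simp add: power_add sum_distrib_left)
  finally show ?thesis .
qed

text \<open>Each term of the Pascal rule becomes \<open>qfact q n\<close> times a q-integer, and
  \<open>sum_powers_split\<close> adds the two. The form without quotients stays valid in semirings,
  where it later serves to compare normalizations.\<close>

lemma qbinomial_qfact:
  "k \<le> n \<Longrightarrow> qbinomial q n k * (qfact q k * qfact q (n - k)) = qfact (q::'a::comm_semiring_1) n"
proof (induction n arbitrary: k)
  case 0
  then show ?case by simp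
next
  case (Suc n)
  show ?case
  proof (cases k)
    case 0
    then show ?thesis by simp
  next
    case (Suc l)
    show ?thesis
    proof (cases "l = n")
      case True
      then show ?thesis
        using Suc by (simp add: qbinomial_eq_0 qfact_Suc algebra_simps)
    next
      case False
      then have l: "l < n" using Suc Suc.prems by simp
      then obtain d where d: "n - l = Suc d" by (metis Suc_diff_Suc)
      have d': "n - Suc l = d" using d by simp
      have "qbinomial q n (Suc l) * (qfact q (Suc l) * qfact q (n - l))
          = qfact q n * (\<Sum>j<n - l. q ^ j)"
      proof -
        have "qbinomial q n (Suc l) * (qfact q (Suc l) * qfact q (n - l))
            = qbinomial q n (Suc l) * (qfact q (Suc l) * qfact q (n - Suc l)) * (\<Sum>j<n - l. q ^ j)"
          unfolding d d' qfact_Suc[of q d] by (simp only: lessThan_Suc_atMost ac_simps)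
        then show ?thesis using Suc.IH[of "Suc l"] l by simp
      qed
      moreover have "qbinomial q n l * (qfact q (Suc l) * qfact q (n - l))
          = qfact q n * (\<Sum>j\<le>l. q ^ j)"
      proof -
        have "qbinomial q n l * (qfact q (Suc l) * qfact q (n - l))
            = qbinomial q n l * (qfact q l * qfact q (n - l)) * (\<Sum>j\<le>l. q ^ j)"
          unfolding qfact_Suc[of q l] by (simp only: ac_simps)
        then show ?thesis using Suc.IH[of l] l by simp
      qed
      ultimately have "(qbinomial q n (Suc l) + q ^ (n - l) * qbinomial q n l) *
            (qfact q (Suc l) * qfact q (n - l))
          = qfact q n * ((\<Sum>j<n - l. q ^ j) + q ^ (n - l) * (\<Sum>j\<le>l. q ^ j))"
        by (simp only: distrib_left distrib_right mult.assoc mult.left_commute[of _ "q ^ (n - l)"])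
      then show ?thesis
        unfolding Suc using l by (simp add: qfact_Suc[of q n] sum_powers_split[of l n q])
    qed
  qed
qed

lemma qbinomial_conv_qfact:
  assumes "0 < q" "k \<le> n"
  shows "qbinomial (q::rat) n k = qfact q n / (qfact q k * qfact q (n - k))"
  using qbinomial_qfact[OF assms(2), of q] qfact_pos[OF assms(1)]
  by (simp add: field_simps less_imp_neq[symmetric])

lemma qbinomial_symmetric:
  "0 < q \<Longrightarrow> k \<le> n \<Longrightarrow> qbinomial (q::rat) n (n - k) = qbinomial q n k"
  by (simp add: qbinomial_conv_qfact mult.commute)

text \<open>The mirror Pascal rule, from the defining one by the symmetry k -> n - k. The defining
  rule fits the removal of the last position of a block; this one makes the alternating sum
  telescope.\<close>

lemma qbinomial_Suc':
  assumes "0 < q"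
  shows "qbinomial (q::rat) (Suc n) (Suc k) = q ^ Suc k * qbinomial q n (Suc k) + qbinomial q n k"
proof (cases "k < n")
  case True
  then obtain d where d: "n = Suc k + d" by (metis less_iff_Suc_add add_Suc)
  have "qbinomial q (Suc n) (Suc k) = qbinomial q (Suc n) (Suc (n - Suc k))"
    using qbinomial_symmetric[OF assms, of "Suc k" "Suc n"] True by (simp add: Suc_diff_Suc)
  also have "\<dots> = qbinomial q n (n - k) + q ^ Suc k * qbinomial q n (n - Suc k)"
    unfolding d by (simp del: power_Suc)
  also have "\<dots> = qbinomial q n k + q ^ Suc k * qbinomial q n (Suc k)"
    using True qbinomial_symmetric[OF assms, of k n] qbinomial_symmetric[OF assms, of "Suc k" n] by simp
  finally show ?thesis by simp
next
  case False
  then show ?thesis by (cases "k = n") (auto simp: qbinomial_eq_0)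
qed

lemma choose_two_0 [simp]: "0 choose 2 = (0::nat)"
  by (simp add: binomial_eq_0)

lemma choose_two_Suc: "Suc n choose 2 = (n choose 2) + n"
  by (simp add: numeral_2_eq_2)

lemma choose_two_add: "(a + b) choose 2 = (a choose 2) + (b choose 2) + a * b"
  by (induction b) (simp_all add: choose_two_Suc)

text \<open>The q-binomial theorem at a zero: the product of the 1 - q^i for i < n contains the
  factor for i = 0. It expresses Moebius inversion in the lattice of subspaces.\<close>

lemma qbinomial_alternating_sum:
  assumes "0 < q"
  shows "(\<Sum>j\<le>n. (- 1) ^ j * q ^ (n - j choose 2) * qbinomial (q::rat) n j) = (if n = 0 then 1 else 0)"
proof (cases n)
  case 0
  then show ?thesis by simp
next
  case (Suc m)
  \<comment> \<open>The partial sums of the reversed series have the closed form \<open>a k\<close>,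
    which vanishes for k = m + 1.\<close>
  define a where "a i = (- 1) ^ i * q ^ (Suc i choose 2) * qbinomial q m i" for i
  define t where "t i = (- 1) ^ i * q ^ (i choose 2) * qbinomial q (Suc m) i" for i
  have t_Suc: "t (Suc i) = a (Suc i) - a i" for i
    unfolding t_def a_def qbinomial_Suc'[OF assms] choose_two_Suc
    by (simp add: algebra_simps power_add)
  have "(\<Sum>i\<le>k. t i) = a k" for k
    by (induction k) (simp_all add: t_Suc, simp add: t_def a_def choose_two_Suc)
  from this[of "Suc m"] have t0: "(\<Sum>i\<le>Suc m. t i) = 0"
    by (simp add: a_def qbinomial_eq_0 del: sum.atMost_Suc)
  have "(\<Sum>j\<le>n. (- 1) ^ j * q ^ (n - j choose 2) * qbinomial q n j) = (\<Sum>i\<le>Suc m. (- 1) ^ Suc m * t i)"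
  proof (rule sum.reindex_bij_witness[of _ "\<lambda>i. Suc m - i" "\<lambda>i. Suc m - i"])
    fix j assume "j \<in> {..n}"
    then have j: "j \<le> Suc m" using Suc by simp
    have "(- 1 :: rat) ^ Suc m * (- 1) ^ (Suc m - j) = (- 1) ^ j"
      using j by (metis (no_types, lifting) diff_add_inverse2 even_diff_nat le_add_diff_inverse2
          minus_one_power_iff mult_minus1_right power_add even_add not_less)
    then show "(- 1) ^ Suc m * t (Suc m - j) = (- 1) ^ j * q ^ (n - j choose 2) * qbinomial q n j"
      unfolding t_def Suc by (simp add: qbinomial_symmetric[OF assms j] mult.assoc[symmetric] del: power_Suc)
  qed (use Suc in auto)
  then show ?thesis using t0 Suc by (simp add: sum_distrib_left[symmetric] sum_negf del: sum.atMost_Suc)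
qed

text \<open>For a prime power q the left side counts independent k-tuples in dimension n, and the
  product on the right counts the bases of a k-dimensional space. Both reduce to one closed form
  with \<open>qfact\<close>, the second being its case n = k.\<close>

lemma prod_power_diff:
  "k \<le> n \<Longrightarrow> (\<Prod>i<k. q ^ n - q ^ i) = (\<Prod>i<k. q ^ k - q ^ i) * qbinomial (q::rat) n k" if "1 < q"
proof -
  have *: "(\<Prod>i<k. q ^ n - q ^ i) * qfact q (n - k) = q ^ (k choose 2) * (q - 1) ^ k * qfact q n"
    if "k \<le> n" for n k
    using that
  proof (induction k)
    case 0
    then show ?case by simp
  next
    case (Suc k)
    then obtain d where d: "n - k = Suc d" by (metis Suc_diff_Suc Suc_le_lessD)
    have d': "n - Suc k = d" "n = k + Suc d" using d by auto
    have "(q - 1) * (\<Sum>j\<le>d. q ^ j) = q ^ Suc d - 1"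
      by (metis power_diff_1_eq lessThan_Suc_atMost)
    then have "q ^ n - q ^ k = q ^ k * ((q - 1) * (\<Sum>j\<le>d. q ^ j))"
      unfolding d'(2) by (simp add: right_diff_distrib power_add)
    then have "(\<Prod>i<Suc k. q ^ n - q ^ i) * qfact q (n - Suc k)
       = ((\<Prod>i<k. q ^ n - q ^ i) * qfact q (n - k)) * (q ^ k * (q - 1))"
      unfolding d d'(1) qfact_Suc prod.lessThan_Suc by (simp only: ac_simps)
    then show ?case using Suc by (simp add: choose_two_Suc power_add)
  qed
  assume "k \<le> n"
  have "(\<Prod>i<k. q ^ n - q ^ i) * qfact q (n - k)
     = (\<Prod>i<k. q ^ k - q ^ i) * qbinomial q n k * qfact q (n - k)"
    using *[OF \<open>k \<le> n\<close>] *[of k k] qbinomial_qfact[OF \<open>k \<le> n\<close>, of q] by (simp add: algebra_simps)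
  then show ?thesis using qfact_pos[of q "n - k"] that by simp
qed

section \<open>Counting subspaces\<close>

lemma card_gt_1_field: "1 < CARD('k::{field,finite})"
proof -
  have "card {0::'k, 1} \<le> CARD('k)" by (rule card_mono) auto
  then show ?thesis by simp
qed

lemma card_span_independent:
  fixes B :: "('k::{field,finite} ^ 'n::finite) set"
  assumes "finite B" "vec.independent B"
  shows "card (vec.span B) = CARD('k) ^ card B"
  using assms
proof (induction B)
  case empty
  then show ?case by (simp add: vec.span_empty)
next
  case (insert a B)
  have a: "a \<notin> vec.span B" and B: "vec.independent B"
    using insert vec.independent_insert[of a B] by auto
  have "bij_betw (\<lambda>(c, y). c *s a + y) (UNIV \<times> vec.span B) (vec.span (insert a B))"
    unfolding bij_betw_def
  proof (intro conjI inj_onI)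
    fix u v assume uv: "u \<in> UNIV \<times> vec.span B" "v \<in> UNIV \<times> vec.span B"
      "(case u of (c, y) \<Rightarrow> c *s a + y) = (case v of (c, y) \<Rightarrow> c *s a + y)"
    obtain c y d z where [simp]: "u = (c, y)" "v = (d, z)" by fastforce
    have eq: "(c - d) *s a = z - y" using uv(3) by (simp add: vector_sub_rdistrib algebra_simps)
    have "c = d"
    proof (rule ccontr)
      assume "c \<noteq> d"
      then have "a = inverse (c - d) *s (z - y)"
        unfolding eq[symmetric] by (simp add: vector_smult_assoc)
      moreover have "z - y \<in> vec.span B" using uv by (auto intro: vec.span_diff)
      ultimately show False using a vec.span_scale by metis
    qed
    then show "u = v" using eq by simp
  next
    show "(\<lambda>(c, y). c *s a + y) ` (UNIV \<times> vec.span B) = vec.span (insert a B)"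
    proof (intro equalityI subsetI)
      fix x assume "x \<in> (\<lambda>(c, y). c *s a + y) ` (UNIV \<times> vec.span B)"
      then obtain c y where "x = c *s a + y" "y \<in> vec.span B" by auto
      then have "x - c *s a \<in> vec.span B" by simp
      then show "x \<in> vec.span (insert a B)" unfolding vec.span_insert by blast
    next
      fix x assume "x \<in> vec.span (insert a B)"
      then obtain c where "x - c *s a \<in> vec.span B" by (auto simp: vec.span_insert)
      then show "x \<in> (\<lambda>(c, y). c *s a + y) ` (UNIV \<times> vec.span B)"
        by (intro image_eqI[of _ _ "(c, x - c *s a)"]) auto
    qed
  qed
  then have "card (vec.span (insert a B)) = CARD('k) * card (vec.span B)"
    using bij_betw_same_card by (metis card_cartesian_product)
  then show ?case using insert B by simp
qed

lemma card_subspace: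
  fixes S :: "('k::{field,finite} ^ 'n::finite) set"
  assumes "vec.subspace S"
  shows "card S = CARD('k) ^ vec.dim S"
proof -
  obtain B where "B \<subseteq> S" "vec.independent B" "S \<subseteq> vec.span B" "card B = vec.dim S"
    using vec.basis_exists[of S] by blast
  moreover have "vec.span B = S"
    using assms calculation vec.span_minimal by blast
  ultimately show ?thesis
    using card_span_independent[of B] by simp
qed

lemma subspace_eq_of_dim_le:
  fixes S :: "('k::{field,finite} ^ 'n::finite) set"
  assumes "vec.subspace S" "vec.subspace U" "S \<subseteq> U" "vec.dim U \<le> vec.dim S"
  shows "S = U"
proof (rule card_seteq)
  show "card U \<le> card S"
    using assms card_gt_1_field[where 'k='k] by (simp add: card_subspace power_increasing)
qed (use assms in simp_all)

text \<open>Rank-nullity by counting: (a, d) -> a + T d maps \<open>A \<times> D\<close> onto the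
  span, all fibres have the size of the second space on the left, and exponents of cardinalities are
  compared. The identity as \<open>T\<close> gives the dimension formula for sums; \<Delta> as
  \<open>T\<close> gives the growth from \<open>A\<close> to A + \<Delta> D.\<close>

lemma dim_span_image:
  fixes A D :: "('k::{field,finite} ^ 'n::finite) set"
  assumes T: "Vector_Spaces.linear (*s) (*s) T" and A: "vec.subspace A" and D: "vec.subspace D"
  shows "vec.dim (vec.span (A \<union> T ` D)) + vec.dim {x \<in> D. T x \<in> A} = vec.dim A + vec.dim D"
proof -
  let ?f = "\<lambda>(a, d). a + T d"
  let ?P = "vec.span (A \<union> T ` D)" and ?K = "{x \<in> D. T x \<in> A}"
  have TD: "vec.subspace (T ` D)" by (rule vec.linear_subspace_image[OF T D])
  have im: "?f ` (A \<times> D) = ?P"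
  proof (intro equalityI subsetI)
    fix x assume "x \<in> ?f ` (A \<times> D)"
    then obtain a d where "x = a + T d" "a \<in> A" "d \<in> D" by auto
    then show "x \<in> ?P" by (auto intro!: vec.span_add intro: vec.span_base)
  next
    fix x assume "x \<in> ?P"
    then obtain y z where yz: "x = y + z" "y \<in> vec.span A" "z \<in> vec.span (T ` D)"
      unfolding vec.span_Un by blast
    have "y \<in> A" using yz(2) vec.span_eq_iff[THEN iffD2, OF A] by simp
    moreover obtain d where "z = T d" "d \<in> D"
      using yz(3) vec.span_eq_iff[THEN iffD2, OF TD] by auto
    ultimately have "y \<in> A" "z = T d" "d \<in> D" by simp_all
    then show "x \<in> ?f ` (A \<times> D)" unfolding yz(1) by (intro image_eqI[of _ _ "(y, d)"]) simp_all
  qed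
  have K: "vec.subspace ?K"
  proof (rule vec.subspaceI)
    show "0 \<in> ?K" using vec.subspace_0[OF A] vec.subspace_0[OF D] by (simp add: vec.linear_0[OF T])
    show "x + y \<in> ?K" if "x \<in> ?K" "y \<in> ?K" for x y
      using that vec.subspace_add[OF A] vec.subspace_add[OF D] by (simp add: vec.linear_add[OF T])
    show "c *s x \<in> ?K" if "x \<in> ?K" for c x
      using that vec.subspace_scale[OF A] vec.subspace_scale[OF D] by (simp add: vec.linear_scale[OF T])
  qed
  have fib: "card {x \<in> A \<times> D. ?f x = y} = card ?K" if "y \<in> ?f ` (A \<times> D)" for y
  proof -
    obtain a0 d0 where y: "a0 \<in> A" "d0 \<in> D" "y = a0 + T d0" using \<open>y \<in> ?f ` (A \<times> D)\<close> by auto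
    \<comment> \<open>All solutions arise from the one solution \<open>(a0, d0)\<close> by adding
      \<open>(- T d, d)\<close> with \<open>T d\<close> in \<open>A\<close>.\<close>
    have "bij_betw (\<lambda>d. (a0 - T d, d0 + d)) ?K {x \<in> A \<times> D. ?f x = y}"
    proof (rule bij_betw_byWitness[of _ "\<lambda>(a, d). d - d0"])
      show "\<forall>x\<in>{x \<in> A \<times> D. ?f x = y}. (a0 - T ((\<lambda>(a, d). d - d0) x), d0 + (\<lambda>(a, d). d - d0) x) = x"
      proof
        fix x assume "x \<in> {x \<in> A \<times> D. ?f x = y}"
        then obtain a d where [simp]: "x = (a, d)" and "a + T d = a0 + T d0" using y(3) by auto
        then show "(a0 - T ((\<lambda>(a, d). d - d0) x), d0 + (\<lambda>(a, d). d - d0) x) = x"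
          by (simp add: vec.linear_diff[OF T] algebra_simps)
      qed
      show "(\<lambda>d. (a0 - T d, d0 + d)) ` ?K \<subseteq> {x \<in> A \<times> D. ?f x = y}"
        unfolding y(3) using y(1,2) A D by (auto simp: vec.linear_add[OF T] vec.subspace_add vec.subspace_diff)
      show "(\<lambda>(a, d). d - d0) ` {x \<in> A \<times> D. ?f x = y} \<subseteq> ?K"
      proof
        fix x assume "x \<in> (\<lambda>(a, d). d - d0) ` {x \<in> A \<times> D. ?f x = y}"
        then obtain a d where *: "x = d - d0" "a \<in> A" "d \<in> D" "a + T d = a0 + T d0"
          using y(3) by auto
        have "T (d - d0) = a0 - a"
          using *(4) by (simp add: vec.linear_diff[OF T] algebra_simps)
        then show "x \<in> ?K"
          using y(1,2) * vec.subspace_diff[OF D] vec.subspace_diff[OF A] by simp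
      qed
    qed auto
    then show ?thesis by (rule bij_betw_same_card[symmetric])
  qed
  have "card (A \<times> D) = (\<Sum>y\<in>?f ` (A \<times> D). card {x \<in> A \<times> D. ?f x = y})"
    using sum.image_gen[of "A \<times> D" "\<lambda>_. 1::nat" ?f] by simp
  also have "\<dots> = card ?P * card ?K"
    using fib unfolding im by simp
  finally have "card A * card D = card ?P * card ?K"
    by (simp only: card_cartesian_product)
  then have "CARD('k) ^ (vec.dim A + vec.dim D) = CARD('k) ^ (vec.dim ?P + vec.dim ?K)"
    unfolding card_subspace[OF A] card_subspace[OF D] card_subspace[OF K]
      card_subspace[OF vec.subspace_span] power_add .
  then show ?thesis
    using card_gt_1_field[where 'k='k] by (simp add: power_inject_exp)
qed

lemma dim_span_Un:
  fixes A B :: "('k::{field,finite} ^ 'n::finite) set"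
  assumes "vec.subspace A" "vec.subspace B"
  shows "vec.dim (vec.span (A \<union> B)) + vec.dim (A \<inter> B) = vec.dim A + vec.dim B"
  using dim_span_image[of "\<lambda>x. x" A B] assms vec.linear_ident
  by (simp add: Int_def conj_commute)

text \<open>Tuples that are linearly independent modulo \<open>P\<close>; counting dimensions over
  \<open>P\<close> stands in for a quotient space.\<close>

definition independent_tuples ::
  "('k::field ^ 'n::finite) set \<Rightarrow> ('k ^ 'n) set \<Rightarrow> nat \<Rightarrow> ('k ^ 'n) list set"
  where "independent_tuples V P k =
    {xs. set xs \<subseteq> V \<and> length xs = k \<and> vec.dim (P \<union> set xs) = vec.dim P + k}"

lemma dim_Un_set_le: "vec.dim (P \<union> set xs) \<le> vec.dim (P::('k::field ^ 'n::finite) set) + length xs"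
  by (induction xs) (auto simp: vec.dim_insert)

lemma finite_independent_tuples:
  "finite (independent_tuples (V::('k::{field,finite} ^ 'n::finite) set) P k)"
  by (rule finite_subset[OF _ finite_lists_length_eq[of V k]])
    (auto simp: independent_tuples_def)

lemma card_independent_tuples:
  fixes V P :: "('k::{field,finite} ^ 'n::finite) set"
  assumes q: "q = of_nat CARD('k)" and V: "vec.subspace V" and P: "vec.subspace P" "P \<subseteq> V"
  shows "rat_of_nat (card (independent_tuples V P k)) = (\<Prod>i<k. q ^ vec.dim V - q ^ (vec.dim P + i))"
proof (induction k)
  case 0
  have "independent_tuples V P 0 = {[]}" by (auto simp: independent_tuples_def)
  then show ?case by simp
next
  case (Suc k)
  have eq: "independent_tuples V P (Suc k) =
     (\<lambda>(xs, x). x # xs) ` (SIGMA xs:independent_tuples V P k. V - vec.span (P \<union> set xs))"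
  proof (intro equalityI subsetI)
    fix ys assume "ys \<in> independent_tuples V P (Suc k)"
    then obtain x xs where ys: "ys = x # xs" "x \<in> V" "set xs \<subseteq> V" "length xs = k"
      "vec.dim (insert x (P \<union> set xs)) = vec.dim P + Suc k"
      by (cases ys) (auto simp: independent_tuples_def)
    then have "x \<notin> vec.span (P \<union> set xs)" "vec.dim (P \<union> set xs) = vec.dim P + k"
      using dim_Un_set_le[of P xs] by (auto simp: vec.dim_insert split: if_splits)
    then show "ys \<in> (\<lambda>(xs, x). x # xs) ` (SIGMA xs:independent_tuples V P k. V - vec.span (P \<union> set xs))"
      using ys by (auto simp: independent_tuples_def intro!: image_eqI[of _ _ "(xs, x)"])
  next
    fix ys assume "ys \<in> (\<lambda>(xs, x). x # xs) ` (SIGMA xs:independent_tuples V P k. V - vec.span (P \<union> set xs))"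
    then show "ys \<in> independent_tuples V P (Suc k)"
      by (auto simp: independent_tuples_def vec.dim_insert)
  qed
  have fib: "rat_of_nat (card (V - vec.span (P \<union> set xs))) = q ^ vec.dim V - q ^ (vec.dim P + k)"
    if xs: "xs \<in> independent_tuples V P k" for xs
  proof -
    have sub: "vec.span (P \<union> set xs) \<subseteq> V"
      using xs P V by (intro vec.span_minimal) (auto simp: independent_tuples_def)
    have "card (vec.span (P \<union> set xs)) = CARD('k) ^ (vec.dim P + k)"
      using xs by (simp add: card_subspace vec.subspace_span independent_tuples_def)
    moreover have "card (vec.span (P \<union> set xs)) \<le> card V" using sub by (intro card_mono) auto
    ultimately show ?thesis
      using sub card_subspace[OF V] by (simp add: card_Diff_subset of_nat_diff q)
  qed
  have "inj_on (\<lambda>(xs, x). x # xs) A" for A :: "(('k ^ 'n) list \<times> ('k ^ 'n)) set"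
    by (auto simp: inj_on_def)
  then have "card (independent_tuples V P (Suc k)) =
      (\<Sum>xs\<in>independent_tuples V P k. card (V - vec.span (P \<union> set xs)))"
    unfolding eq by (simp add: card_image finite_independent_tuples)
  then have "rat_of_nat (card (independent_tuples V P (Suc k))) =
      (\<Sum>xs\<in>independent_tuples V P k. q ^ vec.dim V - q ^ (vec.dim P + k))"
    using fib by simp
  then show ?case using Suc by (simp add: mult.commute)
qed

text \<open>Double counting of the k-tuples in \<open>V\<close> that are independent modulo
  \<open>P'\<close>: each lies in exactly one \<open>U\<close>, its span with \<open>P\<close>, and
  is a basis of \<open>U\<close> modulo \<open>P\<close>. So the number of \<open>U\<close> is a
  quotient of two counts of tuples.\<close>

lemma card_subspaces_avoiding:
  fixes V P P' :: "('k::{field,finite} ^ 'n::finite) set"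
  assumes q: "q = of_nat CARD('k)"
    and V: "vec.subspace V" and P: "vec.subspace P" and P': "vec.subspace P'"
    and sub: "P \<subseteq> P'" "P' \<subseteq> V"
  shows "rat_of_nat (card {U. vec.subspace U \<and> P \<subseteq> U \<and> U \<subseteq> V \<and> U \<inter> P' = P \<and> vec.dim U = vec.dim P + k})
    = q ^ (k * (vec.dim P' - vec.dim P)) * qbinomial q (vec.dim V - vec.dim P') k"
proof -
  let ?U = "{U. vec.subspace U \<and> P \<subseteq> U \<and> U \<subseteq> V \<and> U \<inter> P' = P \<and> vec.dim U = vec.dim P + k}"
  let ?p = "vec.dim P" and ?p' = "vec.dim P'" and ?v = "vec.dim V"
  have q1: "1 < q" using card_gt_1_field[where 'k='k] q by simp
  have le: "?p \<le> ?p'" "?p' \<le> ?v" using sub by (auto intro: vec.dim_subset)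
  have span: "vec.span (P \<union> set xs) = U" if "U \<in> ?U" "xs \<in> independent_tuples U P k" for U xs
  proof (rule subspace_eq_of_dim_le)
    show "vec.span (P \<union> set xs) \<subseteq> U"
      using that by (intro vec.span_minimal) (auto simp: independent_tuples_def)
  qed (use that in \<open>auto simp: independent_tuples_def vec.subspace_span\<close>)
  have span': "vec.span (P' \<union> set xs) = vec.span (P' \<union> vec.span (P \<union> set xs))" for xs
  proof
    show "vec.span (P' \<union> set xs) \<subseteq> vec.span (P' \<union> vec.span (P \<union> set xs))"
      using vec.span_superset[of "P \<union> set xs"] by (intro vec.span_mono) auto
    have "vec.span (P \<union> set xs) \<subseteq> vec.span (P' \<union> set xs)"
      using sub by (intro vec.span_mono) auto
    moreover have "P' \<subseteq> vec.span (P' \<union> set xs)"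
      using vec.span_superset by blast
    ultimately show "vec.span (P' \<union> vec.span (P \<union> set xs)) \<subseteq> vec.span (P' \<union> set xs)"
      by (intro vec.span_minimal) (auto simp: vec.subspace_span)
  qed
  have eq: "independent_tuples V P' k = (\<Union>U\<in>?U. independent_tuples U P k)"
  proof (intro equalityI subsetI)
    fix xs assume xs: "xs \<in> independent_tuples V P' k"
    define U where "U = vec.span (P \<union> set xs)"
    have U: "vec.subspace U" by (simp add: U_def vec.subspace_span)
    have PU: "P \<subseteq> U" "set xs \<subseteq> U" using vec.span_superset[of "P \<union> set xs"] by (simp_all add: U_def)
    have "set xs \<subseteq> V" using xs by (simp add: independent_tuples_def)
    then have UV: "U \<subseteq> V" unfolding U_def using V sub
      by (intro vec.span_minimal) simp_all
    have "vec.dim (P' \<union> set xs) = ?p' + k"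
      using xs by (simp add: independent_tuples_def)
    then have "vec.dim (vec.span (P' \<union> U)) = ?p' + k"
      unfolding U_def span'[symmetric] by (simp only: vec.dim_span)
    then have "k + vec.dim (P' \<inter> U) = vec.dim U"
      using dim_span_Un[OF P' U] by simp
    moreover have "?p \<le> vec.dim (P' \<inter> U)" using PU sub by (intro vec.dim_subset) simp
    moreover have "vec.dim U \<le> ?p + k"
      using dim_Un_set_le[of P xs] xs by (simp add: U_def independent_tuples_def)
    ultimately have d: "vec.dim U = ?p + k" "vec.dim (P' \<inter> U) = ?p" by linarith+
    then have "P = P' \<inter> U"
      using P P' U PU sub vec.subspace_inter[OF P' U] by (intro subspace_eq_of_dim_le) simp_all
    then have "U \<inter> P' = P" by blast
    then have "U \<in> ?U" using U PU UV d(1) by simp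
    moreover have "xs \<in> independent_tuples U P k"
      using xs d(1) PU unfolding independent_tuples_def U_def by (simp add: vec.dim_span)
    ultimately show "xs \<in> (\<Union>U\<in>?U. independent_tuples U P k)" by blast
  next
    fix xs assume "xs \<in> (\<Union>U\<in>?U. independent_tuples U P k)"
    then obtain U where U: "U \<in> ?U" "xs \<in> independent_tuples U P k" by blast
    have "vec.dim (vec.span (P' \<union> U)) + ?p = ?p' + (?p + k)"
      using dim_span_Un[OF P', of U] U(1) by (simp add: Int_commute)
    then have "vec.dim (vec.span (P' \<union> set xs)) = ?p' + k"
      unfolding span'[of xs] span[OF U] by simp
    then have "vec.dim (P' \<union> set xs) = ?p' + k"
      by (simp only: vec.dim_span)
    then show "xs \<in> independent_tuples V P' k"
      using U by (auto simp: independent_tuples_def)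
  qed
  have disj: "independent_tuples U P k \<inter> independent_tuples U' P k = {}"
    if "U \<in> ?U" "U' \<in> ?U" "U \<noteq> U'" for U U'
  proof (rule ccontr)
    assume "\<not> ?thesis"
    then obtain xs where "xs \<in> independent_tuples U P k" "xs \<in> independent_tuples U' P k" by auto
    then have "vec.span (P \<union> set xs) = U" "vec.span (P \<union> set xs) = U'"
      using span[OF that(1)] span[OF that(2)] by blast+
    then show False using that(3) by simp
  qed
  have "card (independent_tuples V P' k) = (\<Sum>U\<in>?U. card (independent_tuples U P k))"
    unfolding eq by (rule card_UN_disjoint) (use disj in \<open>auto simp: finite_independent_tuples\<close>)
  then have "rat_of_nat (card (independent_tuples V P' k)) =
      (\<Sum>U\<in>?U. \<Prod>i<k. q ^ (?p + k) - q ^ (?p + i))"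
    using card_independent_tuples[OF q _ P, of _ k] by simp
  also have "\<dots> = rat_of_nat (card ?U) * (q ^ (?p * k) * (\<Prod>i<k. q ^ k - q ^ i))"
  proof -
    have "(\<Prod>i<k. q ^ (?p + k) - q ^ (?p + i)) = (\<Prod>i<k. q ^ ?p * (q ^ k - q ^ i))"
      by (simp add: power_add right_diff_distrib)
    then show ?thesis by (simp add: prod.distrib power_mult)
  qed
  finally have 1: "rat_of_nat (card ?U) * (q ^ (?p * k) * (\<Prod>i<k. q ^ k - q ^ i))
      = (\<Prod>i<k. q ^ ?v - q ^ (?p' + i))"
    using card_independent_tuples[OF q V P' sub(2), of k] by simp
  have 2: "(\<Prod>i<k. q ^ ?v - q ^ (?p' + i)) = q ^ (?p' * k) * (\<Prod>i<k. q ^ (?v - ?p') - q ^ i)"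
  proof -
    have "(\<Prod>i<k. q ^ ?v - q ^ (?p' + i)) = (\<Prod>i<k. q ^ ?p' * (q ^ (?v - ?p') - q ^ i))"
    proof (rule prod.cong)
      fix i
      have "?v = ?p' + (?v - ?p')" using le by simp
      then have "q ^ ?v = q ^ ?p' * q ^ (?v - ?p')" by (metis power_add)
      then show "q ^ ?v - q ^ (?p' + i) = q ^ ?p' * (q ^ (?v - ?p') - q ^ i)"
        by (simp only: right_diff_distrib power_add)
    qed simp
    then show ?thesis by (simp add: prod.distrib power_mult)
  qed
  have 3: "(\<Prod>i<k. q ^ (?v - ?p') - q ^ i) = (\<Prod>i<k. q ^ k - q ^ i) * qbinomial q (?v - ?p') k"
  proof (cases "k \<le> ?v - ?p'")
    case True
    then show ?thesis using prod_power_diff[OF q1 True] by simp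
  next
    case False
    \<comment> \<open>The factor for i = \<open>?v - ?p'\<close> is zero, in accordance with the
      Gaussian binomial.\<close>
    then have "(\<Prod>i<k. q ^ (?v - ?p') - q ^ i) = 0"
      by (intro prod_zero) (auto intro!: bexI[of _ "?v - ?p'"])
    then show ?thesis using False by (simp add: qbinomial_eq_0)
  qed
  have nz: "(\<Prod>i<k. q ^ k - q ^ i) \<noteq> 0"
  proof -
    have "q ^ k - q ^ i \<noteq> 0" if "i < k" for i
      using power_strict_increasing[OF that q1] by simp
    then show ?thesis by simp
  qed
  obtain d where d: "?p' = ?p + d" using le(1) le_Suc_ex by blast
  have e: "q ^ (?p' * k) = q ^ (?p * k) * q ^ (k * (?p' - ?p))"
    unfolding d by (simp only: add_diff_cancel_left' distrib_right power_add mult.commute[of k d])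
  define X where "X = q ^ (?p * k) * (\<Prod>i<k. q ^ k - q ^ i)"
  have "rat_of_nat (card ?U) * X = X * (q ^ (k * (?p' - ?p)) * qbinomial q (?v - ?p') k)"
    using 1 unfolding 2 3 e X_def[symmetric] by (simp add: X_def)
  moreover have "X \<noteq> 0" unfolding X_def using nz q1 by simp
  ultimately show ?thesis by simp
qed

section \<open>Invariant subspaces\<close>

text \<open>A list \<open>\<kappa>\<close> holds the columns of a partition, with trailing zeros allowed. Adding a vertical strip of
  size \<open>r\<close> to this partition creates at most one new column, and \<open>M\<close> bounds the length of the first.\<close>

fun strips :: "nat \<Rightarrow> nat list \<Rightarrow> nat \<Rightarrow> nat list set" where
  "strips M [] r = (if r \<le> M then {[r]} else {})"
| "strips M (k # ks) r = (\<Union>b\<in>{k..min M (k + r)}. (#) b ` strips k ks (r - (b - k)))"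

text \<open>The coefficient in the Pieri rule for e_r. In the column k, \<open>hd \<nu> - k\<close>
  boxes are added, and \<open>hd \<nu> - hd (tl \<nu>)\<close> is the number of rows of \<nu> ending
  there. A strip has one column more than the given partition; that last column would contribute a
  factor 1.\<close>

fun strip_weight :: "rat \<Rightarrow> nat list \<Rightarrow> nat list \<Rightarrow> rat" where
  "strip_weight q [] \<nu> = 1"
| "strip_weight q (k # ks) \<nu> =
    qbinomial q (hd \<nu> - hd (tl \<nu>)) (hd \<nu> - k) * strip_weight q ks (tl \<nu>)"

definition signed_weight :: "rat \<Rightarrow> nat list \<Rightarrow> rat"
  where "signed_weight q ks = (\<Prod>k\<leftarrow>ks. (- 1) ^ k / q ^ (k choose 2))"

lemma signed_weight_simps [simp]:
  "signed_weight q [] = 1"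
  "signed_weight q (k # ks) = (- 1) ^ k / q ^ (k choose 2) * signed_weight q ks"
  by (simp_all add: signed_weight_def)

lemma finite_strips [simp]: "finite (strips M ks r)"
  by (induction M ks r rule: strips.induct) auto

lemma sum_strips_Cons:
  "(\<Sum>\<nu>\<in>strips M (k # ks) r. f \<nu>) = (\<Sum>b=k..min M (k + r). \<Sum>\<nu>\<in>strips k ks (r - (b - k)). f (b # \<nu>))"
proof -
  have "(\<Sum>\<nu>\<in>strips M (k # ks) r. f \<nu>) = (\<Sum>b=k..min M (k + r). \<Sum>\<nu>\<in>(#) b ` strips k ks (r - (b - k)). f \<nu>)"
    unfolding strips.simps by (rule sum.UNION_disjoint) auto
  also have "\<dots> = (\<Sum>b=k..min M (k + r). \<Sum>\<nu>\<in>strips k ks (r - (b - k)). f (b # \<nu>))"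
  proof (rule sum.cong[OF refl])
    fix b
    show "sum f ((#) b ` strips k ks (r - (b - k))) = (\<Sum>\<nu>\<in>strips k ks (r - (b - k)). f (b # \<nu>))"
      by (rule sum.reindex_bij_witness[of _ "(#) b" tl]) auto
  qed
  finally show ?thesis .
qed

lemma length_strips: "\<nu> \<in> strips M ks r \<Longrightarrow> length \<nu> = Suc (length ks)"
  by (induction M ks r arbitrary: \<nu> rule: strips.induct) (auto split: if_splits)

text \<open>After expansion both sides have the same cross terms fe, ie and if. The comparisons of
  powers of q in \<open>card_invariant_between\<close> and \<open>moebius_weight_step\<close> reduce
  to this identity.\<close>

lemma hook_exponents:
  "((f + e) choose 2) + i * e + ((i + f) choose 2) = (f choose 2) + ((i + f + e) choose 2)"
  by (simp add: choose_two_add algebra_simps)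

locale finite_operator =
  fixes \<Delta> :: "'k::{field,finite} ^ 'n::finite ^ 'n" and q :: rat
  assumes q_card: "q = of_nat CARD('k)"
begin

lemma q_gt_1: "1 < q"
  using card_gt_1_field[where 'k='k] q_card by simp

text \<open>Two arguments separate the space of the vectors from the one that must contain their
  images: for \<open>A \<subseteq> U\<close>, the condition \<open>pre A U = D\<close> records which
  part of \<open>A\<close> is mapped into the larger \<open>U\<close>.\<close>

definition pre :: "('k ^ 'n) set \<Rightarrow> ('k ^ 'n) set \<Rightarrow> ('k ^ 'n) set"
  where "pre A U = {x \<in> A. \<Delta> *v x \<in> U}"

abbreviation core :: "('k ^ 'n) set \<Rightarrow> ('k ^ 'n) set"
  where "core A \<equiv> pre A A"

text \<open>For a subspace \<open>A\<close> this is also the growth in dimension from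
  \<open>A\<close> to A + \<Delta> A, by \<open>dim_pre\<close> with \<open>D = A\<close>.\<close>

definition jump :: "('k ^ 'n) set \<Rightarrow> nat"
  where "jump A = vec.dim A - vec.dim (core A)"

lemma linear_operator: "Vector_Spaces.linear (*s) (*s) ((*v) \<Delta>)"
  by (rule matrix_vector_mul_linear_gen)

lemma subspace_pre:
  assumes "vec.subspace A" "vec.subspace U"
  shows "vec.subspace (pre A U)"
proof (rule vec.subspaceI)
  note [simp] = pre_def vec.linear_0[OF linear_operator] vec.linear_add[OF linear_operator]
    vec.linear_scale[OF linear_operator]
  show "0 \<in> pre A U" using vec.subspace_0[OF assms(1)] vec.subspace_0[OF assms(2)] by simp
  show "x + y \<in> pre A U" if "x \<in> pre A U" "y \<in> pre A U" for x y
    using that vec.subspace_add[OF assms(1)] vec.subspace_add[OF assms(2)] by simp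
  show "c *s x \<in> pre A U" if "x \<in> pre A U" for c x
    using that vec.subspace_scale[OF assms(1)] vec.subspace_scale[OF assms(2)] by simp
qed

lemma pre_subset: "pre A U \<subseteq> A"
  by (auto simp: pre_def)

lemma dim_core_le: "vec.dim (core A) \<le> vec.dim A"
  using pre_subset by (rule vec.dim_subset)

lemma dim_eq_jump: "vec.dim A = jump A + vec.dim (core A)"
  using dim_core_le[of A] by (simp add: jump_def)

lemma dim_pre:
  assumes "vec.subspace A" "vec.subspace D"
  shows "vec.dim (vec.span (A \<union> (*v) \<Delta> ` D)) + vec.dim (pre D A) = vec.dim A + vec.dim D"
  unfolding pre_def by (rule dim_span_image[OF linear_operator assms])

lemma dim_add_jump_le:
  assumes "vec.subspace A" "vec.subspace V" "A \<subseteq> V" "pre A V = A"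
  shows "vec.dim A + jump A \<le> vec.dim V"
proof -
  have "vec.span (A \<union> (*v) \<Delta> ` A) \<subseteq> V"
    using assms by (intro vec.span_minimal) (auto simp: pre_def)
  then have "vec.dim (vec.span (A \<union> (*v) \<Delta> ` A)) \<le> vec.dim V" by (rule vec.dim_subset)
  then show ?thesis using dim_pre[OF assms(1,1)] dim_eq_jump[of A] by linarith
qed

text \<open>\<Delta> maps \<open>core A\<close> into \<open>A\<close>, so the preceding bound
  applies. The drops along a chain of cores therefore decrease weakly and form the columns of a
  partition.\<close>

lemma jump_core_le: "vec.subspace A \<Longrightarrow> jump (core A) \<le> jump A"
  using dim_add_jump_le[of "core A" A] subspace_pre[of A A] dim_eq_jump[of A]
  by (fastforce simp: pre_def)

text \<open>If \<open>core A \<subseteq> D\<close>, the condition \<open>pre A U = D\<close> says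
  that \<open>U\<close> meets A + \<Delta> A exactly in A + \<Delta> D, which leads to
  \<open>card_subspaces_avoiding\<close>. These spaces have dimensions
  \<open>vec.dim A + jump A\<close> and \<open>vec.dim D + jump A\<close>. If \<open>core A\<close>
  is not inside \<open>D\<close>, no \<open>U\<close> exists.\<close>

lemma card_extensions:
  assumes V: "vec.subspace V" and A: "vec.subspace A" and D: "vec.subspace D"
    and DA: "D \<subseteq> A" and AV: "A \<subseteq> V" "pre A V = A"
  shows "rat_of_nat (card {U. vec.subspace U \<and> A \<subseteq> U \<and> U \<subseteq> V \<and> vec.dim U = u \<and> pre A U = D}) =
    (if core A \<subseteq> D \<and> vec.dim D + jump A \<le> u
     then q ^ ((vec.dim A - vec.dim D) * (u - (vec.dim D + jump A))) *
       qbinomial q (vec.dim V - (vec.dim A + jump A)) (u - (vec.dim D + jump A))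
     else 0)"
proof (cases "core A \<subseteq> D")
  case False
  have "core A \<subseteq> D" if "A \<subseteq> U" "pre A U = D" for U
    using that by (auto simp: pre_def)
  then have "{U. vec.subspace U \<and> A \<subseteq> U \<and> U \<subseteq> V \<and> vec.dim U = u \<and> pre A U = D} = {}"
    using False by blast
  then show ?thesis using False by (simp only: card.empty of_nat_0 if_False simp_thms)
next
  case True
  define P where "P = vec.span (A \<union> (*v) \<Delta> ` D)"
  define P' where "P' = vec.span (A \<union> (*v) \<Delta> ` A)"
  have sP: "vec.subspace P" "vec.subspace P'" by (simp_all add: P_def P'_def vec.subspace_span)
  have PP': "P \<subseteq> P'" unfolding P_def P'_def using DA by (intro vec.span_mono) auto
  have P'V: "P' \<subseteq> V" unfolding P'_def using V AV by (intro vec.span_minimal) (auto simp: pre_def)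
  have "pre D A = core A" using True DA by (auto simp: pre_def)
  then have dP: "vec.dim P = vec.dim D + jump A" "vec.dim P' = vec.dim A + jump A"
    using dim_pre[OF A D] dim_pre[OF A A] dim_eq_jump[of A] by (auto simp: P_def P'_def)
  have AP: "A \<subseteq> P" unfolding P_def using vec.span_superset by blast
  have DP: "\<Delta> *v x \<in> P" if "x \<in> D" for x unfolding P_def using that by (auto intro: vec.span_base)
  have AP': "\<Delta> *v x \<in> P'" if "x \<in> A" for x unfolding P'_def using that by (auto intro: vec.span_base)
  have dec: "\<exists>a d. y = a + \<Delta> *v d \<and> a \<in> A \<and> d \<in> E"
    if y: "y \<in> vec.span (A \<union> (*v) \<Delta> ` E)" and E: "vec.subspace E" for y E
  proof -
    obtain a z where *: "y = a + z" "a \<in> vec.span A" "z \<in> vec.span ((*v) \<Delta> ` E)"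
      using y unfolding vec.span_Un by blast
    have "a \<in> A" using *(2) vec.span_eq_iff[THEN iffD2, OF A] by simp
    moreover have "z \<in> (*v) \<Delta> ` E"
      using *(3) vec.span_eq_iff[THEN iffD2, OF vec.linear_subspace_image[OF linear_operator E]] by simp
    ultimately show ?thesis using *(1) by blast
  qed
  have iff: "(A \<subseteq> U \<and> U \<subseteq> V \<and> pre A U = D) \<longleftrightarrow> (P \<subseteq> U \<and> U \<subseteq> V \<and> U \<inter> P' = P)" if U: "vec.subspace U" for U
  proof
    assume *: "A \<subseteq> U \<and> U \<subseteq> V \<and> pre A U = D"
    then have PU: "P \<subseteq> U" unfolding P_def using U by (intro vec.span_minimal) (auto simp: pre_def)
    moreover have "U \<inter> P' \<subseteq> P"
    proof
      fix y assume y: "y \<in> U \<inter> P'"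
      then obtain a d where ad: "y = a + \<Delta> *v d" "a \<in> A" "d \<in> A"
        using dec[of y A] A unfolding P'_def by blast
      have "\<Delta> *v d = y - a" using ad by simp
      also have "y - a \<in> U" using y ad * U by (intro vec.subspace_diff) auto
      finally have "d \<in> D" using ad * by (auto simp: pre_def)
      then show "y \<in> P" using ad DP AP sP(1) by (auto intro!: vec.subspace_add)
    qed
    ultimately show "P \<subseteq> U \<and> U \<subseteq> V \<and> U \<inter> P' = P" using * PP' by blast
  next
    assume *: "P \<subseteq> U \<and> U \<subseteq> V \<and> U \<inter> P' = P"
    have "pre A U \<subseteq> D"
    proof
      fix x assume x: "x \<in> pre A U"
      then have "\<Delta> *v x \<in> P" using * AP' by (auto simp: pre_def)
      then obtain a d where ad: "\<Delta> *v x = a + \<Delta> *v d" "a \<in> A" "d \<in> D"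
        using dec[of "\<Delta> *v x" D] D unfolding P_def by blast
      \<comment> \<open>Here \<open>core A \<subseteq> D\<close> enters: x and d have the same image
        modulo \<open>A\<close>, so x - d lies in \<open>core A\<close>.\<close>
      have "\<Delta> *v (x - d) = a" using ad by (simp add: vec.linear_diff[OF linear_operator])
      moreover have "x - d \<in> A" using x ad DA A by (auto simp: pre_def intro!: vec.subspace_diff)
      ultimately have "x - d \<in> D" using ad True by (auto simp: pre_def)
      then have "x - d + d \<in> D" using ad D by (intro vec.subspace_add)
      then show "x \<in> D" by simp
    qed
    moreover have "D \<subseteq> pre A U" using DA DP * by (auto simp: pre_def)
    ultimately show "A \<subseteq> U \<and> U \<subseteq> V \<and> pre A U = D" using * AP by blast
  qed
  have eq: "{U. vec.subspace U \<and> A \<subseteq> U \<and> U \<subseteq> V \<and> vec.dim U = u \<and> pre A U = D} =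
      {U. vec.subspace U \<and> P \<subseteq> U \<and> U \<subseteq> V \<and> U \<inter> P' = P \<and> vec.dim U = u}"
  proof (rule Collect_cong)
    fix U
    show "(vec.subspace U \<and> A \<subseteq> U \<and> U \<subseteq> V \<and> vec.dim U = u \<and> pre A U = D) \<longleftrightarrow>
      (vec.subspace U \<and> P \<subseteq> U \<and> U \<subseteq> V \<and> U \<inter> P' = P \<and> vec.dim U = u)"
      using iff[of U] by argo
  qed
  show ?thesis
  proof (cases "vec.dim P \<le> u")
    case le: True
    have "rat_of_nat (card {U. vec.subspace U \<and> P \<subseteq> U \<and> U \<subseteq> V \<and> U \<inter> P' = P \<and> vec.dim U = vec.dim P + (u - vec.dim P)})
        = q ^ ((u - vec.dim P) * (vec.dim P' - vec.dim P)) * qbinomial q (vec.dim V - vec.dim P') (u - vec.dim P)"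
      by (rule card_subspaces_avoiding[OF q_card V sP PP' P'V])
    then show ?thesis using le True unfolding eq dP by (simp add: mult.commute)
  next
    case False
    have "vec.dim P \<le> vec.dim U" if "P \<subseteq> U" for U using that by (rule vec.dim_subset)
    then have "{U. vec.subspace U \<and> P \<subseteq> U \<and> U \<subseteq> V \<and> U \<inter> P' = P \<and> vec.dim U = u} = {}"
      using False by blast
    then show ?thesis using False unfolding eq dP by (simp only: card.empty of_nat_0 if_False simp_thms)
  qed
qed

text \<open>Moebius inversion: a subspace \<open>A\<close> contributes iff it meets \<open>core U\<close> exactly in \<open>D\<close>.\<close>

lemma invariant_indicator:
  assumes U: "vec.subspace U" and D: "vec.subspace D" "D \<subseteq> core U"
  defines "w \<equiv> vec.dim U - vec.dim D"
  shows "(\<Sum>A | vec.subspace A \<and> D \<subseteq> A \<and> A \<subseteq> U \<and> pre A U = D.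
      (- 1) ^ (vec.dim A - vec.dim D) * q ^ (w - (vec.dim A - vec.dim D) choose 2))
    = (if core U = U then q ^ (w choose 2) else 0)"
proof -
  let ?S = "{A. vec.subspace A \<and> D \<subseteq> A \<and> A \<subseteq> U \<and> pre A U = D}"
  define f where "f j = (- 1) ^ j * q ^ (w - j choose 2)" for j :: nat
  define s where "s = vec.dim (core U) - vec.dim D"
  define \<rho> where "\<rho> = vec.dim U - vec.dim (core U)"
  have le: "vec.dim D \<le> vec.dim (core U)" "vec.dim (core U) \<le> vec.dim U"
    using D(2) dim_core_le by (auto intro: vec.dim_subset)
  have w: "w = \<rho> + s" using le by (simp add: w_def s_def \<rho>_def)
  have DU: "D \<subseteq> U" using D(2) pre_subset by blast
  have "(\<Sum>A\<in>?S. f (vec.dim A - vec.dim D)) =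
      (\<Sum>j\<le>w. \<Sum>A | A \<in> ?S \<and> vec.dim A - vec.dim D = j. f (vec.dim A - vec.dim D))"
    by (rule sum.group[symmetric]) (auto simp: w_def intro!: diff_le_mono vec.dim_subset)
  also have "\<dots> = (\<Sum>j\<le>w. f j * (q ^ (j * s) * qbinomial q \<rho> j))"
  proof (rule sum.cong[OF refl])
    fix j
    have "{A. A \<in> ?S \<and> vec.dim A - vec.dim D = j} =
        {A. vec.subspace A \<and> D \<subseteq> A \<and> A \<subseteq> U \<and> A \<inter> core U = D \<and> vec.dim A = vec.dim D + j}"
    proof -
      have "pre A U = A \<inter> core U" if "A \<subseteq> U" for A using that by (auto simp: pre_def)
      moreover have "vec.dim A - vec.dim D = j \<longleftrightarrow> vec.dim A = vec.dim D + j" if "D \<subseteq> A" for A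
        using vec.dim_subset[OF that] by auto
      ultimately show ?thesis by blast
    qed
    then have "rat_of_nat (card {A. A \<in> ?S \<and> vec.dim A - vec.dim D = j}) = q ^ (j * s) * qbinomial q \<rho> j"
      using card_subspaces_avoiding[OF q_card U D(1) subspace_pre[OF U U] D(2) pre_subset, of j]
      by (simp add: s_def \<rho>_def)
    then show "(\<Sum>A | A \<in> ?S \<and> vec.dim A - vec.dim D = j. f (vec.dim A - vec.dim D)) =
        f j * (q ^ (j * s) * qbinomial q \<rho> j)"
      by simp
  qed
  also have "\<dots> = (\<Sum>j\<le>\<rho>. f j * (q ^ (j * s) * qbinomial q \<rho> j))"
    by (rule sum.mono_neutral_right) (auto simp: w qbinomial_eq_0)
  \<comment> \<open>Since w = \<rho> + s, the exponents differ from those of the alternating sum for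
    \<rho> by an amount free of j. So the sum survives only for \<rho> = 0, that is, for invariant
    \<open>U\<close>.\<close>
  also have "\<dots> = (\<Sum>j\<le>\<rho>. q ^ ((s choose 2) + \<rho> * s) * ((- 1) ^ j * q ^ (\<rho> - j choose 2) * qbinomial q \<rho> j))"
  proof (rule sum.cong[OF refl])
    fix j assume "j \<in> {..\<rho>}"
    then obtain e where e: "\<rho> = j + e" using le_Suc_ex by auto
    have e1: "q ^ (w - j choose 2) * q ^ (j * s) = q ^ ((s choose 2) + \<rho> * s) * q ^ (\<rho> - j choose 2)"
      unfolding power_add[symmetric] w e by (simp add: choose_two_add algebra_simps)
    have e2: "f j * (q ^ (j * s) * qbinomial q \<rho> j) =
        (- 1) ^ j * (q ^ (w - j choose 2) * q ^ (j * s)) * qbinomial q \<rho> j"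
      unfolding f_def by (simp only: mult.assoc)
    show "f j * (q ^ (j * s) * qbinomial q \<rho> j) =
        q ^ ((s choose 2) + \<rho> * s) * ((- 1) ^ j * q ^ (\<rho> - j choose 2) * qbinomial q \<rho> j)"
      unfolding e2 e1 by (simp only: ac_simps)
  qed
  also have "\<dots> = q ^ ((s choose 2) + \<rho> * s) * (if \<rho> = 0 then 1 else 0)"
    using q_gt_1 by (simp add: sum_distrib_left[symmetric] qbinomial_alternating_sum)
  also have "\<dots> = (if core U = U then q ^ (w choose 2) else 0)"
  proof -
    have "\<rho> = 0 \<longleftrightarrow> core U = U"
      using subspace_eq_of_dim_le[OF subspace_pre[OF U U] U pre_subset] le by (auto simp: \<rho>_def)
    then show ?thesis by (auto simp: w)
  qed
  finally show ?thesis by (simp add: f_def)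
qed

text \<open>The coefficient of \<open>A\<close> when n is \<open>jump A\<close> and j is the
  codimension of \<open>D\<close> in \<open>A\<close>. The summand of
  \<open>invariant_indicator\<close>, divided by q^(w choose 2), depends on w; the power of q in the
  number of \<open>U\<close> above \<open>A\<close> cancels this dependence.\<close>

definition moebius_weight :: "nat \<Rightarrow> nat \<Rightarrow> rat"
  where "moebius_weight n j = (- 1) ^ j * q ^ (n - j choose 2) / q ^ (n choose 2)"

text \<open>The invariance of \<open>U\<close> is tested by \<open>invariant_indicator\<close>;
  after the sums are exchanged, the \<open>U\<close> above a fixed \<open>A\<close> are counted by
  \<open>card_extensions\<close>.\<close>

lemma card_invariant_between:
  assumes V: "vec.subspace V" "core V = V" and D: "vec.subspace D" "D \<subseteq> V"
  shows "rat_of_nat (card {U. vec.subspace U \<and> core U = U \<and> D \<subseteq> U \<and> U \<subseteq> V \<and> vec.dim U = vec.dim D + w})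
    = (\<Sum>A | vec.subspace A \<and> D \<subseteq> A \<and> A \<subseteq> V \<and> core A \<subseteq> D. moebius_weight (jump A) (vec.dim A - vec.dim D) *
        (if jump A \<le> w then qbinomial q (vec.dim V - (vec.dim A + jump A)) (w - jump A) else 0))"
proof -
  \<comment> \<open>\<open>pre D U = D\<close> says that \<Delta> maps \<open>D\<close> into
    \<open>U\<close>. Every invariant \<open>U\<close> containing \<open>D\<close> satisfies this,
    and it provides \<open>D \<subseteq> core U\<close> for the indicator.\<close>
  let ?W = "{U. vec.subspace U \<and> D \<subseteq> U \<and> U \<subseteq> V \<and> pre D U = D \<and> vec.dim U = vec.dim D + w}"
  let ?A = "{A. vec.subspace A \<and> D \<subseteq> A \<and> A \<subseteq> V}"
  define f where "f A = (- 1) ^ (vec.dim A - vec.dim D) * q ^ (w - (vec.dim A - vec.dim D) choose 2) / q ^ (w choose 2)" for A :: "('k ^ 'n) set"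
  have ind: "(\<Sum>A | A \<in> ?A \<and> A \<subseteq> U \<and> pre A U = D. f A) = (if core U = U then 1 else 0)"
    if U: "U \<in> ?W" for U
  proof -
    have "D \<subseteq> core U" using U by (auto simp: pre_def)
    moreover have "{A. A \<in> ?A \<and> A \<subseteq> U \<and> pre A U = D} = {A. vec.subspace A \<and> D \<subseteq> A \<and> A \<subseteq> U \<and> pre A U = D}"
      using U by auto
    ultimately show ?thesis
      using invariant_indicator[of U D] U D q_gt_1
      by (simp add: f_def sum_divide_distrib[symmetric])
  qed
  have "{U. vec.subspace U \<and> core U = U \<and> D \<subseteq> U \<and> U \<subseteq> V \<and> vec.dim U = vec.dim D + w} = {U \<in> ?W. core U = U}"
    by (auto simp: pre_def)
  then have "rat_of_nat (card {U. vec.subspace U \<and> core U = U \<and> D \<subseteq> U \<and> U \<subseteq> V \<and> vec.dim U = vec.dim D + w})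
      = (\<Sum>U\<in>?W. if core U = U then 1 else 0)"
    by (simp add: sum.If_cases Int_def conj_commute)
  also have "\<dots> = (\<Sum>U\<in>?W. \<Sum>A | A \<in> ?A \<and> A \<subseteq> U \<and> pre A U = D. f A)"
    using ind by (intro sum.cong) auto
  also have "\<dots> = (\<Sum>A\<in>?A. \<Sum>U | U \<in> ?W \<and> A \<subseteq> U \<and> pre A U = D. f A)"
    by (rule sum.swap_restrict) auto
  also have "\<dots> = (\<Sum>A\<in>?A. f A * (if core A \<subseteq> D \<and> jump A \<le> w
     then q ^ ((vec.dim A - vec.dim D) * (w - jump A)) *
       qbinomial q (vec.dim V - (vec.dim A + jump A)) (w - jump A) else 0))"
  proof (rule sum.cong[OF refl])
    fix A assume A: "A \<in> ?A"
    \<comment> \<open>For \<open>D \<subseteq> A\<close>, the condition \<open>pre A U = D\<close>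
      already implies \<open>pre D U = D\<close>.\<close>
    have "{U. U \<in> ?W \<and> A \<subseteq> U \<and> pre A U = D} =
        {U. vec.subspace U \<and> A \<subseteq> U \<and> U \<subseteq> V \<and> vec.dim U = vec.dim D + w \<and> pre A U = D}"
      using A by (auto simp: pre_def)
    moreover have "pre A V = A" using A V(2) by (auto simp: pre_def)
    ultimately have "rat_of_nat (card {U. U \<in> ?W \<and> A \<subseteq> U \<and> pre A U = D}) =
       (if core A \<subseteq> D \<and> jump A \<le> w
     then q ^ ((vec.dim A - vec.dim D) * (w - jump A)) *
       qbinomial q (vec.dim V - (vec.dim A + jump A)) (w - jump A) else 0)"
      using card_extensions[OF V(1) _ D(1), of A "vec.dim D + w"] A by simp
    then show "(\<Sum>U | U \<in> ?W \<and> A \<subseteq> U \<and> pre A U = D. f A) = f A * (if core A \<subseteq> D \<and> jump A \<le> w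
     then q ^ ((vec.dim A - vec.dim D) * (w - jump A)) *
       qbinomial q (vec.dim V - (vec.dim A + jump A)) (w - jump A) else 0)"
      by (simp add: mult.commute)
  qed
  also have "\<dots> = (\<Sum>A\<in>{A \<in> ?A. core A \<subseteq> D}. moebius_weight (jump A) (vec.dim A - vec.dim D) *
        (if jump A \<le> w then qbinomial q (vec.dim V - (vec.dim A + jump A)) (w - jump A) else 0))"
  proof (rule sum.mono_neutral_cong_right)
    fix A assume A: "A \<in> {A \<in> ?A. core A \<subseteq> D}"
    show "f A * (if core A \<subseteq> D \<and> jump A \<le> w
     then q ^ ((vec.dim A - vec.dim D) * (w - jump A)) *
       qbinomial q (vec.dim V - (vec.dim A + jump A)) (w - jump A) else 0) =
       moebius_weight (jump A) (vec.dim A - vec.dim D) *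
        (if jump A \<le> w then qbinomial q (vec.dim V - (vec.dim A + jump A)) (w - jump A) else 0)"
    proof (cases "jump A \<le> w")
      case True
      define j where "j = vec.dim A - vec.dim D"
      have "vec.dim (core A) \<le> vec.dim D" using A by (intro vec.dim_subset) auto
      then have "j \<le> jump A" by (simp add: j_def jump_def)
      then obtain g where g: "jump A = j + g" using le_Suc_ex by blast
      obtain e where e: "w = jump A + e" using True le_Suc_ex by blast
      have "q ^ (w - j choose 2) * q ^ (j * (w - jump A)) * q ^ (jump A choose 2)
          = q ^ (jump A - j choose 2) * q ^ (w choose 2)"
        unfolding power_add[symmetric] e g using hook_exponents[of g e j] by (simp add: add.assoc)
      then have "f A * q ^ (j * (w - jump A)) = moebius_weight (jump A) j"
        using q_gt_1 unfolding f_def moebius_weight_def j_def[symmetric] by (simp add: field_simps)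
      then show ?thesis using A True by (simp add: j_def mult.assoc[symmetric])
    qed simp
  qed auto
  finally show ?thesis by (simp add: conj_assoc)
qed

text \<open>For invariant \<open>D\<close> every \<open>A\<close> in
  \<open>card_invariant_between\<close> has \<open>core A = D\<close>, hence dimension
  \<open>vec.dim D + jump A\<close>. Its Gaussian binomial has upper index w + w' - 2
  \<open>jump A\<close> and lower index w - \<open>jump A\<close>, so it is symmetric in w and w'.
  The symmetry of the flag generating function rests on this.\<close>

lemma card_invariant_symmetric:
  assumes V: "vec.subspace V" "core V = V" and D: "vec.subspace D" "core D = D" "D \<subseteq> V"
    and dim: "vec.dim V = vec.dim D + w + w'"
  shows "card {U. vec.subspace U \<and> core U = U \<and> D \<subseteq> U \<and> U \<subseteq> V \<and> vec.dim U = vec.dim D + w} =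
    card {U. vec.subspace U \<and> core U = U \<and> D \<subseteq> U \<and> U \<subseteq> V \<and> vec.dim U = vec.dim D + w'}"
proof -
  have "(if jump A \<le> w then qbinomial q (vec.dim V - (vec.dim A + jump A)) (w - jump A) else 0)
      = (if jump A \<le> w' then qbinomial q (vec.dim V - (vec.dim A + jump A)) (w' - jump A) else 0)"
    if A: "vec.subspace A \<and> D \<subseteq> A \<and> A \<subseteq> V \<and> core A \<subseteq> D" for A
  proof -
    have "core A = D" using A D(2) by (auto simp: pre_def)
    then have a: "vec.dim A = vec.dim D + jump A" using dim_eq_jump[of A] by simp
    have "pre A V = A" using A V(2) by (auto simp: pre_def)
    then have "vec.dim A + jump A \<le> vec.dim V" using dim_add_jump_le[of A V] A V by blast
    then have le: "2 * jump A \<le> w + w'" using a dim by simp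
    have n: "vec.dim V - (vec.dim A + jump A) = w + w' - 2 * jump A" using a dim by simp
    show ?thesis
    proof (cases "jump A \<le> w \<and> jump A \<le> w'")
      case True
      then have "w' - jump A = (w + w' - 2 * jump A) - (w - jump A)" "w - jump A \<le> w + w' - 2 * jump A"
        by auto
      then show ?thesis
        using True q_gt_1 qbinomial_symmetric[of q "w - jump A" "w + w' - 2 * jump A"] unfolding n by simp
    next
      \<comment> \<open>By \<open>le\<close>, \<open>jump A\<close> exceeds just one of w and w';
        then the lower index exceeds the upper one.\<close>
      case False
      then show ?thesis using le unfolding n by (auto simp: qbinomial_eq_0)
    qed
  qed
  then have "rat_of_nat (card {U. vec.subspace U \<and> core U = U \<and> D \<subseteq> U \<and> U \<subseteq> V \<and> vec.dim U = vec.dim D + w}) =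
    rat_of_nat (card {U. vec.subspace U \<and> core U = U \<and> D \<subseteq> U \<and> U \<subseteq> V \<and> vec.dim U = vec.dim D + w'})"
    unfolding card_invariant_between[OF V D(1,3)] by (intro sum.cong) auto
  then show ?thesis by (simp only: of_nat_eq_iff)
qed

end

section \<open>Chains of cores\<close>

context finite_operator
begin

text \<open>Since \<open>core {0} = {0}\<close>, trailing zeros are allowed, in agreement with
  \<open>strips\<close>.\<close>

fun profile :: "('k ^ 'n) set \<Rightarrow> nat list \<Rightarrow> bool" where
  "profile D [] \<longleftrightarrow> D = {0}"
| "profile D (k # ks) \<longleftrightarrow> vec.dim D = k + vec.dim (core D) \<and> profile (core D) ks"

text \<open>Those \<open>D\<close> for which \<open>A\<close> occurs in the sum of
  \<open>card_invariant_between\<close>, sorted by codimension and profile.\<close>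

definition between :: "('k ^ 'n) set \<Rightarrow> nat list \<Rightarrow> nat \<Rightarrow> ('k ^ 'n) set set"
  where "between A ks j =
    {D. vec.subspace D \<and> core A \<subseteq> D \<and> D \<subseteq> A \<and> vec.dim A = vec.dim D + j \<and> profile D ks}"

lemma profile_Cons_iff: "profile A (b # \<nu>) \<longleftrightarrow> b = jump A \<and> profile (core A) \<nu>"
  using dim_eq_jump[of A] by auto

declare profile.simps(2) [simp del]

lemma hd_profile: "profile A \<nu> \<Longrightarrow> \<nu> \<noteq> [] \<Longrightarrow> hd \<nu> = jump A"
  by (cases \<nu>) (auto simp: profile_Cons_iff)

lemma core_zero [simp]: "core {0} = {0}"
  by (auto simp: pre_def)

lemma card_between_Nil:
  assumes "vec.subspace A"
  shows "card (between A [] j) = (if core A = {0} \<and> vec.dim A = j then 1 else 0)"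
proof -
  have "0 \<in> core A" using subspace_pre[OF assms assms] by (rule vec.subspace_0)
  then have "between A [] j = (if core A = {0} \<and> vec.dim A = j then {{0}} else {})"
    using vec.subspace_0[OF assms] by (auto simp: between_def vec.subspace_single_0)
  then show ?thesis by simp
qed

text \<open>For \<open>D\<close> between \<open>core A\<close> and \<open>A\<close> one has
  \<open>core D = pre (core A) D\<close>, so \<open>E = core D\<close> lies between the core of
  \<open>core A\<close> and \<open>core A\<close>. The \<open>D\<close> belonging to a given
  \<open>E\<close> are counted by \<open>card_extensions\<close> for \<open>core A\<close> inside
  \<open>A\<close>.\<close>

lemma card_between_Cons:
  assumes A: "vec.subspace A"
  shows "rat_of_nat (card (between A (k # ks) j)) =
    (if jump (core A) \<le> k \<and> k \<le> jump A \<and> jump A \<le> k + j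
     then q ^ ((k + j - jump A) * (k - jump (core A))) *
       qbinomial q (jump A - jump (core A)) (k - jump (core A)) *
       of_nat (card (between (core A) ks (k + j - jump A)))
     else 0)"
proof -
  let ?C = "core A"
  define S where "S = {E. vec.subspace E \<and> E \<subseteq> ?C \<and> profile E ks \<and> vec.dim A = k + vec.dim E + j}"
  have C: "vec.subspace ?C" by (rule subspace_pre[OF A A])
  have CA: "?C \<subseteq> A" by (rule pre_subset)
  have preC: "pre ?C A = ?C" by (auto simp: pre_def)
  have dimA: "vec.dim A = jump A + vec.dim ?C" by (rule dim_eq_jump)
  have le: "jump ?C \<le> jump A" by (rule jump_core_le[OF A])
  have core_D: "core D = pre ?C D" if "?C \<subseteq> D" "D \<subseteq> A" for D
    using that by (auto simp: pre_def)
  have eq: "between A (k # ks) j =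
     (\<Union>E\<in>S. {D. vec.subspace D \<and> ?C \<subseteq> D \<and> D \<subseteq> A \<and> vec.dim D = vec.dim E + k \<and> pre ?C D = E})"
    (is "_ = (\<Union>E\<in>S. ?X E)")
  proof (intro equalityI subsetI)
    fix D assume D: "D \<in> between A (k # ks) j"
    then have "core D = pre ?C D" by (intro core_D) (auto simp: between_def)
    then have "pre ?C D \<in> S" "D \<in> ?X (pre ?C D)"
      using D C subspace_pre[OF C, of D] pre_subset[of ?C D] by (auto simp: between_def S_def profile.simps(2))
    then show "D \<in> (\<Union>E\<in>S. ?X E)" by blast
  next
    fix D assume "D \<in> (\<Union>E\<in>S. ?X E)"
    then obtain E where "E \<in> S" "D \<in> ?X E" by blast
    moreover from this have "core D = pre ?C D" by (intro core_D) auto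
    ultimately show "D \<in> between A (k # ks) j" by (auto simp: between_def S_def profile.simps(2))
  qed
  have "card (between A (k # ks) j) = (\<Sum>E\<in>S. card (?X E))"
    unfolding eq by (rule card_UN_disjoint) auto
  then have "rat_of_nat (card (between A (k # ks) j)) = (\<Sum>E\<in>S. rat_of_nat (card (?X E)))"
    by simp
  also have "\<dots> = (\<Sum>E\<in>S. if core ?C \<subseteq> E \<and> jump ?C \<le> k
     then q ^ ((k + j - jump A) * (k - jump ?C)) * qbinomial q (jump A - jump ?C) (k - jump ?C) else 0)"
  proof (rule sum.cong[OF refl])
    fix E assume E: "E \<in> S"
    then have "rat_of_nat (card {D. vec.subspace D \<and> ?C \<subseteq> D \<and> D \<subseteq> A \<and> vec.dim D = vec.dim E + k \<and> pre ?C D = E}) =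
      (if core ?C \<subseteq> E \<and> vec.dim E + jump ?C \<le> vec.dim E + k
       then q ^ ((vec.dim ?C - vec.dim E) * (vec.dim E + k - (vec.dim E + jump ?C))) *
       qbinomial q (vec.dim A - (vec.dim ?C + jump ?C)) (vec.dim E + k - (vec.dim E + jump ?C)) else 0)"
      by (intro card_extensions[OF A C _ _ CA preC]) (auto simp: S_def)
    moreover have "vec.dim ?C - vec.dim E = k + j - jump A" "vec.dim A - (vec.dim ?C + jump ?C) = jump A - jump ?C"
      using E dimA by (auto simp: S_def)
    ultimately show "rat_of_nat (card (?X E)) = (if core ?C \<subseteq> E \<and> jump ?C \<le> k
     then q ^ ((k + j - jump A) * (k - jump ?C)) * qbinomial q (jump A - jump ?C) (k - jump ?C) else 0)"
      by simp
  qed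
  also have "\<dots> = (if jump ?C \<le> k then of_nat (card {E \<in> S. core ?C \<subseteq> E}) *
     (q ^ ((k + j - jump A) * (k - jump ?C)) * qbinomial q (jump A - jump ?C) (k - jump ?C)) else 0)"
    by (simp add: sum.If_cases Int_def)
  also have "\<dots> = (if jump ?C \<le> k \<and> k \<le> jump A \<and> jump A \<le> k + j
     then q ^ ((k + j - jump A) * (k - jump ?C)) * qbinomial q (jump A - jump ?C) (k - jump ?C) *
       of_nat (card (between ?C ks (k + j - jump A))) else 0)"
  proof (cases "jump ?C \<le> k \<and> k \<le> jump A")
    case False
    then show ?thesis using le by (auto simp: qbinomial_eq_0)
  next
    case True
    show ?thesis
    proof (cases "jump A \<le> k + j")
      case le2: True
      have "{E \<in> S. core ?C \<subseteq> E} = between ?C ks (k + j - jump A)"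
        using dimA le2 by (auto simp: S_def between_def)
      then show ?thesis using True le2 by (simp add: mult.commute)
    next
      case False
      have "vec.dim E \<le> vec.dim ?C" if "E \<in> S" for E
        using that by (intro vec.dim_subset) (auto simp: S_def)
      then have "S = {}" using False dimA by (fastforce simp: S_def)
      then show ?thesis using False by simp
    qed
  qed
  finally show ?thesis .
qed

text \<open>One step down the chain of cores: the power of q from \<open>card_between_Cons\<close>
  and the factor of \<open>signed_weight\<close> at k turn the weight of \<open>A\<close> into that
  of \<open>core A\<close>, and the factor of \<open>signed_weight\<close> at n1 comes out. Here n1
  and n2 are the jumps of \<open>A\<close> and \<open>core A\<close>, and \<open>k + j - n1\<close>
  is the new codimension.\<close>

lemma moebius_weight_step:
  assumes "n2 \<le> k" "k \<le> n1" "n1 \<le> k + j" "k + j - n1 \<le> n2"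
  shows "moebius_weight n1 j * q ^ ((k + j - n1) * (k - n2)) * ((- 1) ^ k / q ^ (k choose 2)) =
     (- 1) ^ n1 / q ^ (n1 choose 2) * moebius_weight n2 (k + j - n1)"
proof -
  define i where "i = k + j - n1"
  obtain e where e: "k = n2 + e" using assms(1) le_Suc_ex by blast
  obtain f where f: "n2 = i + f" using assms(4) le_Suc_ex unfolding i_def by blast
  have n1j: "n1 - j = k - i" "n1 + i = k + j" using assms by (auto simp: i_def)
  have "k - i = f + e" using e f by simp
  then have "(n1 - j choose 2) + i * (k - n2) + (n2 choose 2) = (n2 - i choose 2) + (k choose 2)"
    unfolding n1j(1) using hook_exponents[of f e i] e f by simp
  then have p: "q ^ (n1 - j choose 2) * q ^ (i * (k - n2)) * q ^ (n2 choose 2) =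
      q ^ (n2 - i choose 2) * q ^ (k choose 2)"
    by (metis power_add)
  have s: "(- 1 :: rat) ^ j * (- 1) ^ k = (- 1) ^ n1 * (- 1) ^ i"
    using n1j(2) by (metis power_add add.commute)
  have "moebius_weight n1 j * q ^ (i * (k - n2)) * ((- 1) ^ k / q ^ (k choose 2)) =
    ((- 1) ^ j * (- 1) ^ k) * (q ^ (n1 - j choose 2) * q ^ (i * (k - n2)) * q ^ (n2 choose 2)) /
      (q ^ (n1 choose 2) * q ^ (k choose 2) * q ^ (n2 choose 2))"
    using q_gt_1 by (simp add: moebius_weight_def)
  also have "\<dots> = (- 1) ^ n1 / q ^ (n1 choose 2) * moebius_weight n2 i"
    unfolding p s using q_gt_1 by (simp add: moebius_weight_def)
  finally show ?thesis by (simp add: i_def)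
qed

text \<open>All strips here have the same length, and \<open>A\<close> has at most one profile of
  that length, so the left side has at most one nonzero term. The weighted number of
  \<open>D\<close> with columns \<open>ks\<close> below \<open>A\<close> is thus a Pieri coefficient
  between \<open>ks\<close> and the profile of \<open>A\<close>; this is how strips enter the
  count.\<close>

lemma sum_strips_profile:
  assumes "vec.subspace A"
  shows "(\<Sum>\<nu>\<in>strips M ks j. if profile A \<nu> then strip_weight q ks \<nu> * signed_weight q \<nu> else 0) =
    (if jump A \<le> M then moebius_weight (jump A) j * of_nat (card (between A ks j)) * signed_weight q ks else 0)"
  using assms
proof (induction ks arbitrary: A M j)
  case Nil
  have "profile A [j] \<longleftrightarrow> core A = {0} \<and> vec.dim A = j" by (auto simp: profile.simps(2))
  moreover have "jump A = j" if "core A = {0} \<and> vec.dim A = j" using that by (simp add: jump_def)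
  ultimately show ?case by (auto simp: card_between_Nil[OF Nil] moebius_weight_def)
next
  case (Cons k ks)
  let ?C = "core A"
  have C: "vec.subspace ?C" by (rule subspace_pre[OF Cons.prems Cons.prems])
  let ?w = "\<lambda>\<nu>. (if profile A \<nu> then strip_weight q (k # ks) \<nu> * signed_weight q \<nu> else 0)"
  have "(\<Sum>\<nu>\<in>strips M (k # ks) j. ?w \<nu>) =
     (\<Sum>b=k..min M (k + j). if b = jump A then \<Sum>\<nu>\<in>strips k ks (j - (b - k)). ?w (b # \<nu>) else 0)"
    unfolding sum_strips_Cons by (intro sum.cong refl) (simp add: profile_Cons_iff)
  also have "\<dots> = (if k \<le> jump A \<and> jump A \<le> M \<and> jump A \<le> k + j
     then \<Sum>\<nu>\<in>strips k ks (k + j - jump A). ?w (jump A # \<nu>) else 0)"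
    by (simp add: sum.delta' add.commute)
  also have "\<dots> = (if k \<le> jump A \<and> jump A \<le> M \<and> jump A \<le> k + j
     then qbinomial q (jump A - jump ?C) (jump A - k) * ((- 1) ^ jump A / q ^ (jump A choose 2)) *
      (\<Sum>\<nu>\<in>strips k ks (k + j - jump A). if profile ?C \<nu> then strip_weight q ks \<nu> * signed_weight q \<nu> else 0)
     else 0)"
  proof -
    have "?w (jump A # \<nu>) = qbinomial q (jump A - jump ?C) (jump A - k) * ((- 1) ^ jump A / q ^ (jump A choose 2)) *
       (if profile ?C \<nu> then strip_weight q ks \<nu> * signed_weight q \<nu> else 0)"
      if "\<nu> \<in> strips k ks (k + j - jump A)" for \<nu>
    proof -
      have "\<nu> \<noteq> []" using length_strips[OF that] by auto
      then show ?thesis using hd_profile[of ?C \<nu>] by (auto simp: profile_Cons_iff)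
    qed
    then show ?thesis by (simp add: sum_distrib_left cong: sum.cong)
  qed
  also have "\<dots> = (if jump A \<le> M then moebius_weight (jump A) j * of_nat (card (between A (k # ks) j)) * signed_weight q (k # ks) else 0)"
  proof (cases "k \<le> jump A \<and> jump A \<le> M \<and> jump A \<le> k + j \<and> jump ?C \<le> k")
    case False
    then show ?thesis
      using Cons.IH[OF C, of k "k + j - jump A"] card_between_Cons[OF Cons.prems, of k ks j] by auto
  next
    case True
    define i where "i = k + j - jump A"
    show ?thesis
    proof (cases "between ?C ks i = {}")
      case empty: True
      then show ?thesis
        using True Cons.IH[OF C, of k "k + j - jump A"] card_between_Cons[OF Cons.prems, of k ks j]
        by (simp add: i_def)
    next
      case False
      \<comment> \<open>A member \<open>D\<close> of \<open>between\<close> gives the bound on i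
        that \<open>moebius_weight_step\<close> requires.\<close>
      then obtain D where "core ?C \<subseteq> D" "vec.dim ?C = vec.dim D + i" by (auto simp: between_def)
      then have "i \<le> jump ?C" using vec.dim_subset[of "core ?C" D] dim_eq_jump[of ?C] by simp
      then have h: "moebius_weight (jump A) j * q ^ (i * (k - jump ?C)) * ((- 1) ^ k / q ^ (k choose 2)) =
          (- 1) ^ jump A / q ^ (jump A choose 2) * moebius_weight (jump ?C) i"
        using moebius_weight_step[of "jump ?C" k "jump A" j] True by (simp add: i_def)
      have "jump A - k = (jump A - jump ?C) - (k - jump ?C)" "k - jump ?C \<le> jump A - jump ?C"
        using True by auto
      then have b: "qbinomial q (jump A - jump ?C) (jump A - k) = qbinomial q (jump A - jump ?C) (k - jump ?C)"
        using qbinomial_symmetric[of q "k - jump ?C" "jump A - jump ?C"] q_gt_1 by simp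
      have "moebius_weight (jump A) j * of_nat (card (between A (k # ks) j)) * signed_weight q (k # ks) =
        (moebius_weight (jump A) j * q ^ (i * (k - jump ?C)) * ((- 1) ^ k / q ^ (k choose 2))) *
        qbinomial q (jump A - jump ?C) (k - jump ?C) * of_nat (card (between ?C ks i)) * signed_weight q ks"
        using True card_between_Cons[OF Cons.prems, of k ks j] by (simp add: i_def)
      then show ?thesis
        using True Cons.IH[OF C, of k i] unfolding h b[symmetric] i_def[symmetric] by simp
    qed
  qed
  finally show ?case .
qed

text \<open>The first entry is a codimension and not a drop, since an invariant \<open>V\<close>
  equals its own core.\<close>

fun chain_count :: "('k ^ 'n) set \<Rightarrow> nat list \<Rightarrow> rat" where
  "chain_count V [] = (if V = {0} then 1 else 0)"
| "chain_count V (k # ks) =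
    of_nat (card {D. vec.subspace D \<and> D \<subseteq> V \<and> vec.dim V = vec.dim D + k \<and> profile D ks})"

definition invariant_below :: "('k ^ 'n) set \<Rightarrow> nat \<Rightarrow> ('k ^ 'n) set set"
  where "invariant_below V r = {U. vec.subspace U \<and> core U = U \<and> U \<subseteq> V \<and> vec.dim V = vec.dim U + r}"

lemma subspace_dim_0: "vec.subspace D \<Longrightarrow> vec.dim D = 0 \<longleftrightarrow> D = {0::'k ^ 'n}"
  using subspace_eq_of_dim_le[of "{0}" D] vec.subspace_0[of D] by (auto simp: vec.subspace_single_0)

text \<open>The counterpart of the Pieri rule. Counting pairs \<open>D \<subseteq> U\<close> by
  \<open>card_invariant_between\<close> brings in the subspaces \<open>A\<close>. The codimension of
  \<open>A\<close> in \<open>V\<close> becomes the first column of the strip, and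
  \<open>sum_strips_profile\<close> turns the sum over \<open>D\<close> below \<open>A\<close> into
  the other columns.\<close>

theorem chain_count_strips:
  assumes V: "vec.subspace V" "core V = V"
  shows "(\<Sum>U\<in>invariant_below V r. chain_count U \<kappa>) * signed_weight q (tl \<kappa>) =
    (\<Sum>\<nu>\<in>strips (vec.dim V) \<kappa> r. strip_weight q \<kappa> \<nu> * signed_weight q (tl \<nu>) * chain_count V \<nu>)"
proof (cases \<kappa>)
  case Nil
  have 1: "(\<Sum>U\<in>invariant_below V r. chain_count U []) = (if vec.dim V = r then 1 else 0)"
  proof -
    have "(\<Sum>U\<in>invariant_below V r. chain_count U []) = (\<Sum>U\<in>invariant_below V r \<inter> {{0}}. 1)"
      by (rule sum.mono_neutral_cong_right) auto
    also have "invariant_below V r \<inter> {{0}} = (if vec.dim V = r then {{0}} else {})"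
      using vec.subspace_0[OF V(1)] by (auto simp: invariant_below_def vec.subspace_single_0)
    finally show ?thesis by simp
  qed
  have "{D. vec.subspace D \<and> D \<subseteq> V \<and> vec.dim V = vec.dim D + r \<and> D = {0}} = (if vec.dim V = r then {{0}} else {})"
    using vec.subspace_0[OF V(1)] by (auto simp: vec.subspace_single_0)
  then have 2: "chain_count V [r] = (if vec.dim V = r then 1 else 0)" by simp
  show ?thesis unfolding Nil 1 by (auto simp: 2 simp del: chain_count.simps)
next
  case (Cons k ks)
  define v where "v = vec.dim V"
  \<comment> \<open>\<open>n0 A\<close> will be the first column b of the strip, and
    \<open>j A\<close> the size r - (b - k) left for the other columns.\<close>
  define n0 where "n0 A = v - vec.dim A" for A :: "('k ^ 'n) set"
  define j where "j A = k + r - n0 A" for A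
  let ?A = "{A. vec.subspace A \<and> A \<subseteq> V}"
  let ?D = "{D. vec.subspace D \<and> D \<subseteq> V \<and> profile D ks \<and> v = vec.dim D + k + r}"
  let ?Q = "\<lambda>A. if jump A \<le> k then qbinomial q (v - (vec.dim A + jump A)) (k - jump A) else 0"
  have dimA: "vec.dim A + jump A \<le> v" if "A \<in> ?A" for A
  proof -
    have "pre A V = A" using that V(2) by (auto simp: pre_def)
    then show ?thesis using dim_add_jump_le[of A V] that V(1) by (simp add: v_def)
  qed
  have "(\<Sum>U\<in>invariant_below V r. chain_count U \<kappa>) =
      (\<Sum>U\<in>invariant_below V r. \<Sum>D | D \<in> ?D \<and> D \<subseteq> U. 1)"
  proof (rule sum.cong[OF refl])
    fix U assume U: "U \<in> invariant_below V r"
    then have "{D. vec.subspace D \<and> D \<subseteq> U \<and> vec.dim U = vec.dim D + k \<and> profile D ks} = {D. D \<in> ?D \<and> D \<subseteq> U}"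
      by (auto simp: invariant_below_def v_def)
    then show "chain_count U \<kappa> = (\<Sum>D | D \<in> ?D \<and> D \<subseteq> U. 1)" unfolding Cons by simp
  qed
  also have "\<dots> = (\<Sum>D\<in>?D. \<Sum>U | U \<in> invariant_below V r \<and> D \<subseteq> U. 1)"
    by (rule sum.swap_restrict) auto
  also have "\<dots> = (\<Sum>D\<in>?D. \<Sum>A | A \<in> ?A \<and> D \<subseteq> A \<and> core A \<subseteq> D. moebius_weight (jump A) (vec.dim A - vec.dim D) * ?Q A)"
  proof (rule sum.cong[OF refl])
    fix D assume D: "D \<in> ?D"
    have "{U. U \<in> invariant_below V r \<and> D \<subseteq> U} =
        {U. vec.subspace U \<and> core U = U \<and> D \<subseteq> U \<and> U \<subseteq> V \<and> vec.dim U = vec.dim D + k}"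
      using D by (auto simp: invariant_below_def v_def)
    moreover have "{A. A \<in> ?A \<and> D \<subseteq> A \<and> core A \<subseteq> D} = {A. vec.subspace A \<and> D \<subseteq> A \<and> A \<subseteq> V \<and> core A \<subseteq> D}"
      by auto
    ultimately show "(\<Sum>U | U \<in> invariant_below V r \<and> D \<subseteq> U. 1) =
       (\<Sum>A | A \<in> ?A \<and> D \<subseteq> A \<and> core A \<subseteq> D. moebius_weight (jump A) (vec.dim A - vec.dim D) * ?Q A)"
      using card_invariant_between[OF V, of D k] D unfolding v_def by simp
  qed
  also have "\<dots> = (\<Sum>A\<in>?A. \<Sum>D | D \<in> ?D \<and> D \<subseteq> A \<and> core A \<subseteq> D. moebius_weight (jump A) (vec.dim A - vec.dim D) * ?Q A)"
    by (rule sum.swap_restrict) auto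
  also have "\<dots> = (\<Sum>A\<in>?A. if n0 A \<le> k + r then moebius_weight (jump A) (j A) * ?Q A * of_nat (card (between A ks (j A))) else 0)"
  proof (rule sum.cong[OF refl])
    fix A assume A: "A \<in> ?A"
    then have av: "vec.dim A \<le> v" using dimA[OF A] by simp
    show "(\<Sum>D | D \<in> ?D \<and> D \<subseteq> A \<and> core A \<subseteq> D. moebius_weight (jump A) (vec.dim A - vec.dim D) * ?Q A) =
      (if n0 A \<le> k + r then moebius_weight (jump A) (j A) * ?Q A * of_nat (card (between A ks (j A))) else 0)"
    proof (cases "n0 A \<le> k + r")
      case True
      have "{D. D \<in> ?D \<and> D \<subseteq> A \<and> core A \<subseteq> D} = between A ks (j A)"
        using A True av by (auto simp: between_def j_def n0_def)
      moreover have "(\<Sum>D\<in>between A ks (j A). moebius_weight (jump A) (vec.dim A - vec.dim D) * ?Q A) =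
          (\<Sum>D\<in>between A ks (j A). moebius_weight (jump A) (j A) * ?Q A)"
        by (rule sum.cong) (auto simp: between_def)
      ultimately show ?thesis using True by (simp add: mult.commute)
    next
      case False
      have "False" if "D \<in> ?D" "D \<subseteq> A" for D
        using that False av vec.dim_subset[OF that(2)] by (auto simp: n0_def)
      then have e: "{D. D \<in> ?D \<and> D \<subseteq> A \<and> core A \<subseteq> D} = {}" by blast
      show ?thesis unfolding e using False by simp
    qed
  qed
  finally have L0: "(\<Sum>U\<in>invariant_below V r. chain_count U \<kappa>) =
    (\<Sum>A\<in>?A. if n0 A \<le> k + r then moebius_weight (jump A) (j A) * ?Q A * of_nat (card (between A ks (j A))) else 0)" .
  have L: "(\<Sum>U\<in>invariant_below V r. chain_count U \<kappa>) * signed_weight q ks =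
     (\<Sum>A\<in>?A. if n0 A \<le> k + r then ?Q A * (moebius_weight (jump A) (j A) * of_nat (card (between A ks (j A))) * signed_weight q ks) else 0)"
    unfolding L0 sum_distrib_right
  proof (rule sum.cong[OF refl])
    fix A
    show "(if n0 A \<le> k + r then moebius_weight (jump A) (j A) * ?Q A * of_nat (card (between A ks (j A))) else 0) * signed_weight q ks =
      (if n0 A \<le> k + r then ?Q A * (moebius_weight (jump A) (j A) * of_nat (card (between A ks (j A))) * signed_weight q ks) else 0)"
      by (cases "n0 A \<le> k + r") (simp_all only: if_True if_False mult_zero_left ac_simps)
  qed
  define g where "g A \<nu> = (if profile A \<nu> then strip_weight q ks \<nu> * signed_weight q \<nu> else 0)" for A \<nu>
  have "(\<Sum>\<nu>\<in>strips v (k # ks) r. strip_weight q \<kappa> \<nu> * signed_weight q (tl \<nu>) * chain_count V \<nu>) =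
    (\<Sum>b=k..min v (k + r). \<Sum>\<nu>\<in>strips k ks (r - (b - k)). \<Sum>A | A \<in> ?A \<and> n0 A = b.
      qbinomial q (v - (vec.dim A + jump A)) (b - k) * g A \<nu>)"
  proof -
    have "strip_weight q \<kappa> (b # \<nu>) * signed_weight q (tl (b # \<nu>)) * chain_count V (b # \<nu>) =
        (\<Sum>A | A \<in> ?A \<and> n0 A = b. qbinomial q (v - (vec.dim A + jump A)) (b - k) * g A \<nu>)"
      if "b \<in> {k..min v (k + r)}" "\<nu> \<in> strips k ks (r - (b - k))" for b \<nu>
    proof -
      have "{D. vec.subspace D \<and> D \<subseteq> V \<and> vec.dim V = vec.dim D + b \<and> profile D \<nu>} =
          {A. (A \<in> ?A \<and> n0 A = b) \<and> profile A \<nu>}"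
        using that dimA by (force simp: n0_def v_def)
      then have "chain_count V (b # \<nu>) = (\<Sum>A | A \<in> ?A \<and> n0 A = b. if profile A \<nu> then 1 else 0)"
        by (simp add: sum.If_cases Int_def)
      then have "strip_weight q \<kappa> (b # \<nu>) * signed_weight q (tl (b # \<nu>)) * chain_count V (b # \<nu>) =
        (\<Sum>A | A \<in> ?A \<and> n0 A = b. qbinomial q (b - hd \<nu>) (b - k) * g A \<nu>)"
        unfolding Cons g_def by (simp add: sum_distrib_left if_distrib mult.assoc cong: if_cong)
      also have "\<dots> = (\<Sum>A | A \<in> ?A \<and> n0 A = b. qbinomial q (v - (vec.dim A + jump A)) (b - k) * g A \<nu>)"
      proof (rule sum.cong[OF refl])
        fix A assume A: "A \<in> {A. A \<in> ?A \<and> n0 A = b}"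
        have "\<nu> \<noteq> []" using length_strips[OF that(2)] by auto
        then show "qbinomial q (b - hd \<nu>) (b - k) * g A \<nu> = qbinomial q (v - (vec.dim A + jump A)) (b - k) * g A \<nu>"
          using hd_profile[of A \<nu>] A by (auto simp: g_def n0_def diff_diff_add)
      qed
      finally show ?thesis .
    qed
    then show ?thesis unfolding sum_strips_Cons by (intro sum.cong refl) simp_all
  qed
  also have "\<dots> = (\<Sum>b=k..min v (k + r). \<Sum>A | A \<in> ?A \<and> n0 A = b.
      qbinomial q (v - (vec.dim A + jump A)) (b - k) * (\<Sum>\<nu>\<in>strips k ks (r - (b - k)). g A \<nu>))"
    by (subst sum.swap) (simp add: sum_distrib_left)
  also have "\<dots> = (\<Sum>b=k..min v (k + r). \<Sum>A | A \<in> ?A \<and> n0 A = b.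
      ?Q A * (moebius_weight (jump A) (j A) * of_nat (card (between A ks (j A))) * signed_weight q ks))"
  proof (intro sum.cong refl)
    fix b A assume b: "b \<in> {k..min v (k + r)}" and A: "A \<in> {A. A \<in> ?A \<and> n0 A = b}"
    have j: "r - (b - k) = j A" using A b by (auto simp: j_def)
    have av: "vec.dim A + jump A \<le> v" using dimA A by blast
    \<comment> \<open>The Pieri coefficient has lower index b - k and the count of subspaces k -
      \<open>jump A\<close>; both have upper index b - \<open>jump A\<close>, so symmetry identifies
      them.\<close>
    have "qbinomial q (v - (vec.dim A + jump A)) (b - k) = qbinomial q (v - (vec.dim A + jump A)) (k - jump A)"
      if "jump A \<le> k"
    proof -
      have "v - (vec.dim A + jump A) = b - jump A" using A by (auto simp: n0_def)
      moreover have "b - k = (b - jump A) - (k - jump A)" "k - jump A \<le> b - jump A" using b that by auto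
      ultimately show ?thesis using qbinomial_symmetric[of q "k - jump A" "b - jump A"] q_gt_1 by simp
    qed
    then show "qbinomial q (v - (vec.dim A + jump A)) (b - k) * (\<Sum>\<nu>\<in>strips k ks (r - (b - k)). g A \<nu>) =
      ?Q A * (moebius_weight (jump A) (j A) * of_nat (card (between A ks (j A))) * signed_weight q ks)"
      using sum_strips_profile[where A=A and M=k and ks=ks and j="j A"] A unfolding j g_def by auto
  qed
  also have "\<dots> = (\<Sum>A | A \<in> ?A \<and> n0 A \<in> {k..min v (k + r)}.
      ?Q A * (moebius_weight (jump A) (j A) * of_nat (card (between A ks (j A))) * signed_weight q ks))"
  proof -
    have "{A. A \<in> {A. A \<in> ?A \<and> n0 A \<in> {k..min v (k + r)}} \<and> n0 A = b} = {A. A \<in> ?A \<and> n0 A = b}"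
      if "b \<in> {k..min v (k + r)}" for b using that by auto
    then show ?thesis
      using sum.group[of "{A. A \<in> ?A \<and> n0 A \<in> {k..min v (k + r)}}" "{k..min v (k + r)}" n0
        "\<lambda>A. ?Q A * (moebius_weight (jump A) (j A) * of_nat (card (between A ks (j A))) * signed_weight q ks)"]
      by (force intro: sum.cong)
  qed
  also have "\<dots> = (\<Sum>A\<in>?A. if n0 A \<le> k + r then ?Q A * (moebius_weight (jump A) (j A) * of_nat (card (between A ks (j A))) * signed_weight q ks) else 0)"
  proof (rule sum.mono_neutral_cong_left)
    \<comment> \<open>For \<open>n0 A < k\<close> the upper index \<open>n0 A - jump A\<close> of
      the Gaussian binomial is below the lower one.\<close>
    show "\<forall>A\<in>?A - {A. A \<in> ?A \<and> n0 A \<in> {k..min v (k + r)}}.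
      (if n0 A \<le> k + r then ?Q A * (moebius_weight (jump A) (j A) * of_nat (card (between A ks (j A))) * signed_weight q ks) else 0) = 0"
    proof
      fix A assume A: "A \<in> ?A - {A. A \<in> ?A \<and> n0 A \<in> {k..min v (k + r)}}"
      then have "n0 A \<le> k + r \<Longrightarrow> n0 A < k" by (auto simp: n0_def)
      moreover have "vec.dim A + jump A \<le> v" using dimA A by blast
      ultimately show "(if n0 A \<le> k + r then ?Q A * (moebius_weight (jump A) (j A) * of_nat (card (between A ks (j A))) * signed_weight q ks) else 0) = 0"
        by (auto simp: n0_def qbinomial_eq_0)
    qed
  qed auto
  finally show ?thesis unfolding L[symmetric] by (simp add: Cons v_def)
qed

end

section \<open>Flags and anti-invariant subspaces\<close>

context finite_operator
begin

text \<open>Flags are built from the top: the first entry is the codimension of the next member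
  below \<open>U\<close>. This matches multiplication by e_r but reverses the order of
  \<open>invariant_flags\<close>.\<close>

fun flag_count :: "('k ^ 'n) set \<Rightarrow> nat list \<Rightarrow> nat" where
  "flag_count U [] = (if U = {0} then 1 else 0)"
| "flag_count U (r # rs) = (\<Sum>U'\<in>invariant_below U r. flag_count U' rs)"

lemma invariant_subspace_iff: "invariant_subspace \<Delta> U \<longleftrightarrow> vec.subspace U \<and> core U = U"
  by (auto simp: invariant_subspace_def pre_def)

text \<open>Flags ending at \<open>U\<close> in place of the whole space, so that the last member
  can be removed by induction.\<close>

definition flags_upto :: "('k ^ 'n) set \<Rightarrow> nat list \<Rightarrow> ('k ^ 'n) set list set"
  where "flags_upto U \<alpha> = {W. length W = length \<alpha> + 1 \<and> W ! 0 = {0} \<and> W ! length \<alpha> = U \<and>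
    (\<forall>i\<le>length \<alpha>. invariant_subspace \<Delta> (W ! i)) \<and>
    (\<forall>i<length \<alpha>. W ! i \<subseteq> W ! (i + 1) \<and> vec.dim (W ! (i + 1)) = vec.dim (W ! i) + \<alpha> ! i)}"

lemma flags_upto_snoc:
  assumes U: "vec.subspace U" "core U = U"
  shows "flags_upto U (\<alpha> @ [r]) = (\<Union>U'\<in>invariant_below U r. (\<lambda>W. W @ [U]) ` flags_upto U' \<alpha>)"
proof (intro equalityI subsetI)
  fix W assume W: "W \<in> flags_upto U (\<alpha> @ [r])"
  define W' where "W' = butlast W"
  have len: "length W = length \<alpha> + 2" using W by (simp add: flags_upto_def)
  have "W = W' @ [last W]" unfolding W'_def using len by (intro append_butlast_last_id[symmetric]) auto
  moreover have "last W = U"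
  proof -
    have "W \<noteq> []" using len by auto
    then have "last W = W ! length (\<alpha> @ [r])" using len by (simp add: last_conv_nth)
    then show ?thesis using W by (simp add: flags_upto_def)
  qed
  ultimately have WW: "W = W' @ [U]" by simp
  have len': "length W' = length \<alpha> + 1" using len WW by simp
  have nth: "W ! i = W' ! i" if "i \<le> length \<alpha>" for i
    using that len' unfolding WW by (simp add: nth_append)
  have last: "W ! (length \<alpha> + 1) = U" using len' unfolding WW by (simp add: nth_append)
  have "W' ! (length \<alpha>) \<in> invariant_below U r"
  proof -
    have "W ! length \<alpha> \<subseteq> W ! (length \<alpha> + 1)" "vec.dim (W ! (length \<alpha> + 1)) = vec.dim (W ! length \<alpha>) + r"
      "invariant_subspace \<Delta> (W ! length \<alpha>)"
      using W by (auto simp: flags_upto_def dest!: spec[of _ "length \<alpha>"])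
    then show ?thesis
      unfolding last by (simp add: invariant_below_def nth invariant_subspace_iff)
  qed
  moreover have "W' \<in> flags_upto (W' ! (length \<alpha>)) \<alpha>"
    unfolding flags_upto_def mem_Collect_eq
  proof (intro conjI allI impI)
    show "W' ! 0 = {0}" using W nth[of 0] by (simp add: flags_upto_def)
    fix i assume "i \<le> length \<alpha>"
    moreover have "\<forall>i\<le>length \<alpha> + 1. invariant_subspace \<Delta> (W ! i)" using W by (simp add: flags_upto_def)
    ultimately show "invariant_subspace \<Delta> (W' ! i)" by (simp add: nth[symmetric])
  next
    fix i assume i: "i < length \<alpha>"
    then have "W ! i \<subseteq> W ! (i + 1) \<and> vec.dim (W ! (i + 1)) = vec.dim (W ! i) + (\<alpha> @ [r]) ! i"
      using W by (simp add: flags_upto_def)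
    then show "W' ! i \<subseteq> W' ! (i + 1)" "vec.dim (W' ! (i + 1)) = vec.dim (W' ! i) + \<alpha> ! i"
      using nth[of i] nth[of "i + 1"] i by (simp_all add: nth_append)
  qed (simp_all add: len')
  ultimately show "W \<in> (\<Union>U'\<in>invariant_below U r. (\<lambda>W. W @ [U]) ` flags_upto U' \<alpha>)"
    using WW by blast
next
  fix W assume "W \<in> (\<Union>U'\<in>invariant_below U r. (\<lambda>W. W @ [U]) ` flags_upto U' \<alpha>)"
  then obtain U' W' where U': "U' \<in> invariant_below U r" and W': "W' \<in> flags_upto U' \<alpha>"
    and WW: "W = W' @ [U]" by blast
  have len': "length W' = length \<alpha> + 1" using W' by (simp add: flags_upto_def)
  have nth: "W ! i = W' ! i" if "i \<le> length \<alpha>" for i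
    using that len' unfolding WW by (simp add: nth_append)
  have last: "W ! (length \<alpha> + 1) = U" using len' unfolding WW by (simp add: nth_append)
  show "W \<in> flags_upto U (\<alpha> @ [r])"
    unfolding flags_upto_def mem_Collect_eq
  proof (intro conjI allI impI)
    show "W ! 0 = {0}" using W' nth[of 0] by (simp add: flags_upto_def)
    show "W ! length (\<alpha> @ [r]) = U" using last by simp
    fix i assume i: "i \<le> length (\<alpha> @ [r])"
    show "invariant_subspace \<Delta> (W ! i)"
    proof (cases "i \<le> length \<alpha>")
      case True
      then show ?thesis using W' nth[of i] by (simp add: flags_upto_def)
    next
      case False
      then have "i = length \<alpha> + 1" using i by simp
      then show ?thesis using last U by (simp add: invariant_subspace_iff)
    qed
  next
    fix i assume i: "i < length (\<alpha> @ [r])"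
    have "W ! i \<subseteq> W ! (i + 1) \<and> vec.dim (W ! (i + 1)) = vec.dim (W ! i) + (\<alpha> @ [r]) ! i"
    proof (cases "i < length \<alpha>")
      case True
      then show ?thesis using W' nth[of i] nth[of "i + 1"] by (simp add: flags_upto_def nth_append)
    next
      case False
      then have "i = length \<alpha>" using i by simp
      then show ?thesis using W' U' nth[of i] last by (simp add: flags_upto_def invariant_below_def)
    qed
    then show "W ! i \<subseteq> W ! (i + 1)" "vec.dim (W ! (i + 1)) = vec.dim (W ! i) + (\<alpha> @ [r]) ! i"
      by blast+
  qed (simp add: WW len')
qed

lemma finite_flags_upto: "finite (flags_upto U \<alpha>)"
  by (rule finite_subset[OF _ finite_lists_length_eq[of UNIV "length \<alpha> + 1"]])
    (auto simp: flags_upto_def)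

lemma card_flags_upto:
  "vec.subspace U \<Longrightarrow> core U = U \<Longrightarrow> card (flags_upto U \<alpha>) = flag_count U (rev \<alpha>)"
proof (induction \<alpha> arbitrary: U rule: rev_induct)
  case Nil
  have inv: "invariant_subspace \<Delta> {0 :: 'k ^ 'n}" by (simp add: invariant_subspace_iff vec.subspace_single_0)
  have "flags_upto U [] = (if U = {0} then {[{0}]} else {})"
  proof (intro set_eqI)
    fix W
    show "W \<in> flags_upto U [] \<longleftrightarrow> W \<in> (if U = {0} then {[{0}]} else {})"
    proof (cases "\<exists>A. W = [A]")
      case True
      then obtain A where "W = [A]" by blast
      then show ?thesis using inv by (auto simp: flags_upto_def)
    next
      case False
      then have "length W \<noteq> 1" by (auto simp: length_Suc_conv)
      then show ?thesis by (auto simp: flags_upto_def)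
    qed
  qed
  then show ?case by simp
next
  case (snoc r \<alpha>)
  have disj: "(\<lambda>W. W @ [U]) ` flags_upto U' \<alpha> \<inter> (\<lambda>W. W @ [U]) ` flags_upto U'' \<alpha> = {}" if "U' \<noteq> U''" for U' U''
    using that by (auto simp: flags_upto_def)
  have "card (flags_upto U (\<alpha> @ [r])) = (\<Sum>U'\<in>invariant_below U r. card ((\<lambda>W. W @ [U]) ` flags_upto U' \<alpha>))"
    unfolding flags_upto_snoc[OF snoc.prems]
    by (rule card_UN_disjoint) (use disj in \<open>auto simp: finite_flags_upto\<close>)
  also have "\<dots> = (\<Sum>U'\<in>invariant_below U r. flag_count U' (rev \<alpha>))"
  proof (rule sum.cong[OF refl])
    fix U' assume "U' \<in> invariant_below U r"
    then show "card ((\<lambda>W. W @ [U]) ` flags_upto U' \<alpha>) = flag_count U' (rev \<alpha>)"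
      using snoc.IH[of U'] by (subst card_image) (auto simp: inj_on_def invariant_below_def)
  qed
  finally show ?case by simp
qed

lemma core_UNIV [simp]: "core UNIV = UNIV"
  by (simp add: pre_def)

lemma card_invariant_flags: "card (invariant_flags \<Delta> \<alpha>) = flag_count UNIV (rev \<alpha>)"
proof -
  have "invariant_flags \<Delta> \<alpha> = flags_upto UNIV \<alpha>"
    by (simp add: invariant_flags_def flags_upto_def)
  then show ?thesis by (simp add: card_flags_upto)
qed

section \<open>Symmetry of the flag counts\<close>

lemma invariant_belowD:
  assumes "U' \<in> invariant_below U r"
  shows "vec.subspace U'" "core U' = U'" "U' \<subseteq> U" "vec.dim U = vec.dim U' + r"
  using assms by (auto simp: invariant_below_def)

text \<open>For fixed \<open>E\<close> two steps below \<open>U\<close>, the two counts concern the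
  invariant subspaces between \<open>E\<close> and \<open>U\<close> of relative dimensions s and r;
  they agree by \<open>card_invariant_symmetric\<close>.\<close>

lemma flag_count_swap:
  assumes U: "vec.subspace U" "core U = U"
  shows "flag_count U (r # s # rs) = flag_count U (s # r # rs)"
proof -
  let ?E = "{E. vec.subspace E \<and> core E = E \<and> E \<subseteq> U \<and> vec.dim U = vec.dim E + s + r}"
  have *: "flag_count U (a # b # rs) = (\<Sum>E\<in>?E. card {U'. vec.subspace U' \<and> core U' = U' \<and> E \<subseteq> U' \<and> U' \<subseteq> U \<and>
      vec.dim U' = vec.dim E + b} * flag_count E rs)" if ab: "a + b = s + r" for a b
  proof -
    have "flag_count U (a # b # rs) = (\<Sum>U'\<in>invariant_below U a. \<Sum>E | E \<in> ?E \<and> E \<subseteq> U'. flag_count E rs)"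
    proof -
      have "invariant_below U' b = {E. E \<in> ?E \<and> E \<subseteq> U'}" if "U' \<in> invariant_below U a" for U'
        using that ab by (auto simp: invariant_below_def)
      then show ?thesis by (auto intro!: sum.cong)
    qed
    also have "\<dots> = (\<Sum>E\<in>?E. \<Sum>U' | U' \<in> invariant_below U a \<and> E \<subseteq> U'. flag_count E rs)"
      by (rule sum.swap_restrict) auto
    also have "\<dots> = (\<Sum>E\<in>?E. card {U'. vec.subspace U' \<and> core U' = U' \<and> E \<subseteq> U' \<and> U' \<subseteq> U \<and>
      vec.dim U' = vec.dim E + b} * flag_count E rs)"
    proof (rule sum.cong[OF refl])
      fix E assume E: "E \<in> ?E"
      have "{U'. U' \<in> invariant_below U a \<and> E \<subseteq> U'} =
          {U'. vec.subspace U' \<and> core U' = U' \<and> E \<subseteq> U' \<and> U' \<subseteq> U \<and> vec.dim U' = vec.dim E + b}"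
        using E ab by (auto simp: invariant_below_def)
      then show "(\<Sum>U' | U' \<in> invariant_below U a \<and> E \<subseteq> U'. flag_count E rs) = card {U'. vec.subspace U' \<and> core U' = U' \<and> E \<subseteq> U' \<and> U' \<subseteq> U \<and>
      vec.dim U' = vec.dim E + b} * flag_count E rs" by simp
    qed
    finally show ?thesis .
  qed
  have "card {U'. vec.subspace U' \<and> core U' = U' \<and> E \<subseteq> U' \<and> U' \<subseteq> U \<and> vec.dim U' = vec.dim E + s} =
      card {U'. vec.subspace U' \<and> core U' = U' \<and> E \<subseteq> U' \<and> U' \<subseteq> U \<and> vec.dim U' = vec.dim E + r}"
    if "E \<in> ?E" for E
    using that by (intro card_invariant_symmetric[OF U]) auto
  then show ?thesis
    unfolding *[of r s, OF add.commute] *[of s r, OF refl] by (intro sum.cong) simp_all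
qed

lemma flag_count_insort:
  "vec.subspace U \<Longrightarrow> core U = U \<Longrightarrow> flag_count U (insort x xs) = flag_count U (x # xs)"
proof (induction xs arbitrary: U)
  case (Cons y ys)
  have "flag_count U (y # insort x ys) = flag_count U (y # x # ys)"
    by (simp only: flag_count.simps(2)[of U y], intro sum.cong refl Cons.IH) (auto dest: invariant_belowD)
  then show ?case using flag_count_swap[OF Cons.prems, of x y ys] by simp
qed simp

lemma flag_count_sort:
  "vec.subspace U \<Longrightarrow> core U = U \<Longrightarrow> flag_count U (sort xs) = flag_count U xs"
proof (induction xs arbitrary: U)
  case (Cons x xs)
  have "flag_count U (sort (x # xs)) = flag_count U (x # sort xs)"
    using Cons.prems by (simp add: flag_count_insort del: flag_count.simps)
  also have "\<dots> = flag_count U (x # xs)"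
    by (simp only: flag_count.simps(2), intro sum.cong refl Cons.IH) (auto dest: invariant_belowD)
  finally show ?case .
qed simp

lemma flag_count_mset:
  assumes "vec.subspace U" "core U = U" "mset xs = mset ys"
  shows "flag_count U xs = flag_count U ys"
  using flag_count_sort[OF assms(1,2), of xs] flag_count_sort[OF assms(1,2), of ys]
    properties_for_sort[of "sort ys" xs] assms(3) by simp

lemma invariant_below_0:
  assumes "vec.subspace U" "core U = U"
  shows "invariant_below U 0 = {U}"
proof -
  have "U' = U" if "U' \<in> invariant_below U 0" for U'
    using invariant_belowD[OF that] assms by (intro subspace_eq_of_dim_le) auto
  moreover have "U \<in> invariant_below U 0" using assms by (simp add: invariant_below_def)
  ultimately show ?thesis by blast
qed

lemma flag_count_filter:
  "vec.subspace U \<Longrightarrow> core U = U \<Longrightarrow> flag_count U (filter ((\<noteq>) 0) xs) = flag_count U xs"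
proof (induction xs arbitrary: U)
  case (Cons x xs)
  show ?case
  proof (cases "x = 0")
    case True
    then show ?thesis using Cons by (simp add: invariant_below_0)
  next
    case False
    have "flag_count U' (filter ((\<noteq>) 0) xs) = flag_count U' xs" if "U' \<in> invariant_below U x" for U'
      using invariant_belowD[OF that] by (intro Cons.IH)
    then have "flag_count U (x # filter ((\<noteq>) 0) xs) = flag_count U (x # xs)"
      unfolding flag_count.simps by (rule sum.cong[OF refl])
    moreover have "filter ((\<noteq>) 0) (x # xs) = x # filter ((\<noteq>) 0) xs" using False by simp
    ultimately show ?thesis by (simp only:)
  qed
qed simp

lemma flag_count_eq_0: "vec.subspace U \<Longrightarrow> sum_list xs \<noteq> vec.dim U \<Longrightarrow> flag_count U xs = 0"
proof (induction xs arbitrary: U)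
  case Nil
  then show ?case by auto
next
  case (Cons x xs)
  have "flag_count U' xs = 0" if "U' \<in> invariant_below U x" for U'
    using invariant_belowD[OF that] Cons.prems by (intro Cons.IH) auto
  then show ?case by simp
qed

section \<open>The sums W + \<Delta> W + ... and their cores\<close>

fun orbit_sum :: "nat \<Rightarrow> ('k ^ 'n) set \<Rightarrow> ('k ^ 'n) set" where
  "orbit_sum 0 W = W"
| "orbit_sum (Suc i) W = vec.span (W \<union> (*v) \<Delta> ` orbit_sum i W)"

lemmas [simp del] = orbit_sum.simps(2)

lemma subspace_orbit_sum: "vec.subspace W \<Longrightarrow> vec.subspace (orbit_sum i W)"
  by (cases i) (auto simp: vec.subspace_span orbit_sum.simps)

lemma orbit_sum_superset: "W \<subseteq> orbit_sum i W"
  by (cases i) (auto intro: vec.span_base simp: orbit_sum.simps)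

lemma orbit_sum_mono: "orbit_sum i W \<subseteq> orbit_sum (Suc i) W"
proof (induction i)
  case 0
  then show ?case by (auto intro: vec.span_base simp: orbit_sum.simps)
next
  case (Suc i)
  then show ?case unfolding orbit_sum.simps(2)[of "Suc i"] unfolding orbit_sum.simps(2)[of i]
    by (intro vec.span_mono) auto
qed

lemma orbit_sum_Suc:
  assumes "vec.subspace W"
  shows "orbit_sum (Suc i) W = vec.span (orbit_sum i W \<union> (*v) \<Delta> ` orbit_sum i W)"
proof
  show "orbit_sum (Suc i) W \<subseteq> vec.span (orbit_sum i W \<union> (*v) \<Delta> ` orbit_sum i W)"
    unfolding orbit_sum.simps using orbit_sum_superset[of W i] by (intro vec.span_mono) auto
  have "(*v) \<Delta> ` orbit_sum i W \<subseteq> orbit_sum (Suc i) W" by (auto intro: vec.span_base simp: orbit_sum.simps)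
  then show "vec.span (orbit_sum i W \<union> (*v) \<Delta> ` orbit_sum i W) \<subseteq> orbit_sum (Suc i) W"
    using orbit_sum_mono[of i W] subspace_orbit_sum[OF assms, of "Suc i"] by (intro vec.span_minimal) auto
qed

lemma set_plus_subspaces:
  assumes "vec.subspace A" "vec.subspace B"
  shows "A + B = vec.span (A \<union> (B :: ('k ^ 'n) set))"
  unfolding vec.span_Un vec.span_eq_iff[THEN iffD2, OF assms(1)] vec.span_eq_iff[THEN iffD2, OF assms(2)]
  by (auto simp: set_plus_def)

lemma image_set_sum:
  "(*v) \<Delta> ` (\<Sum>l\<le>i. A l) = (\<Sum>l\<le>(i::nat). (*v) \<Delta> ` (A l :: ('k ^ 'n) set))"
proof (induction i)
  case (Suc i)
  have "(*v) \<Delta> ` (B + C) = (*v) \<Delta> ` B + (*v) \<Delta> ` C" for B C :: "('k ^ 'n) set"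
    by (force simp: set_plus_def vec.linear_add[OF linear_operator])
  then show ?case using Suc by simp
qed simp

lemma set_sum_eq_orbit_sum:
  assumes "vec.subspace W"
  shows "(\<Sum>l\<le>i. ((*v) \<Delta> ^^ l) ` W) = orbit_sum i W"
proof (induction i)
  case 0
  then show ?case by simp
next
  case (Suc i)
  have "(\<Sum>l\<le>Suc i. ((*v) \<Delta> ^^ l) ` W) = W + (\<Sum>l\<le>i. (*v) \<Delta> ` (((*v) \<Delta> ^^ l) ` W))"
    by (simp add: sum.atMost_Suc_shift image_comp del: sum.atMost_Suc)
  also have "\<dots> = W + (*v) \<Delta> ` orbit_sum i W"
    unfolding image_set_sum[symmetric] Suc ..
  also have "\<dots> = orbit_sum (Suc i) W"
    using set_plus_subspaces[OF assms vec.linear_subspace_image[OF linear_operator subspace_orbit_sum[OF assms]]]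
    by (simp add: orbit_sum.simps)
  finally show ?case .
qed

lemma anti_invariant_iff:
  "anti_invariant t \<Delta> W \<longleftrightarrow> vec.subspace W \<and> vec.dim (orbit_sum t W) = (t + 1) * vec.dim W"
  using set_sum_eq_orbit_sum[of W t] by (auto simp: anti_invariant_def)

text \<open>The recursion adds the image of the previous sum to \<open>W\<close>, so
  \<open>dim_pre\<close> bounds the growth by \<open>vec.dim W\<close>.\<close>

lemma dim_orbit_sum_le: 
  assumes "vec.subspace W"
  shows "vec.dim (orbit_sum (Suc i) W) \<le> vec.dim (orbit_sum i W) + vec.dim W"
  using dim_pre[OF assms subspace_orbit_sum[OF assms, of i]] by (simp add: orbit_sum.simps)

text \<open>No step adds more than \<open>vec.dim W\<close>, so maximal growth after t steps forces
  maximal growth in every step.\<close>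

lemma dim_orbit_sum_anti_invariant:
  assumes W: "vec.subspace W" and t: "vec.dim (orbit_sum t W) = (t + 1) * vec.dim W" and "i \<le> t"
  shows "vec.dim (orbit_sum i W) = (i + 1) * vec.dim W"
proof (rule antisym)
  show "vec.dim (orbit_sum i W) \<le> (i + 1) * vec.dim W" for i
  proof (induction i)
    case (Suc i)
    then show ?case using dim_orbit_sum_le[OF W, of i] by simp
  qed simp
  have "vec.dim (orbit_sum (i + s) W) \<le> vec.dim (orbit_sum i W) + s * vec.dim W" for s
  proof (induction s)
    case (Suc s)
    then show ?case using dim_orbit_sum_le[OF W, of "i + s"] by simp
  qed simp
  from this[of "t - i"] have "(t + 1) * vec.dim W \<le> vec.dim (orbit_sum i W) + (t - i) * vec.dim W"
    using t \<open>i \<le> t\<close> by simp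
  moreover have "(t + 1) * vec.dim W = (i + 1) * vec.dim W + (t - i) * vec.dim W"
    using \<open>i \<le> t\<close> by (simp add: add_mult_distrib[symmetric])
  ultimately show "(i + 1) * vec.dim W \<le> vec.dim (orbit_sum i W)" by linarith
qed

text \<open>By \<open>orbit_sum_Suc\<close> and \<open>dim_pre\<close>, the core of the i-th sum has
  twice the dimension of this sum minus that of the next, which is i times \<open>vec.dim W\<close>.
  The preceding sum lies in this core and has the same dimension.\<close>

lemma core_orbit_sum:
  assumes W: "vec.subspace W" and t: "vec.dim (orbit_sum t W) = (t + 1) * vec.dim W"
  shows "0 < t \<Longrightarrow> core W = {0}" "Suc i < t \<Longrightarrow> core (orbit_sum (Suc i) W) = orbit_sum i W"
proof -
  note s = subspace_orbit_sum[OF W]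
  have d: "vec.dim (core (orbit_sum i W)) = i * vec.dim W" if "i < t" for i
  proof -
    have "vec.dim (orbit_sum (Suc i) W) + vec.dim (core (orbit_sum i W)) = 2 * vec.dim (orbit_sum i W)"
      using dim_pre[OF s[of i] s[of i]] orbit_sum_Suc[OF W, of i] by simp
    then show ?thesis
      using dim_orbit_sum_anti_invariant[OF W t, of i] dim_orbit_sum_anti_invariant[OF W t, of "Suc i"] that
      by simp
  qed
  show "core W = {0}" if "0 < t"
    using d[OF that] subspace_dim_0[OF subspace_pre[OF W W]] by simp
  show "core (orbit_sum (Suc i) W) = orbit_sum i W" if "Suc i < t"
  proof (rule subspace_eq_of_dim_le[symmetric])
    show "orbit_sum i W \<subseteq> core (orbit_sum (Suc i) W)"
      using orbit_sum_mono[of i W] by (auto simp: pre_def orbit_sum.simps intro: vec.span_base)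
    show "vec.dim (core (orbit_sum (Suc i) W)) \<le> vec.dim (orbit_sum i W)"
      using d[OF that] dim_orbit_sum_anti_invariant[OF W t, of i] that by simp
  qed (use s subspace_pre in \<open>simp_all del: orbit_sum.simps\<close>)
qed

lemma profile_orbit_sum:
  assumes W: "vec.subspace W" and t: "vec.dim (orbit_sum t W) = (t + 1) * vec.dim W" and "i < t"
  shows "profile (orbit_sum i W) (replicate (Suc i) (vec.dim W))"
  using \<open>i < t\<close>
proof (induction i)
  case 0
  then show ?case using core_orbit_sum(1)[OF W t] by (simp add: profile.simps(2))
next
  case (Suc i)
  then show ?case
    using core_orbit_sum(2)[OF W t, of i] dim_orbit_sum_anti_invariant[OF W t, of i]
      dim_orbit_sum_anti_invariant[OF W t, of "Suc i"]
    unfolding replicate_Suc[of "Suc i"] profile.simps(2) by (simp del: replicate_Suc)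
qed

text \<open>\<open>W\<close> is the bottom core of the chain. By induction the core of
  \<open>D\<close> is a sum of images of \<open>W\<close>; the next sum lies in \<open>D\<close> and
  has its dimension. The last conjunct carries this comparison through the induction and yields
  anti-invariance for t = i + 1.\<close>

lemma orbit_sum_of_profile:
  assumes "vec.subspace D" "profile D (replicate (Suc i) m)"
  shows "\<exists>W. vec.subspace W \<and> vec.dim W = m \<and> D = orbit_sum i W \<and>
    vec.dim (orbit_sum (Suc i) W) = (Suc i + 1) * m"
  using assms
proof (induction i arbitrary: D)
  case 0
  then have "core D = {0}" "vec.dim D = m" by (auto simp: profile.simps(2))
  then show ?case
    using 0 dim_pre[of D D] orbit_sum_Suc[of D 0] by (intro exI[of _ D]) simp
next
  case (Suc i)
  let ?E = "core D"
  have E: "vec.subspace ?E" by (rule subspace_pre[OF Suc.prems(1) Suc.prems(1)])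
  have D: "vec.dim D = m + vec.dim ?E" "profile ?E (replicate (Suc i) m)"
    using Suc.prems(2) unfolding replicate_Suc[of "Suc i"] profile.simps(2) by auto
  obtain W where W: "vec.subspace W" "vec.dim W = m" "?E = orbit_sum i W"
    "vec.dim (orbit_sum (Suc i) W) = (Suc i + 1) * m"
    using Suc.IH[OF E D(2)] by blast
  have dE: "vec.dim ?E = (i + 1) * m"
    using dim_orbit_sum_anti_invariant[of W "Suc i" i] W by simp
  have "orbit_sum (Suc i) W \<subseteq> D"
    unfolding orbit_sum_Suc[OF W(1)] W(3)[symmetric]
    using Suc.prems(1) by (intro vec.span_minimal) (auto simp: pre_def)
  then have DW: "D = orbit_sum (Suc i) W"
    using subspace_eq_of_dim_le[OF subspace_orbit_sum[OF W(1)] Suc.prems(1), of "Suc i"] W(4) D(1) dE by simp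
  have "vec.dim (orbit_sum (Suc (Suc i)) W) + vec.dim ?E = 2 * vec.dim D"
    using dim_pre[OF Suc.prems(1) Suc.prems(1)] orbit_sum_Suc[OF W(1), of "Suc i"] DW by simp
  then have "vec.dim (orbit_sum (Suc (Suc i)) W) = (Suc (Suc i) + 1) * m"
    using D(1) dE by simp
  then show ?case using W DW by blast
qed

text \<open>Taking the core i times leads back to \<open>W\<close>.\<close>

lemma inj_on_orbit_sum:
  assumes "i < t"
  shows "inj_on (orbit_sum i) {W. anti_invariant t \<Delta> W}"
  using assms
proof (induction i)
  case 0
  then show ?case by (simp add: inj_on_def)
next
  case (Suc i)
  show ?case
  proof (rule inj_onI)
    fix W W' assume *: "W \<in> {W. anti_invariant t \<Delta> W}" "W' \<in> {W. anti_invariant t \<Delta> W}"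
      "orbit_sum (Suc i) W = orbit_sum (Suc i) W'"
    then have "orbit_sum i W = orbit_sum i W'"
      using core_orbit_sum(2)[of W t i] core_orbit_sum(2)[of W' t i] Suc.prems
      by (simp add: anti_invariant_iff)
    then show "W = W'" using Suc * by (auto dest: inj_onD)
  qed
qed

theorem card_anti_invariant:
  assumes "0 < t" "m * t \<le> CARD('n)"
  shows "chain_count UNIV ((CARD('n) - m * t) # replicate t m) =
    of_nat (card {W. anti_invariant t \<Delta> W \<and> vec.dim W = m})"
proof -
  obtain i where t: "t = Suc i" using assms(1) gr0_implies_Suc by blast
  \<comment> \<open>The profile fixes the dimension of \<open>D\<close>, hence its codimension n - m
    t.\<close>
  have dim: "vec.dim D = m * t" if "vec.subspace D" "profile D (replicate t m)" for D
    using orbit_sum_of_profile[of D i m] that dim_orbit_sum_anti_invariant[of _ "Suc i" i] t by auto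
  have "{D. vec.subspace D \<and> D \<subseteq> UNIV \<and> vec.dim (UNIV :: ('k ^ 'n) set) = vec.dim D + (CARD('n) - m * t) \<and>
      profile D (replicate t m)} = orbit_sum i ` {W. anti_invariant t \<Delta> W \<and> vec.dim W = m}" (is "?L = ?R")
  proof (intro equalityI subsetI)
    fix D assume "D \<in> ?L"
    then obtain W where "vec.subspace W" "vec.dim W = m" "D = orbit_sum i W"
        "vec.dim (orbit_sum (Suc i) W) = (Suc i + 1) * m"
      using orbit_sum_of_profile[of D i m] t by auto
    then show "D \<in> ?R" by (auto simp: anti_invariant_iff t)
  next
    fix D assume "D \<in> ?R"
    then obtain W where W: "anti_invariant t \<Delta> W" "vec.dim W = m" "D = orbit_sum i W" by auto
    then have "vec.subspace D" "profile D (replicate t m)"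
      using profile_orbit_sum[of W t i] subspace_orbit_sum[of W i] t by (auto simp: anti_invariant_iff)
    then show "D \<in> ?L" using dim[of D] assms(2) by (simp add: card_cart_basis)
  qed
  moreover have "inj_on (orbit_sum i) {W. anti_invariant t \<Delta> W \<and> vec.dim W = m}"
    using inj_on_orbit_sum[of i t] t by (auto intro: inj_on_subset)
  ultimately show ?thesis by (simp add: card_image)
qed

end

section \<open>Coefficients of symmetric functions\<close>

text \<open>The multiset of nonzero exponents, a complete invariant of a monomial up to permutation
  of the variables.\<close>

definition content :: "(nat \<Rightarrow>\<^sub>0 nat) \<Rightarrow> nat multiset"
  where "content \<gamma> = image_mset (Poly_Mapping.lookup \<gamma>) (mset_set (Poly_Mapping.keys \<gamma>))"

lemma content_eq_filter:
  assumes "Poly_Mapping.keys \<gamma> \<subseteq> {..<N}"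
  shows "content \<gamma> = filter_mset ((\<noteq>) 0) (mset (map (Poly_Mapping.lookup \<gamma>) [0..<N]))"
proof -
  have "Poly_Mapping.keys \<gamma> = {i \<in> {0..<N}. 0 \<noteq> Poly_Mapping.lookup \<gamma> i}"
    using assms by (auto simp: in_keys_iff)
  then show ?thesis by (simp add: content_def filter_mset_image_mset)
qed

lemma content_map_key:
  assumes "bij \<pi>"
  shows "content (Poly_Mapping.map_key \<pi> \<gamma>) = content \<gamma>"
proof -
  have inj: "inj \<pi>" and surj: "surj \<pi>" using assms by (auto dest: bij_is_inj bij_is_surj)
  have "content (Poly_Mapping.map_key \<pi> \<gamma>) =
      image_mset (Poly_Mapping.lookup \<gamma>) (image_mset \<pi> (mset_set (\<pi> -` Poly_Mapping.keys \<gamma>)))"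
    by (simp add: content_def Poly_Mapping.map_key.rep_eq inj keys_map_key[OF inj] image_mset.compositionality comp_def)
  also have "image_mset \<pi> (mset_set (\<pi> -` Poly_Mapping.keys \<gamma>)) = mset_set (Poly_Mapping.keys \<gamma>)"
    using inj surj by (subst image_mset_mset_set) (auto simp: inj_on_def surj_image_vimage_eq)
  finally show ?thesis by (simp add: content_def)
qed

text \<open>Written as lists of a common length \<open>N\<close>, the two exponent vectors also have
  equally many zeros, so the lists are permutations of each other. The permutation is the identity
  beyond \<open>N\<close>.\<close>

lemma content_eq_imp_map_key:
  assumes "content \<gamma> = content \<delta>"
  shows "\<exists>\<pi>. bij \<pi> \<and> \<gamma> = Poly_Mapping.map_key \<pi> \<delta>"
proof -
  have "finite (Poly_Mapping.keys \<gamma> \<union> Poly_Mapping.keys \<delta>)" by simp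
  then obtain N where N: "Poly_Mapping.keys \<gamma> \<union> Poly_Mapping.keys \<delta> \<subseteq> {..<N}"
    using finite_nat_iff_bounded by blast
  define xs where "xs \<gamma> = map (Poly_Mapping.lookup \<gamma>) [0..<N]" for \<gamma> :: "nat \<Rightarrow>\<^sub>0 nat"
  have len: "length (xs \<gamma>) = N" for \<gamma> by (simp add: xs_def)
  have dec: "mset (xs \<gamma>) = content \<gamma> + replicate_mset (N - size (content \<gamma>)) 0"
    if "Poly_Mapping.keys \<gamma> \<subseteq> {..<N}" for \<gamma>
  proof -
    have 1: "mset (xs \<gamma>) = content \<gamma> + replicate_mset (count (mset (xs \<gamma>)) 0) 0"
      using multiset_partition[of "mset (xs \<gamma>)" "(\<noteq>) 0"]
      unfolding content_eq_filter[OF that] xs_def[symmetric]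
      by (simp add: filter_eq_replicate_mset[symmetric] eq_commute)
    have "size (mset (xs \<gamma>)) = N" by (simp add: len)
    then have "N = size (content \<gamma>) + count (mset (xs \<gamma>)) 0" using arg_cong[OF 1, of size] by simp
    then show ?thesis using 1 by simp
  qed
  have "mset (xs \<gamma>) = mset (xs \<delta>)" using dec[of \<gamma>] dec[of \<delta>] N assms by simp
  then obtain p where p: "p permutes {..<N}" "permute_list p (xs \<delta>) = xs \<gamma>"
    using mset_eq_permutation[of "xs \<gamma>" "xs \<delta>"] by (metis len)
  have bij: "bij p" using p(1) by (rule permutes_bij)
  have "Poly_Mapping.lookup \<gamma> i = Poly_Mapping.lookup \<delta> (p i)" for i
  proof (cases "i < N")
    case True
    have "xs \<gamma> ! i = xs \<delta> ! p i"
      using p True by (metis len permute_list_nth)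
    moreover have "p i < N" using p(1) True permutes_in_image[OF p(1), of i] by simp
    ultimately show ?thesis using True by (simp add: xs_def)
  next
    case False
    then have "p i = i" using p(1) by (simp add: permutes_not_in)
    moreover have "i \<notin> Poly_Mapping.keys \<gamma>" "i \<notin> Poly_Mapping.keys \<delta>" using False N by auto
    ultimately show ?thesis by (simp add: in_keys_iff)
  qed
  then have "\<gamma> = Poly_Mapping.map_key p \<delta>"
    by (intro poly_mapping_eqI) (simp add: lookup_map_key bij_is_inj[OF bij])
  then show ?thesis using bij by blast
qed

lemma scoeff_map_key: "bij \<pi> \<Longrightarrow> scoeff f (Poly_Mapping.map_key \<pi> \<gamma>) = scoeff f \<gamma>"
  using scoeff[of f] by blast

lemma scoeff_content: "content \<gamma> = content \<delta> \<Longrightarrow> scoeff f \<gamma> = scoeff f \<delta>"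
  using content_eq_imp_map_key[of \<gamma> \<delta>] scoeff_map_key by auto

definition part :: "(nat \<Rightarrow>\<^sub>0 nat) \<Rightarrow> nat list"
  where "part \<gamma> = rev (sorted_list_of_multiset (content \<gamma>))"

lemma mset_part [simp]: "mset (part \<gamma>) = content \<gamma>"
  by (simp add: part_def)

lemma zero_notin_content: "0 \<notin># content \<gamma>"
  by (auto simp: content_def in_keys_iff)

lemma is_partition_part: "is_partition (part \<gamma>)"
proof -
  have "set (part \<gamma>) = set_mset (content \<gamma>)" by (metis mset_part set_mset_mset)
  then show ?thesis using zero_notin_content[of \<gamma>]
    by (simp add: is_partition_def) (simp add: part_def sorted_wrt_rev)
qed

lemma is_partition_eqI:
  assumes "is_partition \<mu>" "is_partition \<nu>" "mset \<mu> = mset \<nu>"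
  shows "\<mu> = \<nu>"
proof -
  have "sorted (rev \<mu>)" "sorted (rev \<nu>)" using assms by (simp_all add: is_partition_def sorted_wrt_rev)
  moreover have "mset (rev \<mu>) = mset (rev \<nu>)" using assms(3) by simp
  ultimately have "rev \<mu> = rev \<nu>" using properties_for_sort by metis
  then show ?thesis by simp
qed

lemma keys_xpow: "Poly_Mapping.keys (xpow xs) \<subseteq> {..<length xs}"
  by (auto simp: in_keys_iff nth_default_def simp del: keys_nth split: if_splits)

lemma content_xpow: "content (xpow xs) = filter_mset ((\<noteq>) 0) (mset xs)"
proof -
  have "map (Poly_Mapping.lookup (xpow xs)) [0..<length xs] = xs"
    by (rule nth_equalityI) (simp_all add: nth_default_def)
  then show ?thesis using content_eq_filter[OF keys_xpow, of xs] by simp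
qed

lemma content_xpow_partition: "is_partition \<mu> \<Longrightarrow> content (xpow \<mu>) = mset \<mu>"
  unfolding content_xpow mset_filter[symmetric] by (subst filter_True) (auto simp: is_partition_def intro: Nat.gr0I)

lemma part_eq_iff: "is_partition \<mu> \<Longrightarrow> part \<gamma> = \<mu> \<longleftrightarrow> content \<gamma> = mset \<mu>"
  using is_partition_eqI[OF is_partition_part, of \<mu> \<gamma>] mset_part[of \<gamma>] by auto

lemma part_xpow: "is_partition \<mu> \<Longrightarrow> part (xpow \<mu>) = \<mu>"
  by (simp add: part_eq_iff content_xpow_partition)

lemma content_xpow_part: "content (xpow (part \<gamma>)) = content \<gamma>"
  by (simp add: content_xpow_partition[OF is_partition_part])

lemma scoeff_part: "scoeff f (xpow (part \<gamma>)) = scoeff f \<gamma>"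
  by (rule scoeff_content[OF content_xpow_part])

lemma scoeff_sym_m:
  assumes "is_partition \<mu>"
  shows "scoeff (sym_m \<mu>) \<gamma> = (if part \<gamma> = \<mu> then 1 else 0)"
proof -
  have "(\<exists>\<pi>. bij \<pi> \<and> \<gamma> = Poly_Mapping.map_key \<pi> (xpow \<mu>)) \<longleftrightarrow> part \<gamma> = \<mu>"
    unfolding part_eq_iff[OF assms] content_xpow_partition[OF assms, symmetric]
    using content_eq_imp_map_key[of \<gamma> "xpow \<mu>"] by (auto simp: content_map_key)
  then show ?thesis by (simp add: sym_m.rep_eq)
qed

lemma sum_mset_content: "sum_mset (content \<gamma>) = total_degree \<gamma>"
  by (simp add: content_def total_degree_def sum_unfold_sum_mset)

lemma sum_list_part [simp]: "sum_list (part \<gamma>) = total_degree \<gamma>"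
  by (metis mset_part sum_mset_content sum_mset_sum_list)

lemma length_part [simp]: "length (part \<gamma>) = card (Poly_Mapping.keys \<gamma>)"
  by (metis mset_part size_mset content_def size_image_mset size_mset_set)

lemma total_degree_xpow: "total_degree (xpow xs) = sum_list xs"
proof -
  have "sum_mset (filter_mset ((\<noteq>) 0) (mset xs)) = sum_list xs" by (induction xs) auto
  then show ?thesis by (simp add: sum_mset_content[symmetric] content_xpow)
qed

lemma scoeff_simps [simp]:
  "scoeff 0 \<gamma> = 0" "scoeff (f + g) \<gamma> = scoeff f \<gamma> + scoeff g \<gamma>" "scoeff (f - g) \<gamma> = scoeff f \<gamma> - scoeff g \<gamma>"
  "scoeff (- f) \<gamma> = - scoeff f \<gamma>"  "scoeff (sscale c f) \<gamma> = c * scoeff f \<gamma>"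
  by (transfer; simp)+

lemma scoeff_one: "scoeff 1 \<gamma> = (if \<gamma> = 0 then 1 else 0)"
  by transfer simp

lemma scoeff_sum [simp]: "scoeff (sum f A) \<gamma> = (\<Sum>a\<in>A. scoeff (f a) \<gamma>)"
  by (induction A rule: infinite_finite_induct) simp_all

lemma symfun_eqI: "(\<And>\<gamma>. scoeff f \<gamma> = scoeff g \<gamma>) \<Longrightarrow> f = g"
  by (simp add: scoeff_inject[symmetric] fun_eq_iff)

lemma sscale_mult_left: "sscale c f * g = sscale c (f * g)"
  by transfer (simp add: conv_def fun_eq_iff sum_distrib_left case_prod_unfold mult.assoc)

lemma sscale_mult_right: "f * sscale c g = sscale c (f * g)"
  using sscale_mult_left[of c g f] by (simp add: mult.commute)

lemma scoeff_bounded: "\<exists>d. \<forall>\<gamma>. scoeff f \<gamma> \<noteq> 0 \<longrightarrow> total_degree \<gamma> \<le> d"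
  using scoeff[of f] by blast

definition partitions_le :: "nat \<Rightarrow> nat list set"
  where "partitions_le D = {\<mu>. is_partition \<mu> \<and> sum_list \<mu> \<le> D}"

lemma finite_partitions_le: "finite (partitions_le D)"
proof (rule finite_subset)
  show "partitions_le D \<subseteq> {xs. set xs \<subseteq> {..D} \<and> length xs \<le> D}"
  proof safe
    fix \<mu> x assume \<mu>: "\<mu> \<in> partitions_le D"
    then show "x \<le> D" if "x \<in> set \<mu>"
      using member_le_sum_list[OF that] by (simp add: partitions_le_def)
    have "length \<mu> \<le> sum_list \<mu>" if "0 \<notin> set \<mu>"
      using that by (induction \<mu>) auto
    then show "length \<mu> \<le> D" using \<mu> by (auto simp: partitions_le_def is_partition_def)
  qed
qed (rule finite_lists_length_le, simp)

lemma symfun_eq_sum_sym_m: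
  assumes "\<And>\<gamma>. scoeff f \<gamma> \<noteq> 0 \<Longrightarrow> total_degree \<gamma> \<le> D"
  shows "f = (\<Sum>\<mu>\<in>partitions_le D. sscale (scoeff f (xpow \<mu>)) (sym_m \<mu>))"
proof (rule symfun_eqI)
  fix \<gamma>
  have "scoeff (\<Sum>\<mu>\<in>partitions_le D. sscale (scoeff f (xpow \<mu>)) (sym_m \<mu>)) \<gamma> =
      (\<Sum>\<mu>\<in>partitions_le D. if part \<gamma> = \<mu> then scoeff f (xpow \<mu>) else 0)"
    unfolding scoeff_sum by (rule sum.cong[OF refl]) (simp add: partitions_le_def scoeff_sym_m)
  also have "\<dots> = (if total_degree \<gamma> \<le> D then scoeff f \<gamma> else 0)"
    using is_partition_part[of \<gamma>] by (simp add: finite_partitions_le scoeff_part) (simp add: partitions_le_def)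
  finally show "scoeff f \<gamma> = scoeff (\<Sum>\<mu>\<in>partitions_le D. sscale (scoeff f (xpow \<mu>)) (sym_m \<mu>)) \<gamma>"
    using assms[of \<gamma>] by auto
qed

section \<open>Products with elementary symmetric functions\<close>

definition ind_mon :: "nat set \<Rightarrow> (nat \<Rightarrow>\<^sub>0 nat)"
  where "ind_mon T = (\<Sum>i\<in>T. Poly_Mapping.single i 1)"

lemma lookup_ind_mon: "finite T \<Longrightarrow> Poly_Mapping.lookup (ind_mon T) i = (if i \<in> T then 1 else 0)"
  by (simp add: ind_mon_def lookup_sum lookup_single when_def)

lemma keys_ind_mon [simp]: "finite T \<Longrightarrow> Poly_Mapping.keys (ind_mon T) = T"
  by (auto simp: in_keys_iff lookup_ind_mon split: if_splits)

lemma total_degree_ind_mon [simp]: "finite T \<Longrightarrow> total_degree (ind_mon T) = card T"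
  by (simp add: total_degree_def lookup_ind_mon)

lemma card_keys_le_total_degree: "card (Poly_Mapping.keys \<gamma>) \<le> total_degree \<gamma>"
  unfolding total_degree_def card_eq_sum by (rule sum_mono) (simp add: in_keys_iff)

lemma total_degree_eq_0_iff: "total_degree \<gamma> = 0 \<longleftrightarrow> \<gamma> = 0"
  by (auto simp: total_degree_def in_keys_iff intro!: poly_mapping_eqI)

lemma ind_mon_add_diff:
  assumes "T \<subseteq> Poly_Mapping.keys \<gamma>"
  shows "ind_mon T + (\<gamma> - ind_mon T) = \<gamma>"
proof (rule poly_mapping_eqI)
  fix i
  have fin: "finite T" using assms by (rule finite_subset) simp
  have "i \<in> T \<Longrightarrow> Poly_Mapping.lookup \<gamma> i > 0" using assms by (auto simp: in_keys_iff)
  then show "Poly_Mapping.lookup (ind_mon T + (\<gamma> - ind_mon T)) i = Poly_Mapping.lookup \<gamma> i"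
    by (simp add: lookup_add lookup_minus lookup_ind_mon[OF fin])
qed

lemma total_degree_diff_ind_mon:
  assumes "T \<subseteq> Poly_Mapping.keys \<gamma>"
  shows "total_degree \<gamma> = total_degree (\<gamma> - ind_mon T) + card T"
proof -
  have "finite T" using assms by (rule finite_subset) simp
  then show ?thesis
    using arg_cong[OF ind_mon_add_diff[OF assms], of total_degree] by (simp add: total_degree_add)
qed

text \<open>The squarefree divisors of degree r of a monomial correspond to the r-element subsets of
  its support.\<close>

lemma scoeff_elementary_mult:
  "scoeff (elementary r * f) \<gamma> =
    (\<Sum>T | T \<subseteq> Poly_Mapping.keys \<gamma> \<and> card T = r. scoeff f (\<gamma> - ind_mon T))"
proof -
  let ?P = "{p. fst p + snd p = \<gamma> \<and> total_degree (fst p) = r \<and> (\<forall>i. Poly_Mapping.lookup (fst p) i \<le> 1)}"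
  have "scoeff (elementary r * f) \<gamma> = (\<Sum>p\<in>{p. fst p + snd p = \<gamma>}. scoeff (elementary r) (fst p) * scoeff f (snd p))"
    by (simp add: times_symfun.rep_eq conv_def case_prod_unfold)
  also have "\<dots> = (\<Sum>p\<in>?P. scoeff f (snd p))"
  proof (rule sum.mono_neutral_cong_right)
    show "finite {p. fst p + snd p = \<gamma>}" using finite_splittings[of \<gamma>] by (simp add: case_prod_unfold)
  qed (auto simp: elementary.rep_eq)
  also have "\<dots> = (\<Sum>T | T \<subseteq> Poly_Mapping.keys \<gamma> \<and> card T = r. scoeff f (\<gamma> - ind_mon T))"
  proof (rule sum.reindex_bij_witness[of _ "\<lambda>T. (ind_mon T, \<gamma> - ind_mon T)" "\<lambda>p. Poly_Mapping.keys (fst p)"])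
    fix p assume p: "p \<in> ?P"
    have eq: "ind_mon (Poly_Mapping.keys (fst p)) = fst p"
    proof (rule poly_mapping_eqI)
      fix i
      have "Poly_Mapping.lookup (fst p) i \<le> 1" using p by blast
      then show "Poly_Mapping.lookup (ind_mon (Poly_Mapping.keys (fst p))) i = Poly_Mapping.lookup (fst p) i"
        by (auto simp: lookup_ind_mon in_keys_iff)
    qed
    show "(ind_mon (Poly_Mapping.keys (fst p)), \<gamma> - ind_mon (Poly_Mapping.keys (fst p))) = p"
      unfolding eq using p by (auto simp: prod_eq_iff)
    show "scoeff f (\<gamma> - ind_mon (Poly_Mapping.keys (fst p))) = scoeff f (snd p)"
      unfolding eq using p by auto
    have "card (Poly_Mapping.keys (fst p)) = total_degree (ind_mon (Poly_Mapping.keys (fst p)))" by simp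
    also have "\<dots> = r" unfolding eq using p by simp
    finally show "Poly_Mapping.keys (fst p) \<in> {T. T \<subseteq> Poly_Mapping.keys \<gamma> \<and> card T = r}"
      using p by (auto simp: in_keys_iff lookup_add)
  next
    fix T assume T: "T \<in> {T. T \<subseteq> Poly_Mapping.keys \<gamma> \<and> card T = r}"
    then have fin: "finite T" by (auto intro: finite_subset)
    show "Poly_Mapping.keys (fst (ind_mon T, \<gamma> - ind_mon T)) = T" using fin by simp
    have "ind_mon T + (\<gamma> - ind_mon T) = \<gamma>" using T by (intro ind_mon_add_diff) simp
    then show "(ind_mon T, \<gamma> - ind_mon T) \<in> ?P" using fin T by (simp add: lookup_ind_mon)
  qed
  finally show ?thesis .
qed

section \<open>The elementary basis\<close>

text \<open>Products over a list ignore order and, under the hypothesis, zero entries; so statements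
  about partitions carry over to arbitrary lists of parts.\<close>

lemma prod_list_part:
  fixes g :: "nat \<Rightarrow> 'a::comm_monoid_mult"
  assumes "g 0 = 1"
  shows "(\<Prod>r\<leftarrow>part (xpow xs). g r) = (\<Prod>r\<leftarrow>xs. g r)"
proof -
  have "(\<Prod>r\<leftarrow>part (xpow xs). g r) = prod_mset (image_mset g (filter_mset ((\<noteq>) 0) (mset xs)))"
    by (simp only: prod_mset_prod_list[symmetric] mset_map mset_part content_xpow)
  also have "\<dots> = (\<Prod>r\<leftarrow>xs. g r)"
    using assms by (induction xs) auto
  finally show ?thesis .
qed

lemma elementary_0 [simp]: "elementary 0 = 1"
  by (rule symfun_eqI) (auto simp: elementary.rep_eq scoeff_one total_degree_eq_0_iff)

lemma complete_homogeneous_0 [simp]: "complete_homogeneous 0 = 1"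
  by (rule symfun_eqI) (auto simp: complete_homogeneous.rep_eq scoeff_one total_degree_eq_0_iff)

lemma sym_e_part: "sym_e (part (xpow xs)) = sym_e xs"
  unfolding sym_e_def by (rule prod_list_part) simp

lemma sym_h_part: "sym_h (part (xpow xs)) = sym_h xs"
  unfolding sym_h_def by (rule prod_list_part) simp

lemma sym_e_simps [simp]: "sym_e [] = 1" "sym_e (r # xs) = elementary r * sym_e xs"
  by (simp_all add: sym_e_def)

lemma sym_h_simps [simp]: "sym_h [] = 1" "sym_h (r # xs) = complete_homogeneous r * sym_h xs"
  by (simp_all add: sym_h_def)

lemma sym_e_in_span_le:
  assumes "sum_list xs \<le> D"
  shows "sym_e xs \<in> symfun.span (sym_e ` partitions_le D)"
proof -
  have "part (xpow xs) \<in> partitions_le D"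
    using assms is_partition_part[of "xpow xs"] by (simp add: partitions_le_def total_degree_xpow)
  then show ?thesis using sym_e_part[of xs] by (metis imageI symfun.span_base)
qed

lemma elementary_mult_in_span:
  assumes "g \<in> symfun.span (sym_e ` partitions_le D)"
  shows "elementary r * g \<in> symfun.span (sym_e ` partitions_le (D + r))"
  using assms
proof (induction rule: symfun.span_induct_alt)
  case base
  then show ?case by (simp add: symfun.span_zero)
next
  case (step c x y)
  then obtain \<mu> where \<mu>: "\<mu> \<in> partitions_le D" "x = sym_e \<mu>" by blast
  have "elementary r * x \<in> symfun.span (sym_e ` partitions_le (D + r))"
    using sym_e_in_span_le[of "r # \<mu>" "D + r"] \<mu> by (simp add: partitions_le_def)
  then show ?case
    using step.IH by (simp add: distrib_left sscale_mult_right symfun.span_add symfun.span_scale)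
qed

text \<open>If the coefficients of \<open>f\<close> vanish at all monomials in fewer than \<open>r\<close> variables, subtracting
  \<open>e\<^sub>r g\<close> for a suitable \<open>g\<close> makes those at the monomials in \<open>r\<close> variables vanish as well.\<close>

lemma in_span_sym_e_aux:
  assumes "\<And>\<gamma>. scoeff f \<gamma> \<noteq> 0 \<Longrightarrow> total_degree \<gamma> \<le> D \<and> r \<le> card (Poly_Mapping.keys \<gamma>)"
  shows "f \<in> symfun.span (sym_e ` partitions_le D)"
  using assms
\<comment> \<open>The measure allows two descents: for g the degree bound drops by r while r returns
  to 0, and for the remainder r rises by one.\<close>
proof (induction "D + (D + 1 - r)" arbitrary: D r f rule: less_induct)
  case less
  show ?case
  proof (cases "r \<le> D")
    case False
    have "scoeff f \<gamma> = 0" for \<gamma>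
    proof (rule ccontr)
      assume "scoeff f \<gamma> \<noteq> 0"
      then show False using less.prems[of \<gamma>] False card_keys_le_total_degree[of \<gamma>] by linarith
    qed
    then have "f = 0" by (intro symfun_eqI) simp
    then show ?thesis by (simp add: symfun.span_zero)
  next
    case True
    \<comment> \<open>\<open>up\<close> pads with zeros to r exponents and raises each by one: it
      inverts the division of a monomial by its r variables.\<close>
    define up where "up \<mu> = xpow (map Suc (\<mu> @ replicate (r - length \<mu>) 0))" for \<mu>
    define A where "A = {\<mu> \<in> partitions_le (D - r). length \<mu> \<le> r}"
    have finA: "finite A" unfolding A_def using finite_partitions_le[of "D - r"] by simp
    define g where "g = (\<Sum>\<mu>\<in>A. sscale (scoeff f (up \<mu>)) (sym_m \<mu>))"
    have g: "scoeff g \<gamma> = (if total_degree \<gamma> \<le> D - r \<and> card (Poly_Mapping.keys \<gamma>) \<le> r then scoeff f (up (part \<gamma>)) else 0)" for \<gamma>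
    proof -
      have "scoeff g \<gamma> = (\<Sum>\<mu>\<in>A. if part \<gamma> = \<mu> then scoeff f (up \<mu>) else 0)"
        unfolding g_def scoeff_sum by (rule sum.cong[OF refl]) (simp add: A_def partitions_le_def scoeff_sym_m)
      also have "\<dots> = (if part \<gamma> \<in> A then scoeff f (up (part \<gamma>)) else 0)"
        by (simp add: finA)
      finally show ?thesis using is_partition_part[of \<gamma>] by (simp add: A_def partitions_le_def)
    qed
    have g_span: "elementary r * g \<in> symfun.span (sym_e ` partitions_le D)"
    \<comment> \<open>The degree bound does not drop for r = 0, but then g is constant.\<close>
    proof (cases "r = 0")
      case True
      have "A = {[]}" using True by (auto simp: A_def partitions_le_def is_partition_def)
      moreover have "sym_m [] = sym_e []"
        by (rule symfun_eqI) (simp add: scoeff_sym_m is_partition_def part_eq_iff content_def scoeff_one mset_set_empty_iff keys_eq_empty)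
      ultimately have "g = sscale (scoeff f (up [])) (sym_e [])" by (simp add: g_def)
      then show ?thesis using True sym_e_in_span_le[of "[]" D] by (simp add: symfun.span_scale)
    next
      case False
      have "g \<in> symfun.span (sym_e ` partitions_le (D - r))"
        by (rule less.hyps[of "D - r" 0]) (use True False in \<open>auto simp: g split: if_splits\<close>)
      then show ?thesis using elementary_mult_in_span[of g "D - r" r] True by simp
    qed
    have key: "scoeff (elementary r * g) \<gamma> = scoeff f \<gamma>"
      if c: "card (Poly_Mapping.keys \<gamma>) = r" for \<gamma>
    proof -
      let ?K = "Poly_Mapping.keys \<gamma>"
      have "{T. T \<subseteq> ?K \<and> card T = r} = {?K}"
        using c card_subset_eq[OF finite_keys, of _ \<gamma>] by auto
      then have 1: "scoeff (elementary r * g) \<gamma> = scoeff g (\<gamma> - ind_mon ?K)"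
        by (simp add: scoeff_elementary_mult)
      define \<delta> where "\<delta> = \<gamma> - ind_mon ?K"
      have lk: "Poly_Mapping.lookup \<gamma> i = Poly_Mapping.lookup \<delta> i + (if i \<in> ?K then 1 else 0)" for i
        by (auto simp: \<delta>_def lookup_minus lookup_ind_mon in_keys_iff)
      have sub: "Poly_Mapping.keys \<delta> \<subseteq> ?K" by (auto simp: \<delta>_def in_keys_iff lookup_minus)
      have deg: "total_degree \<gamma> = total_degree \<delta> + r"
        using total_degree_diff_ind_mon[of ?K \<gamma>] c by (simp add: \<delta>_def)
      have "content (up (part \<delta>)) = content \<gamma>"
      proof -
        have "mset (part \<delta> @ replicate (r - length (part \<delta>)) 0) = image_mset (Poly_Mapping.lookup \<delta>) (mset_set ?K)"
        proof -
          have "mset_set ?K = mset_set (Poly_Mapping.keys \<delta>) + mset_set (?K - Poly_Mapping.keys \<delta>)"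
            using sub by (subst mset_set_Union[symmetric]) (auto simp: Un_absorb1)
          moreover have "image_mset (Poly_Mapping.lookup \<delta>) (mset_set (?K - Poly_Mapping.keys \<delta>)) =
              image_mset (\<lambda>_. 0) (mset_set (?K - Poly_Mapping.keys \<delta>))"
            by (rule image_mset_cong) (simp add: in_keys_iff)
          moreover have "card (?K - Poly_Mapping.keys \<delta>) = r - card (Poly_Mapping.keys \<delta>)"
            using sub c by (simp add: card_Diff_subset)
          ultimately show ?thesis by (simp add: content_def image_mset_const_eq)
        qed
        then have "mset (map Suc (part \<delta> @ replicate (r - length (part \<delta>)) 0)) =
            image_mset (\<lambda>i. Suc (Poly_Mapping.lookup \<delta> i)) (mset_set ?K)"
          unfolding mset_map by (simp add: image_mset.compositionality comp_def)
        also have "\<dots> = content \<gamma>" unfolding content_def by (rule image_mset_cong) (simp add: lk)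
        finally have "mset (map Suc (part \<delta> @ replicate (r - length (part \<delta>)) 0)) = content \<gamma>" .
        then have "content (up (part \<delta>)) = filter_mset ((\<noteq>) 0) (content \<gamma>)"
          unfolding up_def content_xpow by (simp only:)
        also have "\<dots> = content \<gamma>" using zero_notin_content[of \<gamma>] by (auto simp: filter_mset_eq_conv intro!: Nat.gr0I)
        finally show ?thesis .
      qed
      then have "scoeff f (up (part \<delta>)) = scoeff f \<gamma>" by (rule scoeff_content)
      moreover have "card (Poly_Mapping.keys \<delta>) \<le> r" using sub c card_mono[of ?K] by force
      ultimately show ?thesis
        using less.prems[of \<gamma>] deg True unfolding 1 \<delta>_def[symmetric] g
        by (cases "scoeff f \<gamma> = 0") (auto simp: le_diff_conv2)
    qed
    have "f - elementary r * g \<in> symfun.span (sym_e ` partitions_le D)"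
    proof (rule less.hyps[of D "Suc r"])
      show "D + (D + 1 - Suc r) < D + (D + 1 - r)" using True by simp
      fix \<gamma> assume nz: "scoeff (f - elementary r * g) \<gamma> \<noteq> 0"
      show "total_degree \<gamma> \<le> D \<and> Suc r \<le> card (Poly_Mapping.keys \<gamma>)"
      proof (cases "scoeff f \<gamma> = 0")
        case False
        then show ?thesis using less.prems[of \<gamma>] key[of \<gamma>] nz by (cases "card (Poly_Mapping.keys \<gamma>) = r") auto
      next
        case True
        then have "scoeff (elementary r * g) \<gamma> \<noteq> 0" using nz by simp
        then obtain T where T: "T \<subseteq> Poly_Mapping.keys \<gamma>" "card T = r" "scoeff g (\<gamma> - ind_mon T) \<noteq> 0"
          unfolding scoeff_elementary_mult by (metis (mono_tags, lifting) mem_Collect_eq sum.neutral)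
        have "total_degree \<gamma> = total_degree (\<gamma> - ind_mon T) + r"
          using total_degree_diff_ind_mon[OF T(1)] T(2) by simp
        moreover have "total_degree (\<gamma> - ind_mon T) \<le> D - r" using T(3) by (simp add: g split: if_splits)
        moreover have "r \<le> card (Poly_Mapping.keys \<gamma>)" using T card_mono[of "Poly_Mapping.keys \<gamma>" T] by simp
        moreover have "card (Poly_Mapping.keys \<gamma>) \<noteq> r" using key[of \<gamma>] True nz by auto
        ultimately show ?thesis using \<open>r \<le> D\<close> by simp
      qed
    qed
    then show ?thesis using symfun.span_add[OF _ g_span] by fastforce
  qed
qed

lemma in_span_sym_e:
  assumes "\<And>\<gamma>. scoeff f \<gamma> \<noteq> 0 \<Longrightarrow> total_degree \<gamma> \<le> D"
  shows "f \<in> symfun.span (sym_e ` partitions_le D)"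
  using assms by (intro in_span_sym_e_aux[of f D 0]) simp

lemma span_sym_e: "symfun.span (sym_e ` Collect is_partition) = UNIV"
proof -
  have "f \<in> symfun.span (sym_e ` Collect is_partition)" for f
  proof -
    obtain D where "\<forall>\<gamma>. scoeff f \<gamma> \<noteq> 0 \<longrightarrow> total_degree \<gamma> \<le> D" using scoeff_bounded[of f] by blast
    then have "f \<in> symfun.span (sym_e ` partitions_le D)" by (intro in_span_sym_e) blast
    moreover have "sym_e ` partitions_le D \<subseteq> sym_e ` Collect is_partition" by (auto simp: partitions_le_def)
    ultimately show ?thesis using symfun.span_mono by blast
  qed
  then show ?thesis by blast
qed

lemma span_sym_m: "symfun.span (sym_m ` Collect is_partition) = UNIV"
proof -
  have "f \<in> symfun.span (sym_m ` Collect is_partition)" for f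
  proof -
    obtain D where "\<forall>\<gamma>. scoeff f \<gamma> \<noteq> 0 \<longrightarrow> total_degree \<gamma> \<le> D" using scoeff_bounded[of f] by blast
    then have "f = (\<Sum>\<mu>\<in>partitions_le D. sscale (scoeff f (xpow \<mu>)) (sym_m \<mu>))"
      by (intro symfun_eq_sum_sym_m) blast
    moreover have "\<dots> \<in> symfun.span (sym_m ` Collect is_partition)"
      by (intro symfun.span_sum symfun.span_scale symfun.span_base) (auto simp: partitions_le_def)
    ultimately show ?thesis by simp
  qed
  then show ?thesis by blast
qed

lemma inj_on_sym_m: "inj_on sym_m (Collect is_partition)"
proof (rule inj_onI)
  fix \<mu> \<nu> assume "\<mu> \<in> Collect is_partition" "\<nu> \<in> Collect is_partition" "sym_m \<mu> = sym_m \<nu>"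
  then show "\<mu> = \<nu>"
    using scoeff_sym_m[of \<mu> "xpow \<mu>"] scoeff_sym_m[of \<nu> "xpow \<mu>"] by (auto simp: part_xpow split: if_splits)
qed

lemma independent_sym_m: "symfun.independent (sym_m ` Collect is_partition)"
  unfolding symfun.independent_explicit_finite_subsets
proof (intro allI impI ballI)
  fix S u v assume S: "S \<subseteq> sym_m ` Collect is_partition" "finite S" "(\<Sum>v\<in>S. sscale (u v) v) = 0" and v: "v \<in> S"
  obtain \<nu> where \<nu>: "is_partition \<nu>" "v = sym_m \<nu>" using S v by blast
  have "0 = scoeff (\<Sum>v\<in>S. sscale (u v) v) (xpow \<nu>)" by (simp only: S scoeff_simps)
  also have "\<dots> = (\<Sum>w\<in>S. if w = v then u v else 0)"
    unfolding scoeff_sum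
  proof (rule sum.cong[OF refl])
    fix w assume "w \<in> S"
    then obtain \<mu> where \<mu>: "is_partition \<mu>" "w = sym_m \<mu>" using S by blast
    have "w = v \<longleftrightarrow> \<mu> = \<nu>" using \<mu> \<nu> inj_on_sym_m by (auto dest: inj_onD)
    then show "scoeff (sscale (u w) w) (xpow \<nu>) = (if w = v then u v else 0)"
      using \<mu> \<nu> by (auto simp: scoeff_sym_m part_xpow)
  qed
  also have "\<dots> = u v" using S(2) v by simp
  finally show "u v = 0" by simp
qed

text \<open>Up to degree \<open>D\<close>, the span of the e_\<mu> contains the independent m_\<mu>,
  and both families have the same finite index set. Counting forces the e_\<mu> to be distinct and
  independent.\<close>

lemma inj_on_sym_e_le: "inj_on sym_e (partitions_le D)"
  and independent_sym_e_le: "symfun.independent (sym_e ` partitions_le D)"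
proof -
  let ?P = "partitions_le D"
  obtain B where B: "B \<subseteq> sym_e ` ?P" "symfun.independent B" "sym_e ` ?P \<subseteq> symfun.span B"
    using symfun.maximal_independent_subset by blast
  have finB: "finite B" using B(1) finite_partitions_le finite_surj by blast
  have "sym_m ` ?P \<subseteq> symfun.span (sym_e ` ?P)"
  proof
    fix v assume "v \<in> sym_m ` ?P"
    then obtain \<mu> where \<mu>: "is_partition \<mu>" "sum_list \<mu> \<le> D" "v = sym_m \<mu>" by (auto simp: partitions_le_def)
    show "v \<in> symfun.span (sym_e ` ?P)"
      by (rule in_span_sym_e) (use \<mu> in \<open>auto simp: scoeff_sym_m split: if_splits\<close>)
  qed
  also have "\<dots> \<subseteq> symfun.span B" using B(3) by (rule symfun.span_minimal) (rule symfun.subspace_span)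
  finally have sub: "sym_m ` ?P \<subseteq> symfun.span B" .
  have "symfun.independent (sym_m ` ?P)"
    by (rule symfun.independent_mono[OF independent_sym_m]) (auto simp: partitions_le_def)
  from symfun.independent_span_bound[OF finB this sub]
  have "card (sym_m ` ?P) \<le> card B" ..
  moreover have "card (sym_m ` ?P) = card ?P"
    by (rule card_image, rule inj_on_subset[OF inj_on_sym_m]) (auto simp: partitions_le_def)
  moreover have "card B \<le> card (sym_e ` ?P)" using B(1) by (intro card_mono) (simp_all add: finite_partitions_le)
  moreover have "card (sym_e ` ?P) \<le> card ?P" by (rule card_image_le[OF finite_partitions_le])
  ultimately have eq: "card B = card (sym_e ` ?P)" "card (sym_e ` ?P) = card ?P" by linarith+
  show "inj_on sym_e ?P" using eq(2) by (rule eq_card_imp_inj_on[OF finite_partitions_le])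
  have "B = sym_e ` ?P" using B(1) eq(1) by (intro card_subset_eq) (simp_all add: finite_partitions_le)
  then show "symfun.independent (sym_e ` ?P)" using B(2) by simp
qed

lemma inj_on_sym_e: "inj_on sym_e (Collect is_partition)"
proof (rule inj_onI)
  fix \<mu> \<nu> assume "\<mu> \<in> Collect is_partition" "\<nu> \<in> Collect is_partition" "sym_e \<mu> = sym_e \<nu>"
  then show "\<mu> = \<nu>" using inj_onD[OF inj_on_sym_e_le[of "sum_list \<mu> + sum_list \<nu>"], of \<mu> \<nu>]
    by (simp add: partitions_le_def)
qed

text \<open>A linear relation is finite, hence of bounded degree, which reduces it to
  \<open>independent_sym_e_le\<close>.\<close>

lemma independent_sym_e: "symfun.independent (sym_e ` Collect is_partition)"
  unfolding symfun.independent_explicit_finite_subsets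
proof (intro allI impI ballI)
  fix S u v assume S: "S \<subseteq> sym_e ` Collect is_partition" "finite S" "(\<Sum>v\<in>S. sscale (u v) v) = 0" and v: "v \<in> S"
  obtain Q where Q: "Q \<subseteq> Collect is_partition" "finite Q" "S = sym_e ` Q"
    using S(1,2) by (meson finite_subset_image)
  have "Q \<subseteq> partitions_le (\<Sum>\<mu>\<in>Q. sum_list \<mu>)"
    using Q(1,2) by (auto simp: partitions_le_def intro: member_le_sum)
  then have "S \<subseteq> sym_e ` partitions_le (\<Sum>\<mu>\<in>Q. sum_list \<mu>)" using Q(3) by blast
  then show "u v = 0"
    using independent_sym_e_le[of "\<Sum>\<mu>\<in>Q. sum_list \<mu>"] S v
    unfolding symfun.independent_explicit_finite_subsets by blast
qed

section \<open>The involution and the scalar product\<close>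

lemma sum_sign_card_subsets:
  assumes "finite A" "A \<noteq> {}"
  shows "(\<Sum>T\<in>Pow A. (- 1) ^ card T) = (0::rat)"
proof -
  have "(\<Sum>T\<in>Pow A. (- 1) ^ card T) = (\<Sum>T\<in>Pow A. (\<Prod>x\<in>T. (- 1::rat)) * (\<Prod>x\<in>A - T. 1))" by simp
  also have "\<dots> = (\<Prod>x\<in>A. - 1 + 1)" by (rule prod_add[OF assms(1), symmetric])
  also have "\<dots> = 0" using assms by (simp add: prod_zero_iff card_gt_0_iff)
  finally show ?thesis .
qed

text \<open>The relation E(-z) H(z) = 1 of generating series. At a monomial of degree n it is the
  alternating sum over the subsets of its nonempty support.\<close>

lemma sum_elementary_complete_homogeneous:
  assumes "0 < n"
  shows "(\<Sum>i\<le>n. sscale ((- 1) ^ i) (elementary i * complete_homogeneous (n - i))) = 0"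
proof (rule symfun_eqI)
  fix \<gamma> :: "nat \<Rightarrow>\<^sub>0 nat"
  let ?K = "Poly_Mapping.keys \<gamma>"
  have le: "card ?K \<le> total_degree \<gamma>" by (rule card_keys_le_total_degree)
  have "scoeff (elementary i * complete_homogeneous (n - i)) \<gamma> =
      (\<Sum>T | T \<in> Pow ?K \<and> card T = i. if total_degree \<gamma> = n then 1 else 0)" if "i \<le> n" for i
    unfolding scoeff_elementary_mult
  proof (rule sum.cong)
    fix T assume "T \<in> {T \<in> Pow ?K. card T = i}"
    then show "scoeff (complete_homogeneous (n - i)) (\<gamma> - ind_mon T) = (if total_degree \<gamma> = n then 1 else 0)"
      using total_degree_diff_ind_mon[of T \<gamma>] that by (auto simp: complete_homogeneous.rep_eq)
  qed auto
  then have "scoeff (\<Sum>i\<le>n. sscale ((- 1) ^ i) (elementary i * complete_homogeneous (n - i))) \<gamma> =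
      (\<Sum>i\<le>n. \<Sum>T | T \<in> Pow ?K \<and> card T = i. (- 1) ^ card T * (if total_degree \<gamma> = n then 1 else 0))"
    by (simp add: sum_distrib_left mult.commute)
  also have "\<dots> = 0"
  proof (cases "total_degree \<gamma> = n")
    case True
    have "card ` Pow ?K \<subseteq> {..n}" using le True by (auto intro!: order_trans[OF card_mono[of ?K]])
    then have "(\<Sum>i\<le>n. \<Sum>T | T \<in> Pow ?K \<and> card T = i. (- 1) ^ card T) = (\<Sum>T\<in>Pow ?K. (- 1) ^ card T :: rat)"
      by (intro sum.group) simp_all
    also have "\<dots> = 0" using True assms by (intro sum_sign_card_subsets) auto
    finally show ?thesis using True by simp
  qed simp
  finally show "scoeff (\<Sum>i\<le>n. sscale ((- 1) ^ i) (elementary i * complete_homogeneous (n - i))) \<gamma> = scoeff 0 \<gamma>"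
    by simp
qed

interpretation symfun_endo: vector_space_pair sscale sscale
  by unfold_locales

interpretation symfun_dual: vector_space_pair sscale "(*) :: rat \<Rightarrow> rat \<Rightarrow> rat"
  by unfold_locales

lemma symfun_endo_linearI:
  assumes "\<And>x y. f (x + y) = f x + f y" "\<And>c x. f (sscale c x) = sscale c (f x)"
  shows "Vector_Spaces.linear sscale sscale f"
  unfolding Vector_Spaces.linear_iff using assms symfun.vector_space_axioms by blast

lemma symfun_dual_linearI:
  assumes "\<And>x y. f (x + y) = f x + f y" "\<And>c x. f (sscale c x) = c * f x"
  shows "Vector_Spaces.linear sscale ((*) :: rat \<Rightarrow> rat \<Rightarrow> rat) f"
  unfolding Vector_Spaces.linear_iff
  using assms symfun.vector_space_axioms vector_space_over_itself.vector_space_axioms by blast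

text \<open>Independence of the e_\<mu> gives existence of the linear map, and their span gives
  uniqueness.\<close>

lemma omega_spec:
  "Vector_Spaces.linear sscale sscale omega \<and> (\<forall>\<mu>. is_partition \<mu> \<longrightarrow> omega (sym_e \<mu>) = sym_h \<mu>)"
proof -
  define f where "f = symfun_endo.construct (sym_e ` Collect is_partition)
    (\<lambda>v. sym_h (the_inv_into (Collect is_partition) sym_e v))"
  have f: "Vector_Spaces.linear sscale sscale f \<and> (\<forall>\<mu>. is_partition \<mu> \<longrightarrow> f (sym_e \<mu>) = sym_h \<mu>)"
    unfolding f_def
    by (auto simp: symfun_endo.linear_construct independent_sym_e symfun_endo.construct_basis
        the_inv_into_f_f[OF inj_on_sym_e])
  let ?Q = "\<lambda>\<phi>. Vector_Spaces.linear sscale sscale \<phi> \<and> (\<forall>\<mu>. is_partition \<mu> \<longrightarrow> \<phi> (sym_e \<mu>) = sym_h \<mu>)"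
  have "\<exists>!\<phi>. ?Q \<phi>"
  proof (rule ex1I[of ?Q f, OF f])
    fix g assume g: "Vector_Spaces.linear sscale sscale g \<and> (\<forall>\<mu>. is_partition \<mu> \<longrightarrow> g (sym_e \<mu>) = sym_h \<mu>)"
    show "g = f"
    proof
      fix x
      show "g x = f x"
        by (rule symfun_endo.linear_eq_on[of g f, where B = "sym_e ` Collect is_partition"])
          (use f g span_sym_e in auto)
    qed
  qed
  from theI'[OF this] show ?thesis unfolding omega_def .
qed

lemma linear_omega: "Vector_Spaces.linear sscale sscale omega"
  using omega_spec by blast

lemma omega_sym_e: "omega (sym_e xs) = sym_h xs"
  using omega_spec is_partition_part[of "xpow xs"] sym_e_part[of xs] sym_h_part[of xs] by metis

lemma omega_add: "omega (f + g) = omega f + omega g"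
  using linear_omega by (simp add: symfun_endo.linear_add)

lemma omega_sscale: "omega (sscale c f) = sscale c (omega f)"
  using linear_omega by (simp add: symfun_endo.linear_scale)

lemma symfun_endo_eqI:
  assumes "Vector_Spaces.linear sscale sscale f" "Vector_Spaces.linear sscale sscale g"
    and "\<And>\<mu>. is_partition \<mu> \<Longrightarrow> f (sym_e \<mu>) = g (sym_e \<mu>)"
  shows "f x = g x"
  by (rule symfun_endo.linear_eq_on[OF assms(1,2), where B = "sym_e ` Collect is_partition"])
    (use assms(3) span_sym_e in auto)

lemma sym_e_append: "sym_e (xs @ ys) = sym_e xs * sym_e ys"
  by (simp add: sym_e_def)

lemma sym_h_append: "sym_h (xs @ ys) = sym_h xs * sym_h ys"
  by (simp add: sym_h_def)

text \<open>The e_\<mu> are closed under products, so multiplicativity extends linearly, first in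
  one factor and then in the other.\<close>

lemma omega_mult: "omega (f * g) = omega f * omega g"
proof -
  have 1: "omega (sym_e \<mu> * g) = sym_h \<mu> * omega g" for \<mu> g
    by (rule symfun_endo_eqI[of "\<lambda>g. omega (sym_e \<mu> * g)" "\<lambda>g. sym_h \<mu> * omega g"];
        (rule symfun_endo_linearI)?)
      (simp_all add: omega_add omega_sscale distrib_left sscale_mult_right
        sym_e_append[symmetric] sym_h_append[symmetric] omega_sym_e)
  show ?thesis
    by (rule symfun_endo_eqI[of "\<lambda>f. omega (f * g)" "\<lambda>f. omega f * omega g"];
        (rule symfun_endo_linearI)?)
      (simp_all add: omega_add omega_sscale distrib_right sscale_mult_left 1 omega_sym_e)
qed

lemma omega_elementary: "omega (elementary n) = complete_homogeneous n"
  using omega_sym_e[of "[n]"] by simp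

lemma omega_sum: "omega (sum f A) = (\<Sum>a\<in>A. omega (f a))"
  using linear_omega by (rule symfun_endo.linear_sum)

text \<open>Applying \<open>omega\<close> to the relation between e and h yields a recursion for the
  images of the h_n; the same relation read backwards is this recursion for the e_n.\<close>

lemma omega_complete_homogeneous: "omega (complete_homogeneous n) = elementary n"
proof (induction n rule: less_induct)
  case (less n)
  show ?case
  proof (cases "n = 0")
    case True
    then show ?thesis using omega_sym_e[of "[]"] by simp
  next
    case False
    then have n: "0 < n" by simp
    define S where "S = (\<Sum>i<n. sscale ((- 1) ^ Suc i) (complete_homogeneous (Suc i) * elementary (n - Suc i)))"
    have "0 = omega (\<Sum>i\<le>n. sscale ((- 1) ^ i) (elementary i * complete_homogeneous (n - i)))"
      unfolding sum_elementary_complete_homogeneous[OF n] using omega_sscale[of 0 0] by simp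
    also have "\<dots> = (\<Sum>i\<le>n. sscale ((- 1) ^ i) (complete_homogeneous i * omega (complete_homogeneous (n - i))))"
      by (simp add: omega_sum omega_sscale omega_mult omega_elementary)
    also have "\<dots> = omega (complete_homogeneous n) +
        (\<Sum>i<n. sscale ((- 1) ^ Suc i) (complete_homogeneous (Suc i) * omega (complete_homogeneous (n - Suc i))))"
      by (subst sum.atMost_shift) simp
    also have "(\<Sum>i<n. sscale ((- 1) ^ Suc i) (complete_homogeneous (Suc i) * omega (complete_homogeneous (n - Suc i)))) = S"
      unfolding S_def by (rule sum.cong[OF refl]) (simp add: less.IH)
    finally have 1: "omega (complete_homogeneous n) = - S" by (simp add: eq_neg_iff_add_eq_0)
    \<comment> \<open>Reversing the summation exchanges the roles of e and h up to the sign
      \<open>(- 1) ^ n\<close>.\<close>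
    have "0 = sscale ((- 1) ^ n) (\<Sum>i\<le>n. sscale ((- 1) ^ i) (elementary i * complete_homogeneous (n - i)))"
      unfolding sum_elementary_complete_homogeneous[OF n] by simp
    also have "\<dots> = (\<Sum>i\<le>n. sscale ((- 1) ^ n * (- 1) ^ (n - i)) (elementary (n - i) * complete_homogeneous i))"
      unfolding symfun.scale_sum_right
      by (rule sum.reindex_bij_witness[of _ "\<lambda>i. n - i" "\<lambda>i. n - i"]) simp_all
    also have "\<dots> = (\<Sum>i\<le>n. sscale ((- 1) ^ i) (complete_homogeneous i * elementary (n - i)))"
    proof (rule sum.cong[OF refl])
      fix i assume "i \<in> {..n}"
      then have e: "n + (n - i) = i + 2 * (n - i)" by simp
      have "(- 1) ^ n * (- 1) ^ (n - i) = ((- 1) ^ i :: rat)"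
        unfolding power_add[symmetric] e by (simp add: power_add power_mult)
      then show "sscale ((- 1) ^ n * (- 1) ^ (n - i)) (elementary (n - i) * complete_homogeneous i) =
          sscale ((- 1) ^ i) (complete_homogeneous i * elementary (n - i))"
        by (simp add: mult.commute)
    qed
    also have "\<dots> = elementary n + S"
      unfolding S_def by (subst sum.atMost_shift) simp
    finally have "elementary n = - S" by (simp add: eq_neg_iff_add_eq_0)
    then show ?thesis using 1 by simp
  qed
qed

lemma omega_sym_h: "omega (sym_h xs) = sym_e xs"
proof (induction xs)
  case Nil
  show ?case using omega_sym_e[of "[]"] by simp
qed (simp add: omega_mult omega_complete_homogeneous)

lemma omega_omega: "omega (omega f) = f"
proof -
  have "(omega \<circ> omega) f = id f"
    by (rule symfun_endo_eqI[of "omega \<circ> omega" id]; (rule symfun_endo_linearI)?)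
      (simp_all add: omega_add omega_sscale omega_sym_e omega_sym_h)
  then show ?thesis by simp
qed

lemma sym_h_image: "sym_h ` A = omega ` sym_e ` A"
  by (simp add: image_image omega_sym_e)

lemma span_sym_h: "symfun.span (sym_h ` Collect is_partition) = UNIV"
  unfolding sym_h_image symfun_endo.linear_span_image[OF linear_omega] span_sym_e
  using omega_omega by (metis surjI)

lemma inj_omega: "inj omega"
  by (metis injI omega_omega)

lemma independent_sym_h: "symfun.independent (sym_h ` Collect is_partition)"
  unfolding sym_h_image
  by (rule symfun_endo.linear_independent_injective_image[OF linear_omega independent_sym_e])
    (rule inj_on_subset[OF inj_omega], simp)

lemma inj_on_sym_h: "inj_on sym_h (Collect is_partition)"
proof (rule inj_onI)
  fix \<mu> \<nu> assume *: "\<mu> \<in> Collect is_partition" "\<nu> \<in> Collect is_partition" "sym_h \<mu> = sym_h \<nu>"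
  then have "sym_e \<mu> = sym_e \<nu>" by (metis omega_sym_h)
  then show "\<mu> = \<nu>" using * inj_on_sym_e by (auto dest: inj_onD)
qed

section \<open>The Hall scalar product\<close>

lemma symfun_dual_eqI:
  assumes "Vector_Spaces.linear sscale (*) f" "Vector_Spaces.linear sscale (*) g"
    and "symfun.span B = UNIV" "\<And>b. b \<in> B \<Longrightarrow> f b = g b"
  shows "f x = (g x :: rat)"
  by (rule symfun_dual.linear_eq_on[OF assms(1,2), where B = B]) (use assms(3,4) in auto)

text \<open>Existence: on the basis element h_\<nu> the functional \<open>B f\<close> takes the
  coefficient of f at x^\<nu>. Uniqueness: the m_\<mu> span in the left argument and the h_\<nu> in
  the right one.\<close>

lemma hall_spec:
  "(\<forall>g. Vector_Spaces.linear sscale (*) (\<lambda>f. hall f g)) \<and>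
   (\<forall>f. Vector_Spaces.linear sscale (*) (hall f)) \<and>
   (\<forall>\<mu> \<nu>. is_partition \<mu> \<longrightarrow> is_partition \<nu> \<longrightarrow> hall (sym_m \<mu>) (sym_h \<nu>) = (if \<mu> = \<nu> then 1 else 0))"
proof -
  let ?H = "sym_h ` Collect is_partition"
  define F where "F f v = scoeff f (xpow (the_inv_into (Collect is_partition) sym_h v))" for f v
  define B where "B f = symfun_dual.construct ?H (F f)" for f
  let ?Q = "\<lambda>B. (\<forall>g. Vector_Spaces.linear sscale (*) (\<lambda>f. B f g)) \<and>
   (\<forall>f. Vector_Spaces.linear sscale (*) (B f)) \<and>
   (\<forall>\<mu> \<nu>. is_partition \<mu> \<longrightarrow> is_partition \<nu> \<longrightarrow> B (sym_m \<mu>) (sym_h \<nu>) = (if \<mu> = \<nu> then 1 else 0))"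
  have B: "?Q B"
  proof (intro conjI allI impI)
    fix g
    show "Vector_Spaces.linear sscale (*) (\<lambda>f. B f g)"
      unfolding B_def symfun_dual.construct_def F_def
      by (rule symfun_dual_linearI)
        (auto simp: sum.distrib[symmetric] sum_distrib_left algebra_simps intro!: sum.cong)
  next
    fix f
    show "Vector_Spaces.linear sscale (*) (B f)"
      unfolding B_def by (rule symfun_dual.linear_construct[OF independent_sym_h])
  next
    fix \<mu> \<nu> :: "nat list" assume *: "is_partition \<mu>" "is_partition \<nu>"
    then have "B (sym_m \<mu>) (sym_h \<nu>) = F (sym_m \<mu>) (sym_h \<nu>)"
      unfolding B_def by (intro symfun_dual.construct_basis[OF independent_sym_h]) simp
    then show "B (sym_m \<mu>) (sym_h \<nu>) = (if \<mu> = \<nu> then 1 else 0)"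
      using * by (simp add: F_def the_inv_into_f_f[OF inj_on_sym_h] scoeff_sym_m part_xpow)
  qed
  have "\<exists>!B. ?Q B"
  proof (rule ex1I[of ?Q B, OF B])
    fix B' assume B': "?Q B'"
    have 1: "B' f (sym_h \<nu>) = B f (sym_h \<nu>)" if "is_partition \<nu>" for f \<nu>
      by (rule symfun_dual_eqI[of "\<lambda>f. B' f (sym_h \<nu>)" "\<lambda>f. B f (sym_h \<nu>)", OF _ _ span_sym_m])
        (use B B' that in auto)
    have "B' f g = B f g" for f g
      by (rule symfun_dual_eqI[of "B' f" "B f", OF _ _ span_sym_h]) (use B B' 1 in auto)
    then show "B' = B" by blast
  qed
  from theI'[OF this] show ?thesis unfolding hall_def .
qed

lemma linear_hall_left: "Vector_Spaces.linear sscale (*) (\<lambda>f. hall f g)"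
  and linear_hall_right: "Vector_Spaces.linear sscale (*) (hall f)"
  using hall_spec by auto

lemma linear_scoeff: "Vector_Spaces.linear sscale (*) (\<lambda>f. scoeff f \<gamma>)"
  by (rule symfun_dual_linearI) simp_all

lemma hall_sym_h: "hall f (sym_h xs) = scoeff f (xpow xs)"
proof -
  have "hall f (sym_h \<nu>) = scoeff f (xpow \<nu>)" if "is_partition \<nu>" for \<nu>
    by (rule symfun_dual_eqI[of "\<lambda>f. hall f (sym_h \<nu>)" "\<lambda>f. scoeff f (xpow \<nu>)", OF linear_hall_left linear_scoeff span_sym_m])
      (use hall_spec that in \<open>auto simp: scoeff_sym_m part_xpow\<close>)
  from this[OF is_partition_part[of "xpow xs"]] show ?thesis
    by (simp add: sym_h_part scoeff_part)
qed

text \<open>The coefficients of \<open>h\<^sub>\<mu>\<close> and \<open>e\<^sub>\<mu>\<close> count matrices with prescribed row and column sums, the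
  rows being monomials; transposition gives the symmetry in the two partitions.\<close>

definition mon_factorizations :: "(nat \<Rightarrow> bool) \<Rightarrow> nat list \<Rightarrow> (nat \<Rightarrow>\<^sub>0 nat) \<Rightarrow> (nat \<Rightarrow>\<^sub>0 nat) list set"
  where "mon_factorizations P xs \<gamma> = {ms. list_all2 (\<lambda>m x. total_degree m = x \<and> (\<forall>i. P (Poly_Mapping.lookup m i))) ms xs \<and>
    sum_list ms = \<gamma>}"

lemma mon_factorizations_Cons:
  "mon_factorizations P (x # xs) \<gamma> = (\<Union>p\<in>{p. fst p + snd p = \<gamma> \<and> total_degree (fst p) = x \<and>
      (\<forall>i. P (Poly_Mapping.lookup (fst p) i))}. (#) (fst p) ` mon_factorizations P xs (snd p))"
  by (force simp: mon_factorizations_def list_all2_Cons2)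

lemma finite_splittings_if: "finite {p. fst p + snd p = (\<gamma> :: nat \<Rightarrow>\<^sub>0 nat) \<and> Q p}"
  by (rule finite_subset[OF _ finite_splittings[of \<gamma>]]) auto

lemma scoeff_prod_list:
  assumes g: "\<And>r \<gamma>. scoeff (g r) \<gamma> = (if total_degree \<gamma> = r \<and> (\<forall>i. P (Poly_Mapping.lookup \<gamma> i)) then 1 else 0)"
  shows "finite (mon_factorizations P xs \<gamma>)"
    and "scoeff (\<Prod>r\<leftarrow>xs. g r) \<gamma> = of_nat (card (mon_factorizations P xs \<gamma>))"
proof -
  have fin: "finite (mon_factorizations P xs \<gamma>)" for \<gamma> xs
  proof (induction xs arbitrary: \<gamma>)
    case Nil
    have "mon_factorizations P [] \<gamma> \<subseteq> {[]}" by (auto simp: mon_factorizations_def)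
    then show ?case by (rule finite_subset) simp
  next
    case (Cons x xs)
    then show ?case unfolding mon_factorizations_Cons by (intro finite_UN_I finite_splittings_if) auto
  qed
  then show "finite (mon_factorizations P xs \<gamma>)" .
  show "scoeff (\<Prod>r\<leftarrow>xs. g r) \<gamma> = of_nat (card (mon_factorizations P xs \<gamma>))"
  proof (induction xs arbitrary: \<gamma>)
    case Nil
    have "mon_factorizations P [] \<gamma> = (if \<gamma> = 0 then {[]} else {})" by (auto simp: mon_factorizations_def)
    then show ?case by (simp add: scoeff_one)
  next
    case (Cons x xs)
    let ?P = "{p. fst p + snd p = \<gamma> \<and> total_degree (fst p) = x \<and> (\<forall>i. P (Poly_Mapping.lookup (fst p) i))}"
    have "scoeff (\<Prod>r\<leftarrow>x # xs. g r) \<gamma> =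
        (\<Sum>p\<in>{p. fst p + snd p = \<gamma>}. scoeff (g x) (fst p) * of_nat (card (mon_factorizations P xs (snd p))))"
      by (simp add: times_symfun.rep_eq conv_def case_prod_unfold Cons.IH)
    also have "\<dots> = (\<Sum>p\<in>?P. of_nat (card (mon_factorizations P xs (snd p))))"
    proof (rule sum.mono_neutral_cong_right)
      show "finite {p. fst p + snd p = \<gamma>}" using finite_splittings_if[of \<gamma> "\<lambda>_. True"] by simp
    qed (auto simp: g)
    also have "\<dots> = of_nat (card (\<Union>p\<in>?P. (#) (fst p) ` mon_factorizations P xs (snd p)))"
    proof (subst card_UN_disjoint)
      show "finite ?P" by (rule finite_splittings_if)
      show "\<forall>p\<in>?P. finite ((#) (fst p) ` mon_factorizations P xs (snd p))" using fin by blast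
      show "\<forall>p\<in>?P. \<forall>p'\<in>?P. p \<noteq> p' \<longrightarrow>
          (#) (fst p) ` mon_factorizations P xs (snd p) \<inter> (#) (fst p') ` mon_factorizations P xs (snd p') = {}"
        by (auto simp: mon_factorizations_def prod_eq_iff)
    qed (simp add: card_image)
    finally show ?case unfolding mon_factorizations_Cons .
  qed
qed

lemma lookup_sum_list_mon: "Poly_Mapping.lookup (sum_list ms) j = (\<Sum>m\<leftarrow>ms. Poly_Mapping.lookup m j)"
  by (induction ms) (simp_all add: lookup_add)

definition transposed :: "nat \<Rightarrow> (nat \<Rightarrow>\<^sub>0 nat) list \<Rightarrow> (nat \<Rightarrow>\<^sub>0 nat) list"
  where "transposed k ms = map (\<lambda>j. xpow (map (\<lambda>m. Poly_Mapping.lookup m j) ms)) [0..<k]"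

lemma transposed_mon_factorizations:
  assumes P: "P 0" and ms: "ms \<in> mon_factorizations P xs (xpow ys)"
  shows "transposed (length ys) ms \<in> mon_factorizations P ys (xpow xs)"
    and "transposed (length xs) (transposed (length ys) ms) = ms"
proof -
  have len: "length ms = length xs" using ms by (auto simp: mon_factorizations_def list_all2_lengthD)
  have row: "total_degree (ms ! i) = xs ! i" "P (Poly_Mapping.lookup (ms ! i) j)" if "i < length xs" for i j
    using ms that by (auto simp: mon_factorizations_def list_all2_conv_all_nth)
  have col: "(\<Sum>m\<leftarrow>ms. Poly_Mapping.lookup m j) = nth_default 0 ys j" for j
    using ms lookup_sum_list_mon[of ms j] by (auto simp: mon_factorizations_def)
  \<comment> \<open>A variable beyond the list \<open>ys\<close> has exponent 0 in the product, so
    no row contains it; hence transposing twice loses nothing.\<close>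
  have out: "Poly_Mapping.lookup m j = 0" if "m \<in> set ms" "length ys \<le> j" for m j
  proof -
    have "Poly_Mapping.lookup m j \<le> (\<Sum>m\<leftarrow>ms. Poly_Mapping.lookup m j)"
      using that(1) by (intro member_le_sum_list) auto
    then show ?thesis using col[of j] that(2) by (simp add: nth_default_def)
  qed
  have lk: "Poly_Mapping.lookup (transposed (length ys) ms ! j) i = (if i < length xs then Poly_Mapping.lookup (ms ! i) j else 0)"
    if "j < length ys" for i j
    using that len by (simp add: transposed_def nth_default_def)
  show "transposed (length ys) ms \<in> mon_factorizations P ys (xpow xs)"
    unfolding mon_factorizations_def mem_Collect_eq list_all2_conv_all_nth
  proof (intro conjI allI impI)
    show "length (transposed (length ys) ms) = length ys" by (simp add: transposed_def)
    fix j assume "j < length (transposed (length ys) ms)"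
    then have j: "j < length ys" by (simp add: transposed_def)
    have "total_degree (transposed (length ys) ms ! j) = (\<Sum>m\<leftarrow>ms. Poly_Mapping.lookup m j)"
      using j by (simp add: transposed_def total_degree_xpow)
    also have "\<dots> = ys ! j" using col[of j] j by (simp add: nth_default_def)
    finally show "total_degree (transposed (length ys) ms ! j) = ys ! j" .
    show "P (Poly_Mapping.lookup (transposed (length ys) ms ! j) i)" for i
      unfolding lk[OF j] using row P by simp
  next
    show "sum_list (transposed (length ys) ms) = xpow xs"
    proof (rule poly_mapping_eqI)
      fix i
      have "Poly_Mapping.lookup (sum_list (transposed (length ys) ms)) i =
          (\<Sum>j<length ys. if i < length xs then Poly_Mapping.lookup (ms ! i) j else 0)"
        unfolding lookup_sum_list_mon using lk
        by (simp add: sum_list_sum_nth transposed_def atLeast0LessThan cong: sum.cong)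
          (simp add: transposed_def nth_default_def len)
      also have "\<dots> = (if i < length xs then total_degree (ms ! i) else 0)"
      proof (cases "i < length xs")
        case True
        have "Poly_Mapping.keys (ms ! i) \<subseteq> {..<length ys}"
          using out[of "ms ! i"] True len by (force simp: in_keys_iff not_less[symmetric])
        then show ?thesis using True by (simp add: total_degree_superset[of "{..<length ys}"])
      qed simp
      also have "\<dots> = Poly_Mapping.lookup (xpow xs) i" using row by (simp add: nth_default_def)
      finally show "Poly_Mapping.lookup (sum_list (transposed (length ys) ms)) i = Poly_Mapping.lookup (xpow xs) i" .
    qed
  qed
  show "transposed (length xs) (transposed (length ys) ms) = ms"
  proof (rule nth_equalityI)
    show "length (transposed (length xs) (transposed (length ys) ms)) = length ms" by (simp add: transposed_def len)
    fix i assume "i < length (transposed (length xs) (transposed (length ys) ms))"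
    then have i: "i < length xs" by (simp add: transposed_def)
    show "transposed (length xs) (transposed (length ys) ms) ! i = ms ! i"
    proof (rule poly_mapping_eqI)
      fix j
      have "length (transposed (length ys) ms) = length ys" by (simp add: transposed_def)
      then show "Poly_Mapping.lookup (transposed (length xs) (transposed (length ys) ms) ! i) j = Poly_Mapping.lookup (ms ! i) j"
        using i out[of "ms ! i" j] len lk[of j i]
        by (subst transposed_def) (auto simp: nth_default_def)
    qed
  qed
qed

lemma card_mon_factorizations_commute:
  assumes "P 0"
  shows "card (mon_factorizations P xs (xpow ys)) = card (mon_factorizations P ys (xpow xs))"
  by (rule bij_betw_same_card[of "transposed (length ys)"],
      rule bij_betw_byWitness[of _ "transposed (length xs)"])
    (use transposed_mon_factorizations[where P = P, OF assms] in auto)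

lemma scoeff_sym_h_commute: "scoeff (sym_h xs) (xpow ys) = scoeff (sym_h ys) (xpow xs)"
proof -
  have "scoeff (sym_h xs) (xpow ys) = of_nat (card (mon_factorizations (\<lambda>_. True) xs (xpow ys)))" for xs ys
    unfolding sym_h_def by (rule scoeff_prod_list) (simp add: complete_homogeneous.rep_eq)
  then show ?thesis using card_mon_factorizations_commute[of "\<lambda>_. True" xs ys] by simp
qed

lemma scoeff_sym_e_commute: "scoeff (sym_e xs) (xpow ys) = scoeff (sym_e ys) (xpow xs)"
proof -
  have "scoeff (sym_e xs) (xpow ys) = of_nat (card (mon_factorizations (\<lambda>k. k \<le> 1) xs (xpow ys)))" for xs ys
    unfolding sym_e_def by (rule scoeff_prod_list) (simp add: elementary.rep_eq)
  then show ?thesis using card_mon_factorizations_commute[of "\<lambda>k. k \<le> 1" xs ys] by simp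
qed

lemma hall_sym_h_left: "hall (sym_h xs) g = scoeff g (xpow xs)"
  by (rule symfun_dual_eqI[OF linear_hall_right linear_scoeff span_sym_h])
    (auto simp: hall_sym_h scoeff_sym_h_commute)

text \<open>For f = e_\<mu> the left side pairs h_\<mu> with \<open>sym_e xs\<close>, which gives
  the coefficient of \<open>sym_e xs\<close> at x^\<mu>; transposition of matrices turns it into
  that of e_\<mu> at \<open>xpow xs\<close>.\<close>

theorem hall_omega_sym_e: "hall (omega f) (sym_e xs) = scoeff f (xpow xs)"
proof (rule symfun_dual_eqI[of "\<lambda>f. hall (omega f) (sym_e xs)" "\<lambda>f. scoeff f (xpow xs)", OF _ linear_scoeff span_sym_e])
  show "Vector_Spaces.linear sscale (*) (\<lambda>f. hall (omega f) (sym_e xs))"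
    using linear_hall_left[of "sym_e xs"]
    by (intro symfun_dual_linearI) (simp_all add: Vector_Spaces.linear_iff omega_add omega_sscale)
qed (auto simp: omega_sym_e hall_sym_h_left scoeff_sym_e_commute)

section \<open>Hall--Littlewood sums\<close>

lemma sum_subsets_Un:
  assumes "finite A" "finite B" "A \<inter> B = {}"
  shows "(\<Sum>S | S \<subseteq> A \<union> B \<and> card S = r. f S) =
    (\<Sum>j\<le>min (card B) r. \<Sum>T | T \<subseteq> B \<and> card T = j. \<Sum>U | U \<subseteq> A \<and> card U = r - j. f (U \<union> T))"
proof -
  have fin: "finite {S. S \<subseteq> C \<and> P S}" if "finite C" for C :: "'a set" and P
    using that by (auto intro: finite_subset[of _ "Pow C"])
  have "(\<Sum>S | S \<subseteq> A \<union> B \<and> card S = r. f S) =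
      (\<Sum>j\<le>min (card B) r. \<Sum>S | S \<in> {S. S \<subseteq> A \<union> B \<and> card S = r} \<and> card (S \<inter> B) = j. f S)"
  proof (rule sum.group[symmetric])
    show "(\<lambda>S. card (S \<inter> B)) ` {S. S \<subseteq> A \<union> B \<and> card S = r} \<subseteq> {..min (card B) r}"
    proof (rule image_subsetI)
      fix S assume S: "S \<in> {S. S \<subseteq> A \<union> B \<and> card S = r}"
      then have "finite S" using assms(1,2) by (auto dest: finite_subset)
      then have "card (S \<inter> B) \<le> card S" by (intro card_mono) auto
      moreover have "card (S \<inter> B) \<le> card B" using assms(2) by (intro card_mono) auto
      ultimately show "card (S \<inter> B) \<in> {..min (card B) r}" using S by simp
    qed
  qed (use assms fin in auto)
  also have "\<dots> = (\<Sum>j\<le>min (card B) r. \<Sum>(T, U)\<in>{T. T \<subseteq> B \<and> card T = j} \<times> {U. U \<subseteq> A \<and> card U = r - j}. f (U \<union> T))"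
  proof (rule sum.cong[OF refl])
    fix j assume j: "j \<in> {..min (card B) r}"
    show "(\<Sum>S | S \<in> {S. S \<subseteq> A \<union> B \<and> card S = r} \<and> card (S \<inter> B) = j. f S) =
        (\<Sum>(T, U)\<in>{T. T \<subseteq> B \<and> card T = j} \<times> {U. U \<subseteq> A \<and> card U = r - j}. f (U \<union> T))"
    proof (rule sum.reindex_bij_witness[of _ "\<lambda>(T, U). U \<union> T" "\<lambda>S. (S \<inter> B, S \<inter> A)"])
      fix S assume S: "S \<in> {S \<in> {S. S \<subseteq> A \<union> B \<and> card S = r}. card (S \<inter> B) = j}"
      have dec: "(S \<inter> A) \<union> (S \<inter> B) = S" using S by auto
      have "card ((S \<inter> A) \<union> (S \<inter> B)) = card (S \<inter> A) + card (S \<inter> B)"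
        using assms by (intro card_Un_disjoint) auto
      then have "card (S \<inter> A) = r - j" using S unfolding dec by auto
      then show "(S \<inter> B, S \<inter> A) \<in> {T. T \<subseteq> B \<and> card T = j} \<times> {U. U \<subseteq> A \<and> card U = r - j}"
        using S by auto
      show "(case (S \<inter> B, S \<inter> A) of (T, U) \<Rightarrow> U \<union> T) = S"
        "(case (S \<inter> B, S \<inter> A) of (T, U) \<Rightarrow> f (U \<union> T)) = f S" using dec by simp_all
    next
      fix p assume p: "p \<in> {T. T \<subseteq> B \<and> card T = j} \<times> {U. U \<subseteq> A \<and> card U = r - j}"
      obtain T U where TU: "p = (T, U)" by (cases p)
      have sub: "T \<subseteq> B" "U \<subseteq> A" "card T = j" "card U = r - j" using p TU by auto
      have "finite T" "finite U" using sub assms finite_subset by blast+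
      moreover have "U \<inter> T = {}" using sub assms by blast
      ultimately have "card (U \<union> T) = r" using sub j by (simp add: card_Un_disjoint)
      moreover have "(U \<union> T) \<inter> B = T" "(U \<union> T) \<inter> A = U" using sub assms by blast+
      ultimately show "(case p of (T, U) \<Rightarrow> U \<union> T) \<in> {S \<in> {S. S \<subseteq> A \<union> B \<and> card S = r}. card (S \<inter> B) = j}"
        "((case p of (T, U) \<Rightarrow> U \<union> T) \<inter> B, (case p of (T, U) \<Rightarrow> U \<union> T) \<inter> A) = p"
        using sub TU by auto
    qed
  qed
  also have "\<dots> = (\<Sum>j\<le>min (card B) r. \<Sum>T | T \<subseteq> B \<and> card T = j. \<Sum>U | U \<subseteq> A \<and> card U = r - j. f (U \<union> T))"
    by (simp add: sum.cartesian_product)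
  finally show ?thesis .
qed

section \<open>Sums over permutations with arbitrary exponents\<close>

definition bump :: "(nat \<Rightarrow> nat) \<Rightarrow> nat set \<Rightarrow> nat \<Rightarrow> nat"
  where "bump \<alpha> S i = \<alpha> i + (if i \<in> S then 1 else 0)"

lemma bump_bump: "S \<inter> T = {} \<Longrightarrow> bump (bump \<alpha> S) T = bump \<alpha> (S \<union> T)"
  by (auto simp: bump_def fun_eq_iff)

lemma bump_empty [simp]: "bump \<alpha> {} = \<alpha>"
  by (simp add: bump_def fun_eq_iff)

text \<open>The larger index comes first; \<open>hl_factor\<close> reads the pair
  accordingly.\<close>

definition pairs :: "nat \<Rightarrow> (nat \<times> nat) set"
  where "pairs N = (SIGMA j:{..<N}. {..<j})"

definition hl_factor :: "(nat \<Rightarrow> 'a::field) \<Rightarrow> 'a \<Rightarrow> (nat \<Rightarrow> nat) \<Rightarrow> nat \<times> nat \<Rightarrow> 'a"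
  where "hl_factor x q w p = (x (w (snd p)) - q * x (w (fst p))) / (x (w (snd p)) - x (w (fst p)))"

text \<open>The exponent is an arbitrary function because raising exponents leads out of the
  partitions; the variables are arbitrary field elements because \<open>hl_sum_0\<close> permutes
  them.\<close>

definition hl_sum :: "(nat \<Rightarrow> 'a::field) \<Rightarrow> 'a \<Rightarrow> nat \<Rightarrow> (nat \<Rightarrow> nat) \<Rightarrow> 'a"
  where "hl_sum x q N \<alpha> = (\<Sum>w | w permutes {..<N}. (\<Prod>i<N. x (w i) ^ \<alpha> i) * prod (hl_factor x q w) (pairs N))"

lemma finite_pairs [simp]: "finite (pairs N)"
  by (simp add: pairs_def)

lemma prod_power_bump:
  assumes "S \<subseteq> {..<N}"
  shows "(\<Prod>i<N. y i ^ bump \<alpha> S i) = (\<Prod>i\<in>S. y i) * (\<Prod>i<N. (y i :: 'a::comm_monoid_mult) ^ \<alpha> i)"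
proof -
  have "(\<Prod>i<N. y i ^ bump \<alpha> S i) = (\<Prod>i<N. (if i \<in> S then y i else 1) * y i ^ \<alpha> i)"
    by (rule prod.cong) (auto simp: bump_def)
  also have "\<dots> = (\<Prod>i<N. if i \<in> S then y i else 1) * (\<Prod>i<N. y i ^ \<alpha> i)" by (rule prod.distrib)
  also have "(\<Prod>i<N. if i \<in> S then y i else 1) = (\<Prod>i\<in>S. y i)"
    using assms by (simp add: prod.inter_restrict[symmetric] Int_absorb1 Int_absorb2)
  finally show ?thesis .
qed

locale hl_variables =
  fixes x :: "nat \<Rightarrow> 'a::field" and q :: 'a and N :: nat
  assumes inj_x: "inj_on x {..<N}" and two: "(2::'a) \<noteq> 0"
begin

abbreviation R :: "(nat \<Rightarrow> nat) \<Rightarrow> 'a" where "R \<equiv> hl_sum x q N"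

text \<open>The summands of \<open>R (\<beta> + 1\<^sub>k\<^sub>+\<^sub>1) - q R (\<beta> + 1\<^sub>k)\<close> at \<open>w\<close> and at \<open>w\<close> composed with the transposition
  of \<open>k\<close> and \<open>k + 1\<close> cancel.\<close>

lemma hl_sum_adjacent:
  assumes k: "Suc k < N" and \<beta>: "\<beta> k = \<beta> (Suc k)"
  shows "R (bump \<beta> {Suc k}) = q * R (bump \<beta> {k})"
proof -
  define s where "s = Transposition.transpose k (Suc k)"
  have ss: "s (s i) = i" for i by (simp add: s_def)
  have s_perm: "s permutes {..<N}" unfolding s_def using k by (intro permutes_swap_id) auto
  \<comment> \<open>The transposition permutes the other pairs and keeps the order within them, so
    only the factor at this pair changes.\<close>
  define Q where "Q = pairs N - {(Suc k, k)}"
  define E where "E w = prod (hl_factor x q w) Q" for w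
  have D: "prod (hl_factor x q w) (pairs N) = hl_factor x q w (Suc k, k) * E w" for w
    unfolding E_def Q_def using k by (intro prod.remove) (auto simp: pairs_def)
  have E: "E (w \<circ> s) = E w" for w
    unfolding E_def
    by (rule prod.reindex_bij_witness[of _ "map_prod s s" "map_prod s s"])
      (use k in \<open>auto simp: Q_def pairs_def hl_factor_def s_def Transposition.transpose_def split: if_splits\<close>)
  define B where "B w = (\<Prod>i<N. x (w i) ^ \<beta> i)" for w
  have B: "B (w \<circ> s) = B w" for w
    unfolding B_def
    by (rule prod.reindex_bij_witness[of _ s s])
      (use k \<beta> in \<open>auto simp: s_def Transposition.transpose_def split: if_splits\<close>)
  define F where "F w = (x (w (Suc k)) - q * x (w k)) * B w * (hl_factor x q w (Suc k, k) * E w)" for w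
  have diff: "R (bump \<beta> {Suc k}) - q * R (bump \<beta> {k}) = (\<Sum>w | w permutes {..<N}. F w)"
    unfolding hl_sum_def sum_distrib_left sum_subtractf[symmetric]
  proof (rule sum.cong[OF refl])
    fix w
    show "(\<Prod>i<N. x (w i) ^ bump \<beta> {Suc k} i) * prod (hl_factor x q w) (pairs N) -
        q * ((\<Prod>i<N. x (w i) ^ bump \<beta> {k} i) * prod (hl_factor x q w) (pairs N)) = F w"
      using k prod_power_bump[of "{Suc k}" N "\<lambda>i. x (w i)" \<beta>] prod_power_bump[of "{k}" N "\<lambda>i. x (w i)" \<beta>]
      by (simp add: D F_def B_def algebra_simps)
  qed
  have shift: "(\<Sum>w | w permutes {..<N}. F w) = (\<Sum>w | w permutes {..<N}. F (w \<circ> s))"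
  proof (rule sum.reindex_bij_witness[of _ "\<lambda>w. w \<circ> s" "\<lambda>w. w \<circ> s"])
    fix w assume w: "w \<in> {w. w permutes {..<N}}"
    show "(w \<circ> s) \<circ> s = w" by (simp add: fun_eq_iff ss)
    then show "F ((w \<circ> s) \<circ> s) = F w" by simp
    show "w \<circ> s \<in> {w. w permutes {..<N}}" using permutes_compose[OF s_perm] w by blast
  qed (auto simp: fun_eq_iff ss permutes_compose[OF s_perm])
  have neg: "F (w \<circ> s) = - F w" if "w permutes {..<N}" for w
  proof -
    have "F (w \<circ> s) = (x (w k) - q * x (w (Suc k))) * B w *
        ((x (w (Suc k)) - q * x (w k)) / (x (w (Suc k)) - x (w k)) * E w)"
      unfolding F_def E B by (simp add: hl_factor_def s_def)
    also have "x (w (Suc k)) - x (w k) = - (x (w k) - x (w (Suc k)))" by simp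
    finally have Fs: "F (w \<circ> s) = (x (w k) - q * x (w (Suc k))) * B w *
        ((x (w (Suc k)) - q * x (w k)) / - (x (w k) - x (w (Suc k))) * E w)" .
    \<comment> \<open>Exchanging the two numerators and reversing the sign of the denominator
      negates the term.\<close>
    have swap: "u * b * (v / - d * e) = - (v * b * (u / d * e))" for u v b d e :: 'a
      by (simp only: divide_minus_right mult_minus_left mult_minus_right times_divide_eq_left times_divide_eq_right)
        (simp only: ac_simps)
    show ?thesis
      unfolding Fs unfolding F_def hl_factor_def fst_conv snd_conv by (rule swap)
  qed
  have "(\<Sum>w | w permutes {..<N}. F (w \<circ> s)) = - (\<Sum>w | w permutes {..<N}. F w)"
    unfolding sum_negf[symmetric] by (rule sum.cong[OF refl]) (simp only: mem_Collect_eq neg)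
  then have "2 * (\<Sum>w | w permutes {..<N}. F w) = 0"
    unfolding shift[symmetric] mult_2 by (simp only: eq_neg_iff_add_eq_0)
  then show ?thesis using two diff by simp
qed

lemma hl_sum_move:
  assumes "c + d < N" "\<And>i. i \<le> d \<Longrightarrow> \<beta> (c + i) = \<beta> c"
  shows "R (bump \<beta> {c + d}) = q ^ d * R (bump \<beta> {c})"
  using assms
proof (induction d)
  case (Suc d)
  have "R (bump \<beta> {Suc (c + d)}) = q * R (bump \<beta> {c + d})"
    using Suc.prems(1) Suc.prems(2)[of d] Suc.prems(2)[of "Suc d"] by (intro hl_sum_adjacent) simp_all
  then show ?case using Suc by simp
qed simp

text \<open>Straightening every \<open>T\<close> to an initial segment of the block produces powers
  of q that add up to the Gaussian binomial. In the induction, if \<open>T\<close> contains the last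
  position, the other l positions are straightened first and then the last one moves n - l places,
  the exponent in the Pascal rule defining \<open>qbinomial\<close>.\<close>

lemma hl_sum_block:
  assumes "a + n \<le> N" "\<And>i. i < n \<Longrightarrow> \<beta> (a + i) = \<beta> a"
  shows "(\<Sum>T | T \<subseteq> {a..<a + n} \<and> card T = k. R (bump \<beta> T)) = qbinomial q n k * R (bump \<beta> {a..<a + k})"
  using assms
proof (induction n arbitrary: k \<beta>)
  case 0
  have "{T. T \<subseteq> {a..<a + 0} \<and> card T = k} = (if k = 0 then {{}} else {})" by auto
  then show ?case by (cases k) (simp_all only: if_True if_False simp_thms, simp_all)
next
  case (Suc n)
  show ?case
  proof (cases k)
    case 0
    have "{T. T \<subseteq> {a..<a + Suc n} \<and> card T = 0} = {{}}" by (auto dest: finite_subset)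
    then show ?thesis using 0 by simp
  next
    case k: (Suc l)
    let ?A = "{a..<a + n}"
    have "{T. T \<subseteq> {a..<a + Suc n} \<and> card T = k} =
        {T. T \<subseteq> ?A \<and> card T = k} \<union> insert (a + n) ` {T. T \<subseteq> ?A \<and> card T = l}" (is "?L = ?R")
    proof (intro equalityI subsetI)
      fix T assume T: "T \<in> ?L"
      then have fin: "finite T" by (auto dest: finite_subset)
      show "T \<in> ?R"
      proof (cases "a + n \<in> T")
        case True
        then have "T = insert (a + n) (T - {a + n})" "T - {a + n} \<subseteq> ?A" "card (T - {a + n}) = l"
          using T k fin by auto
        then show ?thesis by blast
      next
        case False
        then have "T \<subseteq> ?A" using T by (auto simp: less_Suc_eq)
        then show ?thesis using T by blast
      qed
    next
      fix T assume T: "T \<in> ?R"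
      have "card (insert (a + n) U) = Suc (card U)" if "U \<subseteq> ?A" for U
      proof -
        have "finite U" "a + n \<notin> U" using that by (auto dest: finite_subset)
        then show ?thesis by simp
      qed
      then show "T \<in> ?L" using T k by auto
    qed
    moreover have "(\<Sum>T\<in>\<dots>. R (bump \<beta> T)) =
        (\<Sum>T | T \<subseteq> ?A \<and> card T = k. R (bump \<beta> T)) + (\<Sum>T\<in>insert (a + n) ` {T. T \<subseteq> ?A \<and> card T = l}. R (bump \<beta> T))"
      by (rule sum.union_disjoint) (auto intro: finite_subset[of _ "Pow ?A"])
    moreover have "(\<Sum>T\<in>insert (a + n) ` {T. T \<subseteq> ?A \<and> card T = l}. R (bump \<beta> T)) =
        (\<Sum>T | T \<subseteq> ?A \<and> card T = l. R (bump \<beta> (insert (a + n) T)))"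
      by (rule sum.reindex_cong[OF _ refl refl]) (auto simp: inj_on_def dest!: insert_ident[THEN iffD1, rotated 2])
    moreover have "(\<Sum>T | T \<subseteq> ?A \<and> card T = l. R (bump \<beta> (insert (a + n) T))) =
        q ^ (n - l) * qbinomial q n l * R (bump \<beta> {a..<a + k})"
    proof -
      have "(\<Sum>T | T \<subseteq> ?A \<and> card T = l. R (bump \<beta> (insert (a + n) T))) =
          (\<Sum>T | T \<subseteq> ?A \<and> card T = l. R (bump (bump \<beta> {a + n}) T))"
      proof (rule sum.cong[OF refl])
        fix T assume "T \<in> {T. T \<subseteq> ?A \<and> card T = l}"
        then show "R (bump \<beta> (insert (a + n) T)) = R (bump (bump \<beta> {a + n}) T)"
          by (subst bump_bump) auto
      qed
      also have "\<dots> = qbinomial q n l * R (bump (bump \<beta> {a + n}) {a..<a + l})"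
      proof (rule Suc.IH)
        fix i assume "i < n"
        then show "bump \<beta> {a + n} (a + i) = bump \<beta> {a + n} a"
          using Suc.prems(2)[of i] by (auto simp: bump_def)
      qed (use Suc.prems(1) in simp)
      also have "\<dots> = q ^ (n - l) * qbinomial q n l * R (bump \<beta> {a..<a + k})"
      proof (cases "l \<le> n")
        case True
        have "bump (bump \<beta> {a + n}) {a..<a + l} = bump (bump \<beta> {a..<a + l}) {a + l + (n - l)}"
          using True by (auto simp: bump_def fun_eq_iff)
        moreover have "R (bump (bump \<beta> {a..<a + l}) {a + l + (n - l)}) = q ^ (n - l) * R (bump (bump \<beta> {a..<a + l}) {a + l})"
        proof (rule hl_sum_move)
          show "a + l + (n - l) < N" using True Suc.prems(1) by simp
          fix i assume "i \<le> n - l"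
          then show "bump \<beta> {a..<a + l} (a + l + i) = bump \<beta> {a..<a + l} (a + l)"
            using Suc.prems(2)[of "l + i"] Suc.prems(2)[of l] True by (simp add: bump_def add.assoc)
        qed
        moreover have "bump (bump \<beta> {a..<a + l}) {a + l} = bump \<beta> {a..<a + k}"
          using k by (auto simp: bump_def fun_eq_iff)
        ultimately show ?thesis by (simp add: mult_ac)
      qed (simp add: qbinomial_eq_0)
      finally show ?thesis .
    qed
    moreover have "(\<Sum>T | T \<subseteq> ?A \<and> card T = k. R (bump \<beta> T)) = qbinomial q n k * R (bump \<beta> {a..<a + k})"
      by (rule Suc.IH) (use Suc.prems in auto)
    ultimately show ?thesis unfolding k by (simp add: distrib_right)
  qed
qed

text \<open>The elementary symmetric polynomial is invariant under \<open>w\<close>, so it can be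
  moved inside the sum over permutations.\<close>

lemma esym_times_hl_sum:
  "(\<Sum>S | S \<subseteq> {..<N} \<and> card S = r. \<Prod>i\<in>S. x i) * R \<alpha> = (\<Sum>S | S \<subseteq> {..<N} \<and> card S = r. R (bump \<alpha> S))"
proof -
  let ?S = "{S. S \<subseteq> {..<N} \<and> card S = r}"
  have w: "(\<Sum>S\<in>?S. \<Prod>i\<in>S. x i) = (\<Sum>S\<in>?S. \<Prod>i\<in>S. x (w i))" if w: "w permutes {..<N}" for w
  proof (rule sum.reindex_bij_witness[of _ "image w" "image (inv w)"])
    note i = permutes_inverses[OF w]
    have img: "v ` S \<in> ?S" if "S \<in> ?S" "v permutes {..<N}" for S v
      using that permutes_in_image[OF that(2)] permutes_inj[OF that(2)]
      by (auto simp: card_image inj_on_subset)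
    fix S assume S: "S \<in> ?S"
    show "w ` inv w ` S = S" "inv w ` w ` S = S" by (simp_all add: image_image i)
    show "inv w ` S \<in> ?S" "w ` S \<in> ?S" using img[OF S] w permutes_inv[OF w] by blast+
    show "(\<Prod>i\<in>inv w ` S. x (w i)) = (\<Prod>i\<in>S. x i)"
      using permutes_inj[OF permutes_inv[OF w]] by (subst prod.reindex) (auto intro: inj_on_subset simp: i)
  qed
  have "(\<Sum>S\<in>?S. \<Prod>i\<in>S. x i) * R \<alpha> =
      (\<Sum>w | w permutes {..<N}. (\<Sum>S\<in>?S. \<Prod>i\<in>S. x (w i)) * ((\<Prod>i<N. x (w i) ^ \<alpha> i) * prod (hl_factor x q w) (pairs N)))"
    unfolding hl_sum_def sum_distrib_left by (rule sum.cong[OF refl]) (simp add: w)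
  also have "\<dots> = (\<Sum>w | w permutes {..<N}. \<Sum>S\<in>?S. (\<Prod>i<N. x (w i) ^ bump \<alpha> S i) * prod (hl_factor x q w) (pairs N))"
    unfolding sum_distrib_right
    by (intro sum.cong refl) (subst prod_power_bump, auto simp: mult_ac)
  also have "\<dots> = (\<Sum>S\<in>?S. R (bump \<alpha> S))"
    unfolding hl_sum_def by (rule sum.swap)
  finally show ?thesis .
qed

end

lemma split_fraction:
  fixes a b y q :: "'a::field"
  assumes "a - y \<noteq> 0" "b - y \<noteq> 0" "a - b \<noteq> 0"
  shows "(a - q * y) / (a - y) * (1 / (b - y)) =
    1 / (b - y) * ((a - q * b) / (a - b)) + (1 - q) * a / (a - y) * (1 / (b - a))"
proof -
  define u v w where "u = a - y" "v = b - y" "w = a - b"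
  have ne: "u \<noteq> 0" "v \<noteq> 0" "w \<noteq> 0" using assms by (simp_all add: u_v_w_def)
  have w: "b - a = - w" by (simp add: u_v_w_def)
  have key: "(a - q * b) * u - (1 - q) * a * v = (a - q * y) * w"
    by (simp add: u_v_w_def algebra_simps)
  have gen: "1 / v * (A / w) + B / u * (1 / - w) = (A * u - B * v) / (u * v * w)" for A B
    using ne by (simp add: field_simps)
  show ?thesis
    unfolding u_v_w_def[symmetric] w gen key using ne by simp
qed

text \<open>Partial fractions in y: the value at infinity is \<open>q ^ card A\<close> and the poles
  are the values of x. In the induction, \<open>split_fraction\<close> separates off the pole at
  \<open>x a\<close>, whose residue is assembled by the induction hypothesis at y =
  \<open>x a\<close>.\<close>

lemma partial_fractions:
  fixes x :: "'b \<Rightarrow> 'a::field"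
  assumes "finite A" "inj_on x A" "\<And>l. l \<in> A \<Longrightarrow> x l \<noteq> y"
  shows "(\<Prod>l\<in>A. (x l - q * y) / (x l - y)) =
    q ^ card A + (\<Sum>m\<in>A. (1 - q) * x m / (x m - y) * (\<Prod>l\<in>A - {m}. (x l - q * x m) / (x l - x m)))"
  using assms
proof (induction A arbitrary: y rule: finite_induct)
  case (insert a A)
  let ?c = "\<lambda>m. \<Prod>l\<in>A - {m}. (x l - q * x m) / (x l - x m)"
  have ne: "x a - x m \<noteq> 0" "x m - x a \<noteq> 0" if "m \<in> A" for m
    using inj_onD[OF insert.prems(1), of a m] insert.hyps(2) that by auto
  have ay: "x a - y \<noteq> 0" using insert.prems(2) by simp
  have my: "x m - y \<noteq> 0" if "m \<in> A" for m using insert.prems(2) that by simp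
  have IH: "(\<Prod>l\<in>A. (x l - q * z) / (x l - z)) = q ^ card A + (\<Sum>m\<in>A. (1 - q) * x m / (x m - z) * ?c m)"
    if "\<And>l. l \<in> A \<Longrightarrow> x l \<noteq> z" for z
    by (rule insert.IH) (use insert.prems(1) that in auto)
  have at_a: "(\<Prod>l\<in>A. (x l - q * x a) / (x l - x a)) = q ^ card A + (\<Sum>m\<in>A. (1 - q) * x m / (x m - x a) * ?c m)"
    by (rule IH) (use ne in auto)
  have c': "(\<Prod>l\<in>insert a A - {m}. (x l - q * x m) / (x l - x m)) = (x a - q * x m) / (x a - x m) * ?c m" if "m \<in> A" for m
  proof -
    have "insert a A - {m} = insert a (A - {m})" using that insert.hyps(2) by auto
    then show ?thesis using insert.hyps by simp
  qed
  have ca: "(\<Prod>l\<in>insert a A - {a}. (x l - q * x a) / (x l - x a)) = (\<Prod>l\<in>A. (x l - q * x a) / (x l - x a))"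
    using insert.hyps(2) by simp
  have fa: "(x a - q * y) / (x a - y) = q + (1 - q) * x a / (x a - y)"
    using ay by (simp add: field_simps)
  have split_term: "(x a - q * y) / (x a - y) * ((1 - q) * x m / (x m - y) * C) =
      (1 - q) * x m / (x m - y) * ((x a - q * x m) / (x a - x m) * C) +
      (1 - q) * x a / (x a - y) * ((1 - q) * x m / (x m - x a) * C)" if "m \<in> A" for m C
  proof -
    have "(x a - q * y) / (x a - y) * (1 / (x m - y)) =
        1 / (x m - y) * ((x a - q * x m) / (x a - x m)) + (1 - q) * x a / (x a - y) * (1 / (x m - x a))"
      using split_fraction[OF ay my[OF that] ne(1)[OF that], of q] .
    then have "(1 - q) * x m * C * ((x a - q * y) / (x a - y) * (1 / (x m - y))) = (1 - q) * x m * C *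
       (1 / (x m - y) * ((x a - q * x m) / (x a - x m)) + (1 - q) * x a / (x a - y) * (1 / (x m - x a)))"
      by (simp only:)
    then show ?thesis by (simp add: distrib_left mult_ac)
  qed
  have "(\<Prod>l\<in>insert a A. (x l - q * y) / (x l - y)) =
      (x a - q * y) / (x a - y) * (q ^ card A + (\<Sum>m\<in>A. (1 - q) * x m / (x m - y) * ?c m))"
    using insert.hyps by (simp add: IH insert.prems(2))
  also have "\<dots> = (x a - q * y) / (x a - y) * q ^ card A +
      (\<Sum>m\<in>A. (1 - q) * x m / (x m - y) * ((x a - q * x m) / (x a - x m) * ?c m)) +
      (1 - q) * x a / (x a - y) * (\<Sum>m\<in>A. (1 - q) * x m / (x m - x a) * ?c m)"
    unfolding distrib_left sum_distrib_left add.assoc sum.distrib[symmetric]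
    using split_term by (intro arg_cong2[where f = "(+)"] refl sum.cong)
  also have "(x a - q * y) / (x a - y) * q ^ card A = q ^ Suc (card A) + (1 - q) * x a / (x a - y) * q ^ card A"
    unfolding fa by (simp add: distrib_right)
  also have "q ^ Suc (card A) + (1 - q) * x a / (x a - y) * q ^ card A +
      (\<Sum>m\<in>A. (1 - q) * x m / (x m - y) * ((x a - q * x m) / (x a - x m) * ?c m)) +
      (1 - q) * x a / (x a - y) * (\<Sum>m\<in>A. (1 - q) * x m / (x m - x a) * ?c m) =
      q ^ Suc (card A) + ((1 - q) * x a / (x a - y) * (q ^ card A + (\<Sum>m\<in>A. (1 - q) * x m / (x m - x a) * ?c m)) +
      (\<Sum>m\<in>A. (1 - q) * x m / (x m - y) * ((x a - q * x m) / (x a - x m) * ?c m)))"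
    by (simp only: distrib_left add_ac)
  also have "\<dots> = q ^ card (insert a A) +
      (\<Sum>m\<in>insert a A. (1 - q) * x m / (x m - y) * (\<Prod>l\<in>insert a A - {m}. (x l - q * x m) / (x l - x m)))"
    unfolding at_a[symmetric] ca[symmetric] sum.insert[OF insert.hyps] card_insert_disjoint[OF insert.hyps]
    by (simp only: c' cong: sum.cong)
  finally show ?case .
qed simp

text \<open>The case y = 0 of \<open>partial_fractions\<close>, where every factor on the left is
  1.\<close>

lemma sum_prod_ratios:
  fixes x :: "'b \<Rightarrow> 'a::field"
  assumes "finite A" "inj_on x A" "q \<noteq> 1" "\<And>l. l \<in> A \<Longrightarrow> x l \<noteq> 0"
  shows "(\<Sum>m\<in>A. \<Prod>l\<in>A - {m}. (x l - q * x m) / (x l - x m)) = (\<Sum>j<card A. q ^ j)"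
proof -
  have "1 = q ^ card A + (1 - q) * (\<Sum>m\<in>A. \<Prod>l\<in>A - {m}. (x l - q * x m) / (x l - x m))"
    using partial_fractions[OF assms(1,2), of 0 q] assms(4) by (simp add: sum_distrib_left)
  then have "(1 - q) * (\<Sum>m\<in>A. \<Prod>l\<in>A - {m}. (x l - q * x m) / (x l - x m)) = 1 - q ^ card A"
    by (simp add: algebra_simps)
  also have "\<dots> = (1 - q) * (\<Sum>j<card A. q ^ j)" by (rule one_diff_power_eq)
  finally show ?thesis using assms(3) by simp
qed

lemma pairs_Suc: "pairs (Suc N) = pairs N \<union> {N} \<times> {..<N}"
  by (auto simp: pairs_def less_Suc_eq)

text \<open>Summing over the value \<open>b\<close> of \<open>w\<close> at the last variable reduces the claim to the identity \<open>sum_prod_ratios\<close>.\<close>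

lemma hl_sum_0:
  fixes x :: "nat \<Rightarrow> 'a::field"
  assumes "inj_on x {..<N}" "q \<noteq> 1" "\<And>l. l < N \<Longrightarrow> x l \<noteq> 0"
  shows "hl_sum x q N (\<lambda>_. 0) = qfact q N"
  using assms
proof (induction N arbitrary: x)
  case 0
  then show ?case by (simp add: hl_sum_def pairs_def)
next
  case (Suc N)
  let ?t = "\<lambda>b. Transposition.transpose N b"
  let ?C = "\<lambda>b. \<Prod>l\<in>{..<Suc N} - {b}. (x l - q * x b) / (x l - x b)"
  \<comment> \<open>A permutation of N + 1 points is determined by its value b at N and a
    permutation of the first N points.\<close>
  have perms: "{w. w permutes {..<Suc N}} = (\<lambda>(b, p). ?t b \<circ> p) ` ({..<Suc N} \<times> {p. p permutes {..<N}})"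
  proof -
    have "{(b, p). b \<in> insert N {..<N} \<and> p \<in> {p. p permutes {..<N}}} = insert N {..<N} \<times> {p. p permutes {..<N}}"
      by auto
    then show ?thesis unfolding lessThan_Suc permutes_insert by (simp only:)
  qed
  have inj: "inj_on (\<lambda>(b, p). ?t b \<circ> p) ({..<Suc N} \<times> {p. p permutes {..<N}})"
  proof (rule inj_onI, clarify)
    fix b p b' p' assume p: "p permutes {..<N}" "p' permutes {..<N}" and eq: "?t b \<circ> p = ?t b' \<circ> p'"
    have "p N = N" "p' N = N" using p by (simp_all add: permutes_not_in)
    then have b: "b = b'" using fun_cong[OF eq, of N] by simp
    have "?t b \<circ> (?t b \<circ> p) = ?t b \<circ> (?t b \<circ> p')" using eq b by simp
    then show "b = b' \<and> p = p'" using b by (simp add: fun_eq_iff)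
  qed
  have "hl_sum x q (Suc N) (\<lambda>_. 0) = (\<Sum>w | w permutes {..<Suc N}. prod (hl_factor x q w) (pairs (Suc N)))"
    by (simp add: hl_sum_def)
  also have "\<dots> = (\<Sum>(b, p)\<in>{..<Suc N} \<times> {p. p permutes {..<N}}. prod (hl_factor x q (?t b \<circ> p)) (pairs (Suc N)))"
    unfolding perms by (subst sum.reindex[OF inj]) (simp add: case_prod_unfold)
  also have "\<dots> = (\<Sum>b<Suc N. \<Sum>p | p permutes {..<N}. prod (hl_factor x q (?t b \<circ> p)) (pairs (Suc N)))"
    by (rule sum.cartesian_product[symmetric])
  also have "\<dots> = (\<Sum>b<Suc N. ?C b * hl_sum (x \<circ> ?t b) q N (\<lambda>_. 0))"
  proof (rule sum.cong[OF refl])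
    fix b assume b: "b \<in> {..<Suc N}"
    have "prod (hl_factor x q (?t b \<circ> p)) (pairs (Suc N)) = ?C b * prod (hl_factor (x \<circ> ?t b) q p) (pairs N)"
      if p: "p permutes {..<N}" for p
    proof -
      have pN: "p N = N" using p by (simp add: permutes_not_in)
      have "prod (hl_factor x q (?t b \<circ> p)) (pairs (Suc N)) =
          prod (hl_factor x q (?t b \<circ> p)) (pairs N) * prod (hl_factor x q (?t b \<circ> p)) ({N} \<times> {..<N})"
        unfolding pairs_Suc by (rule prod.union_disjoint) (auto simp: pairs_def)
      also have "prod (hl_factor x q (?t b \<circ> p)) (pairs N) = prod (hl_factor (x \<circ> ?t b) q p) (pairs N)"
        by (simp add: hl_factor_def)
      also have "prod (hl_factor x q (?t b \<circ> p)) ({N} \<times> {..<N}) = ?C b"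
      \<comment> \<open>The values of the permutation below N run through all points other than
        b.\<close>
      proof (rule prod.reindex_bij_witness[of _ "\<lambda>l. (N, inv p (?t b l))" "\<lambda>(j, i). ?t b (p i)"])
        fix a assume "a \<in> {N} \<times> {..<N}"
        then obtain i where a: "a = (N, i)" "i < N" by auto
        have pi: "p i < N" using permutes_in_image[OF p, of i] a(2) by simp
        show "(N, inv p (?t b (case a of (j, i) \<Rightarrow> ?t b (p i)))) = a"
          by (simp add: a permutes_inverses[OF p])
        show "(case a of (j, i) \<Rightarrow> ?t b (p i)) \<in> {..<Suc N} - {b}"
          using a pi b by (auto simp: Transposition.transpose_def)
        show "(x (case a of (j, i) \<Rightarrow> ?t b (p i)) - q * x b) / (x (case a of (j, i) \<Rightarrow> ?t b (p i)) - x b) =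
            hl_factor x q (?t b \<circ> p) a"
          by (simp add: a hl_factor_def pN)
      next
        fix l assume l: "l \<in> {..<Suc N} - {b}"
        have "?t b l < N" using l b by (auto simp: Transposition.transpose_def)
        then have "inv p (?t b l) < N" using permutes_in_image[OF permutes_inv[OF p], of "?t b l"] by simp
        then show "(N, inv p (?t b l)) \<in> {N} \<times> {..<N}" by simp
        show "(case (N, inv p (?t b l)) of (j, i) \<Rightarrow> ?t b (p i)) = l" by (simp add: permutes_inverses[OF p])
      qed
      finally show ?thesis by (simp only: mult.commute)
    qed
    then show "(\<Sum>p | p permutes {..<N}. prod (hl_factor x q (?t b \<circ> p)) (pairs (Suc N))) =
        ?C b * hl_sum (x \<circ> ?t b) q N (\<lambda>_. 0)"
      by (simp add: hl_sum_def sum_distrib_left)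
  qed
  also have "\<dots> = (\<Sum>b<Suc N. ?C b * qfact q N)"
  proof (rule sum.cong[OF refl])
    fix b assume b: "b \<in> {..<Suc N}"
    have img: "?t b l < Suc N" if "l < N" for l using that b by (auto simp: Transposition.transpose_def)
    have "inj_on (x \<circ> ?t b) {..<N}"
      by (rule comp_inj_on) (use img in \<open>auto intro!: inj_on_subset[OF Suc.prems(1)] intro: inj_on_subset[OF inj_transpose]\<close>)
    then have "hl_sum (x \<circ> ?t b) q N (\<lambda>_. 0) = qfact q N"
      using Suc.prems(2,3) img by (intro Suc.IH) (auto simp: comp_def)
    then show "?C b * hl_sum (x \<circ> ?t b) q N (\<lambda>_. 0) = ?C b * qfact q N" by simp
  qed
  also have "\<dots> = (\<Sum>j<Suc N. q ^ j) * qfact q N"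
    unfolding sum_distrib_right[symmetric]
    using sum_prod_ratios[of "{..<Suc N}" x q] Suc.prems by simp
  also have "\<dots> = qfact q (Suc N)" by (simp add: qfact_Suc lessThan_Suc_atMost mult.commute del: sum.lessThan_Suc)
  finally show ?case .
qed

text \<open>The parts recovered from the columns: the part with index i is the number of columns
  longer than i.\<close>

fun column_exponent :: "nat list \<Rightarrow> nat \<Rightarrow> nat" where
  "column_exponent [] i = 0"
| "column_exponent (k # ks) i = (if i < k then 1 else 0) + column_exponent ks i"

lemma column_exponent_eq_0: "(\<And>k. k \<in> set ks \<Longrightarrow> k \<le> i) \<Longrightarrow> column_exponent ks i = 0"
  by (induction ks) (auto simp: not_less)

lemma strips_le: "\<nu> \<in> strips M ks r \<Longrightarrow> k \<in> set \<nu> \<Longrightarrow> sorted_wrt (\<ge>) ks \<Longrightarrow> (case ks of [] \<Rightarrow> True | k # _ \<Rightarrow> k \<le> M) \<Longrightarrow> k \<le> M"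
proof (induction M ks r arbitrary: \<nu> rule: strips.induct)
  case (2 M l ks r)
  then obtain b \<nu>' where b: "b \<in> {l..min M (l + r)}" "\<nu> = b # \<nu>'" "\<nu>' \<in> strips l ks (r - (b - l))" by auto
  have "k \<le> l" if "k \<in> set \<nu>'"
    by (rule "2.IH"[OF b(1) b(3) that]) (use "2.prems"(3) in \<open>auto split: list.splits\<close>)
  then show ?case using "2.prems"(2,4) b by fastforce
qed (auto split: if_splits)

text \<open>The Pieri coefficients of the unnormalized sums. They depend on the number
  \<open>M\<close> of variables; \<open>pieri_weight_hl_norm\<close> relates them to
  \<open>strip_weight\<close>.\<close>

fun pieri_weight :: "'a::comm_semiring_1 \<Rightarrow> nat \<Rightarrow> nat list \<Rightarrow> nat list \<Rightarrow> 'a" where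
  "pieri_weight q M [] \<nu> = qbinomial q M (hd \<nu>)"
| "pieri_weight q M (k # ks) \<nu> = qbinomial q (M - k) (hd \<nu> - k) * pieri_weight q k ks (tl \<nu>)"

context hl_variables
begin

text \<open>The columns cut the first \<open>M\<close> variables into blocks of equal exponent. The
  block from k to \<open>M\<close> is treated by \<open>hl_sum_block\<close>; below k all exponents
  contain one more unit, recorded by c, while \<gamma> keeps the changed exponents above. This
  freedom in c and \<gamma> carries the induction.\<close>

lemma sum_hl_sum_bump:
  assumes "M \<le> N" "\<And>i. i < M \<Longrightarrow> \<gamma> i = c + column_exponent ks i"
    and "sorted_wrt (\<ge>) ks" "case ks of [] \<Rightarrow> True | k # _ \<Rightarrow> k \<le> M"
  shows "(\<Sum>S | S \<subseteq> {..<M} \<and> card S = r. R (bump \<gamma> S)) =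
    (\<Sum>\<nu>\<in>strips M ks r. pieri_weight q M ks \<nu> * R (\<lambda>i. if i < M then c + column_exponent \<nu> i else \<gamma> i))"
  using assms
proof (induction ks arbitrary: M \<gamma> c r)
  case Nil
  have "(\<Sum>S | S \<subseteq> {..<M} \<and> card S = r. R (bump \<gamma> S)) = qbinomial q M r * R (bump \<gamma> {0..<0 + r})"
    using hl_sum_block[of 0 M \<gamma> r] Nil by (simp add: atLeast0LessThan)
  moreover have "bump \<gamma> {0..<0 + r} = (\<lambda>i. if i < M then c + column_exponent [r] i else \<gamma> i)" if "r \<le> M"
    using Nil.prems(2) that by (auto simp: bump_def fun_eq_iff)
  ultimately show ?case by (auto simp: qbinomial_eq_0)
next
  case (Cons k ks)
  have k: "k \<le> M" using Cons.prems(4) by simp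
  have sorted: "sorted_wrt (\<ge>) ks" "\<And>l. l \<in> set ks \<Longrightarrow> l \<le> k" using Cons.prems(3) by auto
  have dom: "{..<M} = {..<k} \<union> {k..<k + (M - k)}" using k by auto
  let ?g = "\<lambda>b \<nu>. R (\<lambda>i. if i < M then c + column_exponent (b # \<nu>) i else \<gamma> i)"
  have "(\<Sum>S | S \<subseteq> {..<M} \<and> card S = r. R (bump \<gamma> S)) =
      (\<Sum>j\<le>min (M - k) r. \<Sum>T | T \<subseteq> {k..<k + (M - k)} \<and> card T = j. \<Sum>U | U \<subseteq> {..<k} \<and> card U = r - j. R (bump \<gamma> (U \<union> T)))"
    unfolding dom by (subst sum_subsets_Un) auto
  also have "\<dots> = (\<Sum>j\<le>min (M - k) r. qbinomial q (M - k) j *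
      (\<Sum>\<nu>\<in>strips k ks (r - j). pieri_weight q k ks \<nu> * ?g (k + j) \<nu>))"
  proof (rule sum.cong[OF refl])
    fix j assume j: "j \<in> {..min (M - k) r}"
    have "(\<Sum>T | T \<subseteq> {k..<k + (M - k)} \<and> card T = j. \<Sum>U | U \<subseteq> {..<k} \<and> card U = r - j. R (bump \<gamma> (U \<union> T))) =
        (\<Sum>U | U \<subseteq> {..<k} \<and> card U = r - j. \<Sum>T | T \<subseteq> {k..<k + (M - k)} \<and> card T = j. R (bump \<gamma> (U \<union> T)))"
      by (rule sum.swap)
    also have "\<dots> = (\<Sum>U | U \<subseteq> {..<k} \<and> card U = r - j. qbinomial q (M - k) j * R (bump (bump \<gamma> {k..<k + j}) U))"
    proof (rule sum.cong[OF refl])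
      fix U assume U: "U \<in> {U. U \<subseteq> {..<k} \<and> card U = r - j}"
      have "(\<Sum>T | T \<subseteq> {k..<k + (M - k)} \<and> card T = j. R (bump \<gamma> (U \<union> T))) =
          (\<Sum>T | T \<subseteq> {k..<k + (M - k)} \<and> card T = j. R (bump (bump \<gamma> U) T))"
      proof (rule sum.cong[OF refl])
        fix T assume "T \<in> {T. T \<subseteq> {k..<k + (M - k)} \<and> card T = j}"
        then have "U \<inter> T \<subseteq> {..<k} \<inter> {k..<k + (M - k)}" using U by blast
        also have "\<dots> = {}" by auto
        finally show "R (bump \<gamma> (U \<union> T)) = R (bump (bump \<gamma> U) T)" by (simp add: bump_bump)
      qed
      also have "\<dots> = qbinomial q (M - k) j * R (bump (bump \<gamma> U) {k..<k + j})"
      proof (rule hl_sum_block)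
        fix i assume i: "i < M - k"
        have "column_exponent (k # ks) (k + i) = 0" "column_exponent (k # ks) k = 0"
          using sorted(2) by (auto intro!: column_exponent_eq_0 intro: trans_le_add1)
        then show "bump \<gamma> U (k + i) = bump \<gamma> U k"
          using Cons.prems(2)[of "k + i"] Cons.prems(2)[of k] i U by (auto simp: bump_def)
      qed (use Cons.prems(1) k in simp)
      also have "bump (bump \<gamma> U) {k..<k + j} = bump (bump \<gamma> {k..<k + j}) U"
        by (simp add: bump_def fun_eq_iff)
      finally show "(\<Sum>T | T \<subseteq> {k..<k + (M - k)} \<and> card T = j. R (bump \<gamma> (U \<union> T))) =
          qbinomial q (M - k) j * R (bump (bump \<gamma> {k..<k + j}) U)" .
    qed
    also have "\<dots> = qbinomial q (M - k) j * (\<Sum>U | U \<subseteq> {..<k} \<and> card U = r - j. R (bump (bump \<gamma> {k..<k + j}) U))"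
      by (rule sum_distrib_left[symmetric])
    also have "(\<Sum>U | U \<subseteq> {..<k} \<and> card U = r - j. R (bump (bump \<gamma> {k..<k + j}) U)) =
      (\<Sum>\<nu>\<in>strips k ks (r - j). pieri_weight q k ks \<nu> *
        R (\<lambda>i. if i < k then Suc c + column_exponent \<nu> i else bump \<gamma> {k..<k + j} i))"
      by (rule Cons.IH) (use k Cons.prems(1,2) sorted in \<open>auto simp: bump_def split: list.splits\<close>)
    also have "\<dots> = (\<Sum>\<nu>\<in>strips k ks (r - j). pieri_weight q k ks \<nu> * ?g (k + j) \<nu>)"
    proof (rule sum.cong[OF refl])
      fix \<nu> assume \<nu>: "\<nu> \<in> strips k ks (r - j)"
      have le: "l \<le> k" if "l \<in> set \<nu>" for l
        by (rule strips_le[OF \<nu> that sorted(1)]) (use sorted(2) in \<open>auto split: list.splits\<close>)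
      have "(\<lambda>i. if i < k then Suc c + column_exponent \<nu> i else bump \<gamma> {k..<k + j} i) =
          (\<lambda>i. if i < M then c + column_exponent ((k + j) # \<nu>) i else \<gamma> i)"
      proof
        fix i
        have "column_exponent \<nu> i = 0" "column_exponent (k # ks) i = 0" if "k \<le> i"
          using le sorted(2) that by (auto intro!: column_exponent_eq_0 intro: order_trans)
        then show "(if i < k then Suc c + column_exponent \<nu> i else bump \<gamma> {k..<k + j} i) =
            (if i < M then c + column_exponent ((k + j) # \<nu>) i else \<gamma> i)"
          using Cons.prems(2)[of i] j k by (auto simp: bump_def)
      qed
      then show "pieri_weight q k ks \<nu> * R (\<lambda>i. if i < k then Suc c + column_exponent \<nu> i else bump \<gamma> {k..<k + j} i) =
          pieri_weight q k ks \<nu> * ?g (k + j) \<nu>" by (simp only:)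
    qed
    finally show "(\<Sum>T | T \<subseteq> {k..<k + (M - k)} \<and> card T = j. \<Sum>U | U \<subseteq> {..<k} \<and> card U = r - j. R (bump \<gamma> (U \<union> T))) =
        qbinomial q (M - k) j * (\<Sum>\<nu>\<in>strips k ks (r - j). pieri_weight q k ks \<nu> * ?g (k + j) \<nu>)" .
  qed
  also have "\<dots> = (\<Sum>b=k..min M (k + r). qbinomial q (M - k) (b - k) *
      (\<Sum>\<nu>\<in>strips k ks (r - (b - k)). pieri_weight q k ks \<nu> * ?g b \<nu>))"
    by (rule sum.reindex_bij_witness[of _ "\<lambda>b. b - k" "\<lambda>j. k + j"]) (use k in auto)
  also have "\<dots> = (\<Sum>\<nu>\<in>strips M (k # ks) r. pieri_weight q M (k # ks) \<nu> *
      R (\<lambda>i. if i < M then c + column_exponent \<nu> i else \<gamma> i))"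
    unfolding sum_strips_Cons by (simp add: sum_distrib_left mult.assoc)
  finally show ?case .
qed

end

section \<open>Truncation to finitely many variables\<close>

text \<open>The leading coefficient of the sum over permutations: \<open>qfact\<close> of the
  multiplicity of every part, including the part 0 among \<open>M\<close> variables.\<close>

fun hl_norm :: "'a::comm_semiring_1 \<Rightarrow> nat \<Rightarrow> nat list \<Rightarrow> 'a" where
  "hl_norm q M [] = qfact q M"
| "hl_norm q M (k # ks) = qfact q (M - k) * hl_norm q k ks"

lemma hl_norm_pos: "0 < q \<Longrightarrow> 0 < hl_norm (q::rat) M ks"
  by (induction q M ks rule: hl_norm.induct) (auto intro: qfact_pos mult_pos_pos)

definition top_column :: "nat list \<Rightarrow> nat"
  where "top_column ks = (case ks of [] \<Rightarrow> 0 | k # _ \<Rightarrow> k)"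

lemma top_column_simps [simp]: "top_column [] = 0" "top_column (k # ks) = k"
  by (simp_all add: top_column_def)

lemma sorted_Cons_iff: "sorted_wrt (\<ge>) (k # ks) \<longleftrightarrow> top_column ks \<le> k \<and> sorted_wrt (\<ge>) (ks :: nat list)"
  by (cases ks) auto

lemma hd_strips_le: "\<nu> \<in> strips M ks r \<Longrightarrow> hd \<nu> \<le> M"
  by (cases ks) (auto split: if_splits)

lemma hd_strips_ge: "\<nu> \<in> strips M ks r \<Longrightarrow> top_column ks \<le> hd \<nu>"
  by (cases ks) auto

lemma strips_ConsE:
  assumes "\<nu> \<in> strips M (k # ks) r"
  obtains b \<nu>' where "\<nu> = b # \<nu>'" "k \<le> b" "b \<le> M" "b \<le> k + r" "\<nu>' \<in> strips k ks (r - (b - k))"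
  using assms by auto

lemma strips_not_Nil: "\<nu> \<in> strips M ks r \<Longrightarrow> \<nu> \<noteq> []"
  by (cases ks) (auto split: if_splits)

text \<open>Normalization replaces the coefficients depending on \<open>M\<close> by those of
  \<open>strip_weight\<close>, which do not. This makes a Pieri rule for symmetric functions
  possible. In each column the comparison is one of q-factorials.\<close>

lemma pieri_weight_hl_norm:
  "\<nu> \<in> strips M ks r \<Longrightarrow> pieri_weight q M ks \<nu> * hl_norm q M \<nu> = strip_weight q ks \<nu> * hl_norm q M ks"
proof (induction ks arbitrary: M \<nu> r)
  case Nil
  then show ?case using qbinomial_qfact[of r M q] by (auto simp: mult.commute split: if_splits)
next
  case (Cons k ks)
  obtain b \<nu>' where \<nu>: "\<nu> = b # \<nu>'" "k \<le> b" "b \<le> M" "\<nu>' \<in> strips k ks (r - (b - k))"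
    using Cons.prems by (elim strips_ConsE)
  obtain b' \<nu>'' where \<nu>': "\<nu>' = b' # \<nu>''" using strips_not_Nil[OF \<nu>(4)] by (cases \<nu>') auto
  have b': "b' \<le> k" using hd_strips_le[OF \<nu>(4)] \<nu>' by simp
  let ?X = "hl_norm q b' \<nu>''" and ?H = "hl_norm q k ks" and ?P = "pieri_weight q k ks \<nu>'" and ?S = "strip_weight q ks \<nu>'"
  have IH: "?P * (qfact q (k - b') * ?X) = ?S * ?H" using Cons.IH[OF \<nu>(4)] \<nu>' by simp
  have q1: "qbinomial q (M - k) (b - k) * (qfact q (b - k) * qfact q (M - b)) = qfact q (M - k)"
    using qbinomial_qfact[of "b - k" "M - k" q] \<nu>(2,3) by simp
  have q2: "qbinomial q (b - b') (b - k) * (qfact q (b - k) * qfact q (k - b')) = qfact q (b - b')"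
    using qbinomial_qfact[of "b - k" "b - b'" q] \<nu>(2) b' by simp
  have "pieri_weight q M (k # ks) \<nu> * hl_norm q M \<nu> =
      qbinomial q (M - k) (b - k) * ?P * (qfact q (M - b) * (qfact q (b - b') * ?X))"
    by (simp add: \<nu>(1) \<nu>')
  also have "\<dots> = qbinomial q (b - b') (b - k) * (qbinomial q (M - k) (b - k) * (qfact q (b - k) * qfact q (M - b))) *
      (?P * (qfact q (k - b') * ?X))"
    unfolding q2[symmetric] by (simp only: mult_ac)
  also have "\<dots> = strip_weight q (k # ks) \<nu> * hl_norm q M (k # ks)"
    unfolding q1 IH by (simp add: \<nu>(1) \<nu>' mult_ac)
  finally show ?case .
qed

text \<open>From \<open>top_column ks + r\<close> on the bound \<open>M\<close> excludes nothing, so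
  one common set contains the strips for every number of variables.\<close>

lemma strips_filter:
  "top_column ks + r \<le> M \<Longrightarrow> strips N ks r = {\<nu> \<in> strips M ks r. hd \<nu> \<le> N}"
  by (cases ks) (auto split: if_splits)

lemma sum_list_strips: "\<nu> \<in> strips M ks r \<Longrightarrow> sum_list \<nu> = sum_list ks + r"
proof (induction ks arbitrary: M \<nu> r)
  case Nil
  then show ?case by (auto split: if_splits)
next
  case (Cons k ks)
  from Cons.prems show ?case
    by (elim strips_ConsE) (simp add: Cons.IH)
qed

lemma sorted_strips: "\<nu> \<in> strips M ks r \<Longrightarrow> sorted_wrt (\<ge>) ks \<Longrightarrow> sorted_wrt (\<ge>) \<nu>"
proof (induction ks arbitrary: M \<nu> r)
  case Nil
  then show ?case by (auto split: if_splits)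
next
  case (Cons k ks)
  obtain b \<nu>' where \<nu>: "\<nu> = b # \<nu>'" "k \<le> b" "\<nu>' \<in> strips k ks (r - (b - k))"
    using Cons.prems(1) by (elim strips_ConsE)
  have "top_column \<nu>' \<le> k" using hd_strips_le[OF \<nu>(3)] strips_not_Nil[OF \<nu>(3)] by (cases \<nu>') auto
  then show ?case using Cons.IH[OF \<nu>(3)] Cons.prems(2) \<nu>(2) unfolding \<nu>(1) sorted_Cons_iff by simp
qed

lemma strips_interlace: "\<nu> \<in> strips M ks r \<Longrightarrow> list_all2 (\<le>) (tl \<nu>) ks"
proof (induction ks arbitrary: M \<nu> r)
  case Nil
  then show ?case by (auto split: if_splits)
next
  case (Cons k ks)
  obtain b \<nu>' where \<nu>: "\<nu> = b # \<nu>'" "\<nu>' \<in> strips k ks (r - (b - k))"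
    using Cons.prems(1) by (elim strips_ConsE)
  show ?case
    using Cons.IH[OF \<nu>(2)] hd_strips_le[OF \<nu>(2)] strips_not_Nil[OF \<nu>(2)] \<nu>(1) by (cases \<nu>') auto
qed

lemma list_all2_le_sum_list:
  "list_all2 (\<le>) xs ys \<Longrightarrow> sum_list xs \<le> sum_list ys \<and> (sum_list xs = sum_list ys \<longrightarrow> xs = (ys :: nat list))"
  by (induction xs ys rule: list_all2_induct) auto

text \<open>The columns after the first are entrywise at most \<open>ks\<close>, so the first has
  length at least r, and exactly r only if the others equal \<open>ks\<close>.\<close>

lemma strips_hd_less:
  assumes "\<nu> \<in> strips M ks r" "\<nu> \<noteq> r # ks"
  shows "r < hd \<nu>"
proof -
  have \<nu>: "\<nu> = hd \<nu> # tl \<nu>" using strips_not_Nil[OF assms(1)] by simp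
  have "hd \<nu> + sum_list (tl \<nu>) = sum_list ks + r"
    using sum_list_strips[OF assms(1)] by (subst (asm) \<nu>) simp
  moreover have "hd \<nu> = r \<Longrightarrow> tl \<nu> \<noteq> ks" using assms(2) \<nu> by metis
  ultimately show ?thesis using list_all2_le_sum_list[OF strips_interlace[OF assms(1)]] by linarith
qed

lemma Cons_in_strips:
  "sorted_wrt (\<ge>) (b # ks) \<Longrightarrow> b \<le> M \<Longrightarrow> b # ks \<in> strips M ks b"
  by (induction ks arbitrary: b M) (auto simp: image_iff)

lemma strip_weight_Cons [simp]: "strip_weight q ks (b # ks) = 1"
  by (induction ks arbitrary: b) auto

section \<open>Constants and variables in the field of rational functions\<close>

lemma const_simps [simp]:
  "const 0 = 0" "const 1 = 1" "const (a + b) = const a + const b" "const (a - b) = const a - const b"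
  by (simp_all add: const_def single_add single_diff)

lemma const_mult [simp]: "const (a * b) = const a * const b"
  unfolding const_def to_fract_mult[symmetric] mult_single by simp

lemma const_eq_iff [simp]: "const a = const b \<longleftrightarrow> a = b"
  unfolding const_def to_fract_eq_iff by (metis lookup_single_eq)

lemma const_eq_0_iff [simp]: "const a = 0 \<longleftrightarrow> a = 0"
  by (metis const_simps(1) const_eq_iff)

lemma const_sum: "const (sum f A) = (\<Sum>a\<in>A. const (f a))"
  by (induction A rule: infinite_finite_induct) simp_all

lemma const_prod: "const (prod f A) = (\<Prod>a\<in>A. const (f a))"
  by (induction A rule: infinite_finite_induct) simp_all

lemma const_power: "const (a ^ n) = const a ^ n"
  by (induction n) simp_all

lemma const_qfact: "qfact (const q) n = const (qfact q n)"
  by (simp add: qfact_def const_sum const_prod const_power)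

lemma const_qbinomial: "qbinomial (const q) n k = const (qbinomial q n k)"
  by (induction q n k rule: qbinomial.induct) (simp_all add: const_power)

lemma const_pieri_weight: "pieri_weight (const q) M ks \<nu> = const (pieri_weight q M ks \<nu>)"
  by (induction q M ks \<nu> rule: pieri_weight.induct) (simp_all add: const_qbinomial)

lemma two_mpoly_fract: "(2 :: mpoly fract) \<noteq> 0"
proof -
  have 2: "(2 :: mpoly fract) = const 2" using const_simps(3)[of 1 1] by simp
  show ?thesis unfolding 2 by simp
qed

lemma inj_var: "inj_on var A"
proof (rule inj_onI)
  fix i j assume "var i = var j"
  then have "Poly_Mapping.lookup (Poly_Mapping.single (Poly_Mapping.single i (1::nat)) (1::rat)) (Poly_Mapping.single j 1) = 1"
    by (simp add: var_def)
  then have "Poly_Mapping.single i (1::nat) = Poly_Mapping.single j 1" by (simp add: lookup_single when_def split: if_splits)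
  then have "Poly_Mapping.lookup (Poly_Mapping.single i (1::nat)) j = 1" by simp
  then show "i = j" by (simp add: lookup_single when_def split: if_splits)
qed

lemma var_neq_0: "var i \<noteq> 0"
  by (simp add: var_def) (metis lookup_single_eq lookup_zero zero_neq_one)

lemma hl_variables_var: "hl_variables var N"
  by unfold_locales (rule inj_var, rule two_mpoly_fract)

lemma xpow_map_lookup: "Poly_Mapping.keys \<gamma> \<subseteq> {..<N} \<Longrightarrow> xpow (map (Poly_Mapping.lookup \<gamma>) [0..<N]) = \<gamma>"
  by (rule poly_mapping_eqI) (auto simp: nth_default_def in_keys_iff subset_iff)

section \<open>Setting all but finitely many variables to zero\<close>

definition trunc :: "nat \<Rightarrow> symfun \<Rightarrow> mpoly"
  where "trunc N f = Abs_poly_mapping (\<lambda>\<gamma>. if Poly_Mapping.keys \<gamma> \<subseteq> {..<N} then scoeff f \<gamma> else 0)"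

text \<open>Bounded degree leaves finitely many monomials in \<open>N\<close> variables, so the
  function passed to \<open>Abs_poly_mapping\<close> has finite support.\<close>

lemma lookup_trunc:
  "Poly_Mapping.lookup (trunc N f) \<gamma> = (if Poly_Mapping.keys \<gamma> \<subseteq> {..<N} then scoeff f \<gamma> else 0)"
proof -
  obtain d where d: "\<forall>\<gamma>. scoeff f \<gamma> \<noteq> 0 \<longrightarrow> total_degree \<gamma> \<le> d" using scoeff_bounded[of f] by blast
  have "{\<gamma>. (if Poly_Mapping.keys \<gamma> \<subseteq> {..<N} then scoeff f \<gamma> else 0) \<noteq> 0} \<subseteq>
      xpow ` {xs. set xs \<subseteq> {..d} \<and> length xs = N}"
  proof
    fix \<gamma> assume "\<gamma> \<in> {\<gamma>. (if Poly_Mapping.keys \<gamma> \<subseteq> {..<N} then scoeff f \<gamma> else 0) \<noteq> 0}"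
    then have \<gamma>: "Poly_Mapping.keys \<gamma> \<subseteq> {..<N}" "total_degree \<gamma> \<le> d" using d by (auto split: if_splits)
    have "Poly_Mapping.lookup \<gamma> i \<le> d" if "i < N" for i
      using \<gamma>(2) member_le_sum[of i "{..<N}" "Poly_Mapping.lookup \<gamma>"] that
      by (simp add: total_degree_superset[OF _ \<gamma>(1)])
    then show "\<gamma> \<in> xpow ` {xs. set xs \<subseteq> {..d} \<and> length xs = N}"
      by (intro image_eqI[of _ _ "map (Poly_Mapping.lookup \<gamma>) [0..<N]"]) (auto simp: xpow_map_lookup[OF \<gamma>(1)])
  qed
  then have "finite {\<gamma>. (if Poly_Mapping.keys \<gamma> \<subseteq> {..<N} then scoeff f \<gamma> else 0) \<noteq> 0}"
    by (rule finite_subset) (intro finite_imageI finite_lists_length_eq, simp)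
  then show ?thesis unfolding trunc_def by (simp add: Abs_poly_mapping_inverse)
qed

lemma symfun_eq_truncI:
  assumes "\<And>N. trunc N f = trunc N g"
  shows "f = g"
proof (rule symfun_eqI)
  fix \<gamma> :: "nat \<Rightarrow>\<^sub>0 nat"
  obtain N where "Poly_Mapping.keys \<gamma> \<subseteq> {..<N}" using finite_nat_iff_bounded[of "Poly_Mapping.keys \<gamma>"] by auto
  then show "scoeff f \<gamma> = scoeff g \<gamma>" using arg_cong[OF assms[of N], of "\<lambda>p. Poly_Mapping.lookup p \<gamma>"]
    by (simp add: lookup_trunc)
qed

lemma lookup_single_mult:
  "Poly_Mapping.lookup (Poly_Mapping.single m c * p) \<gamma> =
    (if \<exists>k. \<gamma> = m + k then c * Poly_Mapping.lookup p (\<gamma> - m) else (0::rat))" for m \<gamma> :: "nat \<Rightarrow>\<^sub>0 nat"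
proof -
  have "p = (\<Sum>k\<in>Poly_Mapping.keys p. Poly_Mapping.single k (Poly_Mapping.lookup p k))"
    by (rule poly_mapping_eqI) (simp add: lookup_sum lookup_single when_def in_keys_iff)
  then have "Poly_Mapping.single m c * p =
      Poly_Mapping.single m c * (\<Sum>k\<in>Poly_Mapping.keys p. Poly_Mapping.single k (Poly_Mapping.lookup p k))"
    by (rule arg_cong)
  also have "\<dots> = (\<Sum>k\<in>Poly_Mapping.keys p. Poly_Mapping.single (m + k) (c * Poly_Mapping.lookup p k))"
    by (simp add: sum_distrib_left mult_single)
  finally have "Poly_Mapping.single m c * p = (\<Sum>k\<in>Poly_Mapping.keys p. Poly_Mapping.single (m + k) (c * Poly_Mapping.lookup p k))" .
  then have *: "Poly_Mapping.lookup (Poly_Mapping.single m c * p) \<gamma> =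
      (\<Sum>k\<in>Poly_Mapping.keys p. if m + k = \<gamma> then c * Poly_Mapping.lookup p k else 0)"
    by (simp add: lookup_sum lookup_single when_def)
  show ?thesis
  proof (cases "\<exists>k. \<gamma> = m + k")
    case True
    then obtain k where k: "\<gamma> = m + k" by blast
    show ?thesis using * unfolding k by (auto simp: in_keys_iff)
  next
    case False
    then show ?thesis unfolding * by (auto intro!: sum.neutral)
  qed
qed

lemma trunc_zero [simp]: "trunc N 0 = 0"
  and trunc_add: "trunc N (f + g) = trunc N f + trunc N g"
  and trunc_diff: "trunc N (f - g) = trunc N f - trunc N g"
  by (auto intro!: poly_mapping_eqI simp: lookup_trunc lookup_add lookup_minus)

lemma trunc_sum: "trunc N (sum f A) = (\<Sum>a\<in>A. trunc N (f a))"
  by (induction A rule: infinite_finite_induct) (simp_all add: trunc_add)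

lemma trunc_one: "trunc N 1 = 1"
  by (rule poly_mapping_eqI) (auto simp: lookup_trunc scoeff_one lookup_one)

lemma trunc_sscale: "to_fract (trunc N (sscale c f)) = const c * to_fract (trunc N f)"
  unfolding const_def to_fract_mult[symmetric] to_fract_eq_iff
  by (rule poly_mapping_eqI) (simp add: lookup_single_mult lookup_trunc)

lemma trunc_elementary_mult:
  "trunc N (elementary r * f) =
    (\<Sum>S | S \<subseteq> {..<N} \<and> card S = r. Poly_Mapping.single (ind_mon S) 1) * trunc N f"
proof (rule poly_mapping_eqI)
  fix \<gamma>
  have "Poly_Mapping.lookup ((\<Sum>S | S \<subseteq> {..<N} \<and> card S = r. Poly_Mapping.single (ind_mon S) 1) * trunc N f) \<gamma> =
     (\<Sum>S | S \<subseteq> {..<N} \<and> card S = r. if \<exists>k. \<gamma> = ind_mon S + k then Poly_Mapping.lookup (trunc N f) (\<gamma> - ind_mon S) else 0)"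
    by (simp add: sum_distrib_right lookup_sum lookup_single_mult cong: if_cong)
  also have "\<dots> = (if Poly_Mapping.keys \<gamma> \<subseteq> {..<N} then scoeff (elementary r * f) \<gamma> else 0)"
  proof (cases "Poly_Mapping.keys \<gamma> \<subseteq> {..<N}")
    case True
    have iff: "(\<exists>k. \<gamma> = ind_mon S + k) \<longleftrightarrow> S \<subseteq> Poly_Mapping.keys \<gamma>" if "finite S" for S
    proof
      assume "S \<subseteq> Poly_Mapping.keys \<gamma>"
      then have "\<gamma> = ind_mon S + (\<gamma> - ind_mon S)" by (rule ind_mon_add_diff[symmetric])
      then show "\<exists>k. \<gamma> = ind_mon S + k" by blast
    qed (auto simp: in_keys_iff lookup_add lookup_ind_mon[OF that])
    have keys: "Poly_Mapping.keys (\<gamma> - ind_mon S) \<subseteq> {..<N}" for S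
      using True by (auto simp: in_keys_iff lookup_minus subset_iff)
    have fin: "finite S" if "S \<in> {S. S \<subseteq> {..<N} \<and> card S = r}" for S
      using that by (auto dest: finite_subset)
    have "(\<Sum>S | S \<subseteq> {..<N} \<and> card S = r. if \<exists>k. \<gamma> = ind_mon S + k then Poly_Mapping.lookup (trunc N f) (\<gamma> - ind_mon S) else 0) =
      (\<Sum>S | S \<subseteq> Poly_Mapping.keys \<gamma> \<and> card S = r. scoeff f (\<gamma> - ind_mon S))"
    proof (rule sum.mono_neutral_cong_right)
      show "finite {S. S \<subseteq> {..<N} \<and> card S = r}" by (rule finite_subset[of _ "Pow {..<N}"]) auto
      show "\<forall>S\<in>{S. S \<subseteq> {..<N} \<and> card S = r} - {S. S \<subseteq> Poly_Mapping.keys \<gamma> \<and> card S = r}.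
          (if \<exists>k. \<gamma> = ind_mon S + k then Poly_Mapping.lookup (trunc N f) (\<gamma> - ind_mon S) else 0) = 0"
        using iff[OF fin] by auto
      fix S assume "S \<in> {S. S \<subseteq> Poly_Mapping.keys \<gamma> \<and> card S = r}"
      then have "S \<subseteq> Poly_Mapping.keys \<gamma>" "finite S" by (auto dest: finite_subset)
      then show "(if \<exists>k. \<gamma> = ind_mon S + k then Poly_Mapping.lookup (trunc N f) (\<gamma> - ind_mon S) else 0) =
          scoeff f (\<gamma> - ind_mon S)"
        using iff[of S] keys by (simp add: lookup_trunc)
    qed (use True in auto)
    then show ?thesis using True by (simp add: scoeff_elementary_mult)
  next
    case False
    have "(\<Sum>S | S \<subseteq> {..<N} \<and> card S = r. if \<exists>k. \<gamma> = ind_mon S + k then Poly_Mapping.lookup (trunc N f) (\<gamma> - ind_mon S) else 0) = 0"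
    proof (intro sum.neutral ballI)
      fix S assume "S \<in> {S. S \<subseteq> {..<N} \<and> card S = r}"
      then have S: "S \<subseteq> {..<N}" "finite S" by (auto dest: finite_subset)
      obtain i where i: "i \<in> Poly_Mapping.keys \<gamma>" "i \<notin> {..<N}" using False by blast
      have "i \<in> Poly_Mapping.keys (\<gamma> - ind_mon S)" using i S by (auto simp: in_keys_iff lookup_minus lookup_ind_mon)
      then show "(if \<exists>k. \<gamma> = ind_mon S + k then Poly_Mapping.lookup (trunc N f) (\<gamma> - ind_mon S) else 0) = 0"
        using i(2) by (auto simp: lookup_trunc)
    qed
    then show ?thesis using False by simp
  qed
  finally show "Poly_Mapping.lookup (trunc N (elementary r * f)) \<gamma> =
     Poly_Mapping.lookup ((\<Sum>S | S \<subseteq> {..<N} \<and> card S = r. Poly_Mapping.single (ind_mon S) 1) * trunc N f) \<gamma>"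
    by (simp add: lookup_trunc)
qed

lemma to_fract_sum: "to_fract (sum f A) = (\<Sum>a\<in>A. to_fract (f a))"
  by (induction A rule: infinite_finite_induct) simp_all

lemma to_fract_ind_mon: "finite S \<Longrightarrow> to_fract (Poly_Mapping.single (ind_mon S) 1) = (\<Prod>i\<in>S. var i)"
proof (induction S rule: finite_induct)
  case empty
  then show ?case by (simp add: ind_mon_def)
next
  case (insert i S)
  have "Poly_Mapping.single (ind_mon (insert i S)) (1::rat) =
      Poly_Mapping.single (Poly_Mapping.single i 1) 1 * Poly_Mapping.single (ind_mon S) 1"
    using insert.hyps by (simp add: ind_mon_def mult_single)
  then show ?case using insert by (simp add: var_def)
qed

lemma to_fract_trunc_elementary_mult:
  "to_fract (trunc N (elementary r * f)) =
    (\<Sum>S | S \<subseteq> {..<N} \<and> card S = r. \<Prod>i\<in>S. var i) * to_fract (trunc N f)"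
  unfolding trunc_elementary_mult to_fract_mult to_fract_sum
  by (intro arg_cong2[where f = "(*)"] sum.cong refl to_fract_ind_mon) (auto dest: finite_subset)

lemma hl_sum_cong: "(\<And>i. i < N \<Longrightarrow> \<alpha> i = \<beta> i) \<Longrightarrow> hl_sum x q N \<alpha> = hl_sum x q N \<beta>"
  by (simp add: hl_sum_def)

section \<open>Hall--Littlewood functions\<close>

lemma hl_sum_bump_all:
  "hl_sum var (const q) N (bump \<alpha> {..<N}) = (\<Prod>i<N. var i) * hl_sum var (const q) N \<alpha>"
proof -
  have "{S. S \<subseteq> {..<N} \<and> card S = N} = {{..<N}}"
    using card_subset_eq[of "{..<N}"] by auto
  then show ?thesis
    using hl_variables.esym_times_hl_sum[OF hl_variables_var[of N], of N "const q" \<alpha>] by simp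
qed

text \<open>The normalized sum in \<open>N\<close> variables; with fewer variables than parts it is
  set to 0, as stability demands.\<close>

definition hl_quot :: "rat \<Rightarrow> nat \<Rightarrow> nat list \<Rightarrow> mpoly fract"
  where "hl_quot q N \<nu> = (if top_column \<nu> \<le> N
    then hl_sum var (const q) N (column_exponent \<nu>) / const (hl_norm q N \<nu>) else 0)"

text \<open>Stability is built in: one symmetric function has the right truncation for every number
  of variables.\<close>

definition is_hl :: "rat \<Rightarrow> symfun \<Rightarrow> nat list \<Rightarrow> bool"
  where "is_hl q p \<nu> \<longleftrightarrow> (\<forall>N. to_fract (trunc N p) = hl_quot q N \<nu>)"

lemma is_hl_unique: "is_hl q p \<nu> \<Longrightarrow> is_hl q p' \<nu> \<Longrightarrow> p = p'"
  unfolding is_hl_def by (rule symfun_eq_truncI) (metis to_fract_eq_iff)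

lemma top_column_eq_hd: "\<nu> \<noteq> [] \<Longrightarrow> top_column \<nu> = hd \<nu>"
  by (cases \<nu>) auto

text \<open>The rule for unnormalized sums is divided by the norms. The range of strips can be the
  same for every \<open>N\<close> because the additional strips have a first column longer than
  \<open>N\<close> and vanish in \<open>hl_quot\<close>.\<close>

lemma trunc_elementary_mult_hl:
  assumes q: "0 < q" and p: "is_hl q p \<kappa>" and sorted: "sorted_wrt (\<ge>) \<kappa>" and M: "top_column \<kappa> + r \<le> M"
  shows "to_fract (trunc N (elementary r * p)) =
    (\<Sum>\<nu>\<in>strips M \<kappa> r. const (strip_weight q \<kappa> \<nu>) * hl_quot q N \<nu>)"
proof (cases "top_column \<kappa> \<le> N")
  \<comment> \<open>The first column of a strip is at least that of \<kappa>, so both sides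
    vanish.\<close>
  case False
  have "hl_quot q N \<nu> = 0" if "\<nu> \<in> strips M \<kappa> r" for \<nu>
    using hd_strips_ge[OF that] False top_column_eq_hd[OF strips_not_Nil[OF that]] by (simp add: hl_quot_def)
  then show ?thesis
    using p False unfolding to_fract_trunc_elementary_mult by (simp add: is_hl_def hl_quot_def)
next
  case True
  let ?R = "\<lambda>\<nu>. hl_sum var (const q) N (column_exponent \<nu>)" and ?n = "hl_norm q N"
  have n0: "?n \<nu> \<noteq> 0" for \<nu> using hl_norm_pos[OF q, of N \<nu>] by simp
  have hd_le: "hd \<nu> \<le> N" if "\<nu> \<in> strips N \<kappa> r" for \<nu> using hd_strips_le[OF that] .
  have "to_fract (trunc N (elementary r * p)) = (\<Sum>S | S \<subseteq> {..<N} \<and> card S = r. \<Prod>i\<in>S. var i) * ?R \<kappa> / const (?n \<kappa>)"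
    using p True unfolding to_fract_trunc_elementary_mult by (simp add: is_hl_def hl_quot_def)
  also have "(\<Sum>S | S \<subseteq> {..<N} \<and> card S = r. \<Prod>i\<in>S. var i) * ?R \<kappa> =
      (\<Sum>S | S \<subseteq> {..<N} \<and> card S = r. hl_sum var (const q) N (bump (column_exponent \<kappa>) S))"
    by (rule hl_variables.esym_times_hl_sum[OF hl_variables_var])
  also have "\<dots> = (\<Sum>\<nu>\<in>strips N \<kappa> r. pieri_weight (const q) N \<kappa> \<nu> *
      hl_sum var (const q) N (\<lambda>i. if i < N then 0 + column_exponent \<nu> i else column_exponent \<kappa> i))"
    by (rule hl_variables.sum_hl_sum_bump[OF hl_variables_var])
      (use True sorted in \<open>auto simp: top_column_def split: list.splits\<close>)
  also have "\<dots> = (\<Sum>\<nu>\<in>strips N \<kappa> r. const (pieri_weight q N \<kappa> \<nu>) * ?R \<nu>)"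
    unfolding const_pieri_weight by (intro sum.cong refl arg_cong2[where f = "(*)"] hl_sum_cong) simp
  also have "\<dots> / const (?n \<kappa>) = (\<Sum>\<nu>\<in>strips N \<kappa> r. const (strip_weight q \<kappa> \<nu>) * hl_quot q N \<nu>)"
    unfolding sum_divide_distrib
  proof (rule sum.cong[OF refl])
    fix \<nu> assume \<nu>: "\<nu> \<in> strips N \<kappa> r"
    have "const (pieri_weight q N \<kappa> \<nu>) * const (?n \<nu>) = const (strip_weight q \<kappa> \<nu>) * const (?n \<kappa>)"
      unfolding const_mult[symmetric] pieri_weight_hl_norm[OF \<nu>] ..
    then have "const (pieri_weight q N \<kappa> \<nu>) / const (?n \<kappa>) = const (strip_weight q \<kappa> \<nu>) / const (?n \<nu>)"
      using n0 by (simp add: frac_eq_eq)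
    then have "const (pieri_weight q N \<kappa> \<nu>) / const (?n \<kappa>) * ?R \<nu> = const (strip_weight q \<kappa> \<nu>) / const (?n \<nu>) * ?R \<nu>"
      by (rule arg_cong)
    moreover have "hl_quot q N \<nu> = ?R \<nu> / const (?n \<nu>)"
      using hd_le[OF \<nu>] top_column_eq_hd[OF strips_not_Nil[OF \<nu>]] by (simp only: hl_quot_def if_True)
    ultimately show "const (pieri_weight q N \<kappa> \<nu>) * ?R \<nu> / const (?n \<kappa>) = const (strip_weight q \<kappa> \<nu>) * hl_quot q N \<nu>"
      by (simp only: times_divide_eq_left times_divide_eq_right)
  qed
  also have "\<dots> = (\<Sum>\<nu>\<in>strips M \<kappa> r. const (strip_weight q \<kappa> \<nu>) * hl_quot q N \<nu>)"
  proof (rule sum.mono_neutral_left)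
    show "\<forall>\<nu>\<in>strips M \<kappa> r - strips N \<kappa> r. const (strip_weight q \<kappa> \<nu>) * hl_quot q N \<nu> = 0"
    proof
      fix \<nu> assume \<nu>: "\<nu> \<in> strips M \<kappa> r - strips N \<kappa> r"
      then have mem: "\<nu> \<in> strips M \<kappa> r" and "\<nu> \<notin> {\<nu> \<in> strips M \<kappa> r. hd \<nu> \<le> N}"
        unfolding strips_filter[OF M, of N] by blast+
      then have "N < hd \<nu>" by simp
      then have "N < top_column \<nu>" using top_column_eq_hd[OF strips_not_Nil[OF mem]] by simp
      then show "const (strip_weight q \<kappa> \<nu>) * hl_quot q N \<nu> = 0" by (simp add: hl_quot_def)
    qed
  qed (simp, unfold strips_filter[OF M, of N], blast)
  finally show ?thesis .
qed

lemma is_hl_Nil: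
  assumes "1 < q"
  shows "is_hl q 1 []"
  unfolding is_hl_def
proof
  fix N
  have "hl_sum var (const q) N (\<lambda>_. 0) = qfact (const q) N"
    using assms by (intro hl_sum_0 inj_var var_neq_0) (metis const_simps(2) const_eq_iff less_irrefl)
  moreover have "column_exponent [] = (\<lambda>_. 0)" by (simp add: fun_eq_iff)
  moreover have "0 < qfact q N" using assms by (intro qfact_pos) simp
  ultimately show "to_fract (trunc N 1) = hl_quot q N []"
    by (simp add: hl_quot_def trunc_one const_qfact)
qed

text \<open>The columns \<open>b, \<kappa>\<close> themselves arise in the Pieri rule for \<open>e\<^sub>b p\<^sub>\<kappa>\<close>, with coefficient \<open>1\<close>, and
  all other terms have a longer first column. So this rule determines \<open>p\<close> at the columns \<open>b, \<kappa>\<close>.\<close>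

lemma columns_induct [consumes 1, case_names Nil Cons]:
  assumes "sorted_wrt (\<ge>) \<nu>" and "P []"
    and step: "\<And>b \<kappa>. sorted_wrt (\<ge>) (b # \<kappa>) \<Longrightarrow> P \<kappa> \<Longrightarrow>
      (\<And>M \<mu>. \<mu> \<in> strips M \<kappa> b \<Longrightarrow> \<mu> \<noteq> b # \<kappa> \<Longrightarrow> P \<mu>) \<Longrightarrow> P (b # \<kappa>)"
  shows "P \<nu>"
  using assms(1)
\<comment> \<open>The measure encodes the lexicographic order by size, size minus first column, and
  length. The length serves for b = 0, where \<kappa> has the same size.\<close>
proof (induction "sum_list \<nu> * (sum_list \<nu> + 1) + (sum_list \<nu> - top_column \<nu>) + length \<nu>"
    arbitrary: \<nu> rule: less_induct)
  case less
  show ?case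
  proof (cases \<nu>)
    case Nil
    then show ?thesis using assms(2) by simp
  next
    case (Cons b \<kappa>)
    have sorted: "top_column \<kappa> \<le> b" "sorted_wrt (\<ge>) \<kappa>"
      using less.prems unfolding Cons sorted_Cons_iff by auto
    have "P (b # \<kappa>)"
    proof (rule step)
      show "sorted_wrt (\<ge>) (b # \<kappa>)" using less.prems Cons by simp
      have "sum_list \<kappa> * (sum_list \<kappa> + 1) \<le> sum_list \<nu> * (sum_list \<kappa> + 1)"
        unfolding Cons by (intro mult_right_mono) auto
      also have "\<dots> + (sum_list \<kappa> - top_column \<kappa>) \<le> sum_list \<nu> * (sum_list \<nu> + 1) + (sum_list \<nu> - top_column \<nu>)"
        unfolding Cons by (simp add: algebra_simps)
      finally show "P \<kappa>" using sorted(2) by (intro less.hyps) (simp_all add: Cons)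
      fix M \<mu> assume \<mu>: "\<mu> \<in> strips M \<kappa> b" "\<mu> \<noteq> b # \<kappa>"
      have "sum_list \<mu> = sum_list \<nu>" using sum_list_strips[OF \<mu>(1)] Cons by simp
      moreover have "length \<mu> = length \<nu>" using length_strips[OF \<mu>(1)] Cons by simp
      moreover have "top_column \<nu> < top_column \<mu>"
        using strips_hd_less[OF \<mu>] strips_not_Nil[OF \<mu>(1)] Cons by (simp add: top_column_eq_hd)
      moreover have "top_column \<mu> \<le> sum_list \<mu>" by (cases \<mu>) auto
      ultimately show "P \<mu>" using sorted_strips[OF \<mu>(1) sorted(2)] by (intro less.hyps) auto
    qed
    then show ?thesis using Cons by simp
  qed
qed

text \<open>The Pieri rule is solved for its term at \<open>b # \<kappa>\<close>. The coefficients
  are free of \<open>N\<close>, so one symmetric function serves all truncations, although the sums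
  over permutations are a priori only rational functions.\<close>

lemma ex_is_hl:
  assumes q: "1 < q" and \<nu>: "sorted_wrt (\<ge>) \<nu>"
  shows "\<exists>p. is_hl q p \<nu>"
  using \<nu>
proof (induction \<nu> rule: columns_induct)
  case Nil
  then show ?case using is_hl_Nil[OF q] by blast
next
  case (Cons b \<kappa>)
  have sorted: "sorted_wrt (\<ge>) \<kappa>" using Cons.hyps by simp
  obtain p where p: "is_hl q p \<kappa>" using Cons.IH(1) by blast
  define M where "M = top_column \<kappa> + b"
  define P where "P \<mu> = (SOME p. is_hl q p \<mu>)" for \<mu>
  let ?S = "strips M \<kappa> b - {b # \<kappa>}"
  have P: "is_hl q (P \<mu>) \<mu>" if "\<mu> \<in> ?S" for \<mu>
    unfolding P_def by (rule someI_ex) (use that Cons.IH(2)[of \<mu> M] in auto)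
  have mem: "b # \<kappa> \<in> strips M \<kappa> b" using Cons.hyps by (intro Cons_in_strips) (auto simp: M_def)
  have "is_hl q (elementary b * p - (\<Sum>\<mu>\<in>?S. sscale (strip_weight q \<kappa> \<mu>) (P \<mu>))) (b # \<kappa>)"
    unfolding is_hl_def
  proof
    fix N
    have "to_fract (trunc N (elementary b * p)) = (\<Sum>\<mu>\<in>strips M \<kappa> b. const (strip_weight q \<kappa> \<mu>) * hl_quot q N \<mu>)"
      using q p sorted by (intro trunc_elementary_mult_hl) (auto simp: M_def)
    also have "\<dots> = hl_quot q N (b # \<kappa>) + (\<Sum>\<mu>\<in>?S. const (strip_weight q \<kappa> \<mu>) * hl_quot q N \<mu>)"
      by (subst sum.remove[OF finite_strips mem]) simp
    also have "(\<Sum>\<mu>\<in>?S. const (strip_weight q \<kappa> \<mu>) * hl_quot q N \<mu>) =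
        (\<Sum>\<mu>\<in>?S. to_fract (trunc N (sscale (strip_weight q \<kappa> \<mu>) (P \<mu>))))"
      using P by (intro sum.cong refl) (simp add: trunc_sscale is_hl_def)
    finally show "to_fract (trunc N (elementary b * p - (\<Sum>\<mu>\<in>?S. sscale (strip_weight q \<kappa> \<mu>) (P \<mu>)))) =
        hl_quot q N (b # \<kappa>)"
      by (simp add: trunc_diff trunc_sum to_fract_sum)
  qed
  then show ?case by blast
qed

definition hl_sym :: "rat \<Rightarrow> nat list \<Rightarrow> symfun"
  where "hl_sym q \<nu> = (SOME p. is_hl q p \<nu>)"

lemma is_hl_hl_sym: "1 < q \<Longrightarrow> sorted_wrt (\<ge>) \<nu> \<Longrightarrow> is_hl q (hl_sym q \<nu>) \<nu>"
  unfolding hl_sym_def using ex_is_hl by (rule someI_ex)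

lemma hl_sym_Nil: "1 < q \<Longrightarrow> hl_sym q [] = 1"
  using is_hl_unique[OF is_hl_hl_sym is_hl_Nil] by simp

theorem hl_sym_pieri:
  assumes q: "1 < q" and \<kappa>: "sorted_wrt (\<ge>) \<kappa>" and M: "top_column \<kappa> + r \<le> M"
  shows "elementary r * hl_sym q \<kappa> = (\<Sum>\<nu>\<in>strips M \<kappa> r. sscale (strip_weight q \<kappa> \<nu>) (hl_sym q \<nu>))"
proof (rule symfun_eq_truncI)
  fix N
  have "to_fract (trunc N (elementary r * hl_sym q \<kappa>)) = (\<Sum>\<nu>\<in>strips M \<kappa> r. const (strip_weight q \<kappa> \<nu>) * hl_quot q N \<nu>)"
    using q by (intro trunc_elementary_mult_hl is_hl_hl_sym \<kappa> M) simp_all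
  also have "\<dots> = (\<Sum>\<nu>\<in>strips M \<kappa> r. const (strip_weight q \<kappa> \<nu>) * to_fract (trunc N (hl_sym q \<nu>)))"
    using is_hl_hl_sym[OF q sorted_strips[OF _ \<kappa>]] by (intro sum.cong refl) (simp add: is_hl_def)
  also have "\<dots> = to_fract (trunc N (\<Sum>\<nu>\<in>strips M \<kappa> r. sscale (strip_weight q \<kappa> \<nu>) (hl_sym q \<nu>)))"
    by (simp add: trunc_sum to_fract_sum trunc_sscale)
  finally show "trunc N (elementary r * hl_sym q \<kappa>) = trunc N (\<Sum>\<nu>\<in>strips M \<kappa> r. sscale (strip_weight q \<kappa> \<nu>) (hl_sym q \<nu>))"
    by simp
qed

definition column_monomial :: "nat list \<Rightarrow> (nat \<Rightarrow>\<^sub>0 nat)"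
  where "column_monomial \<nu> = xpow (map (column_exponent \<nu>) [0..<top_column \<nu>])"

lemma column_exponent_top: "sorted_wrt (\<ge>) \<nu> \<Longrightarrow> top_column \<nu> \<le> i \<Longrightarrow> column_exponent \<nu> i = 0"
  by (rule column_exponent_eq_0) (cases \<nu>, auto)

lemma lookup_column_monomial:
  "sorted_wrt (\<ge>) \<nu> \<Longrightarrow> Poly_Mapping.lookup (column_monomial \<nu>) i = column_exponent \<nu> i"
  using column_exponent_top[of \<nu> i] by (auto simp: column_monomial_def nth_default_def)

lemma keys_column_monomial:
  assumes "sorted_wrt (\<ge>) \<nu>"
  shows "Poly_Mapping.keys (column_monomial \<nu>) \<subseteq> {..<top_column \<nu>}"
proof
  fix i assume "i \<in> Poly_Mapping.keys (column_monomial \<nu>)"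
  then have "column_exponent \<nu> i \<noteq> 0" using assms by (simp only: in_keys_iff lookup_column_monomial not_False_eq_True)
  then show "i \<in> {..<top_column \<nu>}" using column_exponent_top[OF assms, of i] by (auto intro: leI ccontr)
qed

text \<open>In exactly k variables, the sum at \<open>k # ks\<close> is the sum at \<open>ks\<close>
  times the product of the variables, and the norms agree because \<open>qfact q 0 = 1\<close>. So
  the leading coefficient is that of the empty partition.\<close>

lemma scoeff_hl_sym:
  assumes q: "1 < q"
  shows "sorted_wrt (\<ge>) \<nu> \<Longrightarrow> scoeff (hl_sym q \<nu>) (column_monomial \<nu>) = 1"
proof (induction \<nu>)
  case Nil
  then show ?case using hl_sym_Nil[OF q] by (simp add: column_monomial_def scoeff_one)
next
  case (Cons k ks)
  have sorted: "top_column ks \<le> k" "sorted_wrt (\<ge>) ks" using Cons.prems unfolding sorted_Cons_iff by auto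
  have hl: "is_hl q (hl_sym q (k # ks)) (k # ks)" "is_hl q (hl_sym q ks) ks"
    using is_hl_hl_sym[OF q] Cons.prems sorted(2) by blast+
  have "hl_sum var (const q) k (column_exponent (k # ks)) = hl_sum var (const q) k (bump (column_exponent ks) {..<k})"
    by (rule hl_sum_cong) (simp add: bump_def)
  then have "to_fract (trunc k (hl_sym q (k # ks))) = (\<Prod>i<k. var i) * to_fract (trunc k (hl_sym q ks))"
    using hl sorted(1) by (simp add: is_hl_def hl_quot_def hl_sum_bump_all)
  also have "\<dots> = to_fract (Poly_Mapping.single (ind_mon {..<k}) 1 * trunc k (hl_sym q ks))"
    by (simp add: to_fract_ind_mon)
  finally have tr: "trunc k (hl_sym q (k # ks)) = Poly_Mapping.single (ind_mon {..<k}) 1 * trunc k (hl_sym q ks)"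
    by (simp only: to_fract_eq_iff)
  have mon: "column_monomial (k # ks) = ind_mon {..<k} + column_monomial ks"
    using Cons.prems sorted(2)
    by (intro poly_mapping_eqI) (simp add: lookup_column_monomial lookup_add lookup_ind_mon del: sorted_wrt.simps)
  have keys: "Poly_Mapping.keys (column_monomial ks) \<subseteq> {..<k}"
    using keys_column_monomial[OF sorted(2)] sorted(1) by (meson lessThan_subset_iff subset_trans)
  have keys': "Poly_Mapping.keys (column_monomial (k # ks)) \<subseteq> {..<k}"
    using keys_column_monomial[OF Cons.prems] by simp
  have "scoeff (hl_sym q (k # ks)) (column_monomial (k # ks)) = Poly_Mapping.lookup (trunc k (hl_sym q (k # ks))) (column_monomial (k # ks))"
    using keys' by (simp add: lookup_trunc)
  also have "\<dots> = Poly_Mapping.lookup (trunc k (hl_sym q ks)) (column_monomial ks)"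
    unfolding tr lookup_single_mult mon by auto
  also have "\<dots> = 1" using keys Cons.IH[OF sorted(2)] by (simp add: lookup_trunc)
  finally show ?case .
qed

lemma hall_littlewood_sum_eq_hl_sum:
  assumes "length \<mu> \<le> N" "\<And>i. column_exponent \<nu> i = nth_default 0 \<mu> i"
  shows "hall_littlewood_sum N q \<mu> = hl_sum var (const q) N (column_exponent \<nu>)"
  unfolding hall_littlewood_sum_def hl_sum_def
proof (rule sum.cong[OF refl])
  fix w :: "nat \<Rightarrow> nat"
  have "(\<Prod>i<length \<mu>. var (w i) ^ (\<mu> ! i)) = (\<Prod>i<N. var (w i) ^ column_exponent \<nu> i)"
    by (rule prod.mono_neutral_cong_left) (use assms in \<open>auto simp: nth_default_def\<close>)
  moreover have "(\<Prod>j<N. \<Prod>i<j. (var (w i) - const q * var (w j)) / (var (w i) - var (w j))) =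
      prod (hl_factor var (const q) w) (pairs N)"
    unfolding pairs_def by (subst prod.Sigma) (auto simp: hl_factor_def case_prod_unfold)
  ultimately show "(\<Prod>i<length \<mu>. var (w i) ^ (\<mu> ! i)) *
      (\<Prod>j<N. \<Prod>i<j. (var (w i) - const q * var (w j)) / (var (w i) - var (w j))) =
      (\<Prod>i<N. var (w i) ^ column_exponent \<nu> i) * prod (hl_factor var (const q) w) (pairs N)" by simp
qed

text \<open>\<mu> lists the parts and \<nu> the columns of one partition. The scalar multiple is
  unique because its coefficient at x^\<mu> is prescribed, and the symmetric function is unique
  because every monomial lies in enough variables.\<close>

theorem hall_littlewood_eq_hl_sym:
  assumes q: "1 < q" and \<nu>: "sorted_wrt (\<ge>) \<nu>" and len: "length \<mu> = top_column \<nu>"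
    and \<mu>: "\<And>i. column_exponent \<nu> i = nth_default 0 \<mu> i"
  shows "hall_littlewood q \<mu> = hl_sym q \<nu>"
proof -
  have mon: "column_monomial \<nu> = xpow \<mu>"
    by (rule poly_mapping_eqI) (simp add: lookup_column_monomial[OF \<nu>] \<mu>)
  have poly: "hall_littlewood_poly N q \<mu> = trunc N (hl_sym q \<nu>)" if N: "length \<mu> \<le> N" for N
    unfolding hall_littlewood_poly_def
  proof (rule the_equality)
    let ?n = "hl_norm q N \<nu>"
    have n0: "?n \<noteq> 0" using hl_norm_pos[of q N \<nu>] q by simp
    have sum_eq: "to_fract (trunc N (hl_sym q \<nu>)) = hall_littlewood_sum N q \<mu> / const ?n"
      using is_hl_hl_sym[OF q \<nu>] N len by (simp add: is_hl_def hl_quot_def hall_littlewood_sum_eq_hl_sum[OF N \<mu>])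
    have "const (1 / ?n) * const ?n = 1" unfolding const_mult[symmetric] using n0 by simp
    then have "to_fract (trunc N (hl_sym q \<nu>)) = const (1 / ?n) * hall_littlewood_sum N q \<mu>"
      unfolding sum_eq using n0 by (simp add: field_simps)
    moreover have keys: "Poly_Mapping.keys (xpow \<mu>) \<subseteq> {..<N}" using keys_xpow[of \<mu>] N by (meson lessThan_subset_iff subset_trans)
    moreover have coeff: "Poly_Mapping.lookup (trunc N (hl_sym q \<nu>)) (xpow \<mu>) = 1"
      using scoeff_hl_sym[OF q \<nu>] keys mon by (simp add: lookup_trunc del: keys_nth)
    ultimately show "(\<exists>c. to_fract (trunc N (hl_sym q \<nu>)) = const c * hall_littlewood_sum N q \<mu>) \<and>
        Poly_Mapping.lookup (trunc N (hl_sym q \<nu>)) (xpow \<mu>) = 1" by blast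
    fix p assume p: "(\<exists>c. to_fract p = const c * hall_littlewood_sum N q \<mu>) \<and> Poly_Mapping.lookup p (xpow \<mu>) = 1"
    then obtain c where c: "to_fract p = const c * hall_littlewood_sum N q \<mu>" by blast
    also have "hall_littlewood_sum N q \<mu> = const ?n * to_fract (trunc N (hl_sym q \<nu>))"
      unfolding sum_eq using n0 by simp
    finally have "to_fract p = to_fract (Poly_Mapping.single 0 (c * ?n) * trunc N (hl_sym q \<nu>))"
      unfolding to_fract_mult const_def[symmetric] by simp
    then have p_eq: "p = Poly_Mapping.single 0 (c * ?n) * trunc N (hl_sym q \<nu>)" by (simp only: to_fract_eq_iff)
    have "c * ?n = 1" using p coeff unfolding p_eq lookup_single_mult by simp
    then show "p = trunc N (hl_sym q \<nu>)" unfolding p_eq by simp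
  qed
  show ?thesis
    unfolding hall_littlewood_def
  proof (rule the_equality)
    show "\<forall>N\<ge>length \<mu>. \<forall>\<gamma>. Poly_Mapping.keys \<gamma> \<subseteq> {..<N} \<longrightarrow>
        scoeff (hl_sym q \<nu>) \<gamma> = Poly_Mapping.lookup (hall_littlewood_poly N q \<mu>) \<gamma>"
      by (simp add: poly lookup_trunc)
    fix P assume P: "\<forall>N\<ge>length \<mu>. \<forall>\<gamma>. Poly_Mapping.keys \<gamma> \<subseteq> {..<N} \<longrightarrow>
        scoeff P \<gamma> = Poly_Mapping.lookup (hall_littlewood_poly N q \<mu>) \<gamma>"
    show "P = hl_sym q \<nu>"
    proof (rule symfun_eqI)
      fix \<gamma> :: "nat \<Rightarrow>\<^sub>0 nat"
      obtain N where N: "Poly_Mapping.keys \<gamma> \<subseteq> {..<N}" using finite_nat_iff_bounded[of "Poly_Mapping.keys \<gamma>"] by auto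
      then have "Poly_Mapping.keys \<gamma> \<subseteq> {..<max N (length \<mu>)}" by auto
      then show "scoeff P \<gamma> = scoeff (hl_sym q \<nu>) \<gamma>"
        using P[rule_format, of "max N (length \<mu>)" \<gamma>] by (simp add: poly lookup_trunc)
    qed
  qed
qed

section \<open>Pairing with the flag generating function\<close>

context finite_operator
begin

text \<open>Built from the counts at partitions; the symmetry of \<open>flag_count\<close> makes the
  coefficients right at all lists. Partitions of size below \<open>vec.dim U\<close> have count
  0.\<close>

definition flag_symfun :: "('k ^ 'n) set \<Rightarrow> symfun"
  where "flag_symfun U = (\<Sum>\<mu>\<in>partitions_le (vec.dim U). sscale (of_nat (flag_count U \<mu>)) (sym_m \<mu>))"

lemma scoeff_flag_symfun:
  assumes U: "vec.subspace U" "core U = U"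
  shows "scoeff (flag_symfun U) (xpow xs) = of_nat (flag_count U xs)"
proof -
  let ?p = "part (xpow xs)"
  have p: "is_partition ?p" by (rule is_partition_part)
  have "mset ?p = mset (filter ((\<noteq>) 0) xs)" by (simp only: mset_part content_xpow mset_filter)
  then have count: "flag_count U ?p = flag_count U xs"
    using flag_count_mset[OF U] flag_count_filter[OF U, of xs] by metis
  have "scoeff (flag_symfun U) (xpow xs) =
      (\<Sum>\<mu>\<in>partitions_le (vec.dim U). if ?p = \<mu> then of_nat (flag_count U \<mu>) else 0)"
    unfolding flag_symfun_def scoeff_sum by (rule sum.cong[OF refl]) (simp add: partitions_le_def scoeff_sym_m)
  also have "\<dots> = (if ?p \<in> partitions_le (vec.dim U) then of_nat (flag_count U ?p) else 0)"
    by (simp add: finite_partitions_le)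
  also have "\<dots> = of_nat (flag_count U ?p)"
    using flag_count_eq_0[OF U(1), of ?p] p by (auto simp: partitions_le_def)
  finally show ?thesis unfolding count .
qed

lemma flag_gf_eq: "flag_gf \<Delta> = flag_symfun UNIV"
  unfolding flag_gf_def
proof (rule the_equality)
  \<comment> \<open>The reversal in \<open>card_invariant_flags\<close> disappears by
    symmetry.\<close>
  have card: "card (invariant_flags \<Delta> \<alpha>) = flag_count UNIV \<alpha>" for \<alpha>
    unfolding card_invariant_flags by (rule flag_count_mset) simp_all
  show F: "\<forall>\<alpha>. scoeff (flag_symfun UNIV) (xpow \<alpha>) =
      (if sum_list \<alpha> = CARD('n) then of_nat (card (invariant_flags \<Delta> \<alpha>)) else 0)"
    using flag_count_eq_0[of UNIV] by (simp add: scoeff_flag_symfun card card_cart_basis)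
  fix F assume "\<forall>\<alpha>. scoeff F (xpow \<alpha>) = (if sum_list \<alpha> = CARD('n) then of_nat (card (invariant_flags \<Delta> \<alpha>)) else 0)"
  then have "scoeff F (xpow (part \<gamma>)) = scoeff (flag_symfun UNIV) (xpow (part \<gamma>))" for \<gamma> using F by metis
  then show "F = flag_symfun UNIV" by (intro symfun_eqI) (simp only: scoeff_part)
qed

definition flag_functional :: "('k ^ 'n) set \<Rightarrow> symfun \<Rightarrow> rat"
  where "flag_functional U = hall (omega (flag_symfun U))"

lemma linear_flag_functional: "Vector_Spaces.linear sscale (*) (flag_functional U)"
  unfolding flag_functional_def by (rule linear_hall_right)

lemma flag_functional_simps:
  "flag_functional U (f + g) = flag_functional U f + flag_functional U g"
  "flag_functional U (sscale c f) = c * flag_functional U f"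
  "flag_functional U (sum F A) = (\<Sum>a\<in>A. flag_functional U (F a))"
  using linear_flag_functional[of U]
  by (simp_all add: symfun_dual.linear_add symfun_dual.linear_scale symfun_dual.linear_sum)

lemma flag_functional_sym_e:
  "vec.subspace U \<Longrightarrow> core U = U \<Longrightarrow> flag_functional U (sym_e xs) = of_nat (flag_count U xs)"
  by (simp add: flag_functional_def hall_omega_sym_e scoeff_flag_symfun)

text \<open>On e_\<mu> this is the recursion defining \<open>flag_count\<close> at
  \<open>r # \<mu>\<close>; the rest is linear extension.\<close>

lemma flag_functional_elementary_mult:
  assumes U: "vec.subspace U" "core U = U"
  shows "flag_functional U (elementary r * g) = (\<Sum>U'\<in>invariant_below U r. flag_functional U' g)"
proof (rule symfun_dual_eqI[of "\<lambda>g. flag_functional U (elementary r * g)"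
      "\<lambda>g. \<Sum>U'\<in>invariant_below U r. flag_functional U' g", OF _ _ span_sym_e])
  show "Vector_Spaces.linear sscale (*) (\<lambda>g. flag_functional U (elementary r * g))"
    by (rule symfun_dual_linearI) (simp_all add: distrib_left sscale_mult_right flag_functional_simps)
  show "Vector_Spaces.linear sscale (*) (\<lambda>g. \<Sum>U'\<in>invariant_below U r. flag_functional U' g)"
    by (rule symfun_dual_linearI) (simp_all add: flag_functional_simps sum.distrib sum_distrib_left)
  fix b assume "b \<in> sym_e ` Collect is_partition"
  then obtain \<mu> where b: "b = sym_e \<mu>" by blast
  have "flag_functional U (elementary r * b) = of_nat (flag_count U (r # \<mu>))"
    using flag_functional_sym_e[OF U, of "r # \<mu>"] b by simp
  also have "\<dots> = (\<Sum>U'\<in>invariant_below U r. flag_functional U' b)"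
    unfolding flag_count.simps of_nat_sum b
    by (rule sum.cong[OF refl]) (simp add: flag_functional_sym_e invariant_belowD)
  finally show "flag_functional U (elementary r * b) = (\<Sum>U'\<in>invariant_below U r. flag_functional U' b)" .
qed

text \<open>The functional applied to the Pieri rule gives the same relation as
  \<open>chain_count_strips\<close>. Induction settles all strips but \<open>b # \<kappa>\<close>,
  whose coefficient is 1, so equality there follows by subtraction. \<open>U\<close> varies because
  the relation involves its invariant subspaces.\<close>

theorem flag_functional_hl_sym:
  assumes "sorted_wrt (\<ge>) \<nu>" "vec.subspace U" "core U = U" "sum_list \<nu> = vec.dim U"
  shows "flag_functional U (hl_sym q \<nu>) = signed_weight q (tl \<nu>) * chain_count U \<nu>"
  using assms
proof (induction \<nu> arbitrary: U rule: columns_induct)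
  case Nil
  have "U = {0}" using Nil subspace_dim_0[of U] by simp
  then show ?case
    using flag_functional_sym_e[OF Nil(1,2), of "[]"] hl_sym_Nil[OF q_gt_1] by simp
next
  case (Cons b \<kappa>)
  note U = Cons.prems(1,2)
  have sorted: "sorted_wrt (\<ge>) \<kappa>" using Cons.hyps by simp
  have "top_column \<kappa> \<le> sum_list \<kappa>" by (cases \<kappa>) auto
  then have M: "top_column \<kappa> + b \<le> vec.dim U" using Cons.prems(3) by simp
  have mem: "b # \<kappa> \<in> strips (vec.dim U) \<kappa> b" using Cons.hyps Cons.prems(3) by (intro Cons_in_strips) auto
  let ?S = "strips (vec.dim U) \<kappa> b"
  have "(\<Sum>\<mu>\<in>?S. strip_weight q \<kappa> \<mu> * flag_functional U (hl_sym q \<mu>)) = flag_functional U (elementary b * hl_sym q \<kappa>)"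
    unfolding hl_sym_pieri[OF q_gt_1 sorted M] by (simp add: flag_functional_simps)
  also have "\<dots> = (\<Sum>U'\<in>invariant_below U b. chain_count U' \<kappa>) * signed_weight q (tl \<kappa>)"
    unfolding flag_functional_elementary_mult[OF U] sum_distrib_right
  proof (rule sum.cong[OF refl])
    fix U' assume "U' \<in> invariant_below U b"
    from invariant_belowD[OF this]
    show "flag_functional U' (hl_sym q \<kappa>) = chain_count U' \<kappa> * signed_weight q (tl \<kappa>)"
      using Cons.IH(1)[of U'] Cons.prems(3) by simp
  qed
  also have "\<dots> = (\<Sum>\<mu>\<in>?S. strip_weight q \<kappa> \<mu> * signed_weight q (tl \<mu>) * chain_count U \<mu>)"
    by (rule chain_count_strips[OF U])
  finally have eq: "(\<Sum>\<mu>\<in>?S. strip_weight q \<kappa> \<mu> * flag_functional U (hl_sym q \<mu>)) =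
      (\<Sum>\<mu>\<in>?S. strip_weight q \<kappa> \<mu> * signed_weight q (tl \<mu>) * chain_count U \<mu>)" .
  have "(\<Sum>\<mu>\<in>?S - {b # \<kappa>}. strip_weight q \<kappa> \<mu> * flag_functional U (hl_sym q \<mu>)) =
      (\<Sum>\<mu>\<in>?S - {b # \<kappa>}. strip_weight q \<kappa> \<mu> * signed_weight q (tl \<mu>) * chain_count U \<mu>)"
  proof (rule sum.cong[OF refl])
    fix \<mu> assume \<mu>: "\<mu> \<in> ?S - {b # \<kappa>}"
    then have "sum_list \<mu> = vec.dim U" using sum_list_strips[of \<mu> "vec.dim U" \<kappa> b] Cons.prems(3) by simp
    then have "flag_functional U (hl_sym q \<mu>) = signed_weight q (tl \<mu>) * chain_count U \<mu>"
      using Cons.IH(2)[of \<mu> "vec.dim U" U] \<mu> U by simp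
    then show "strip_weight q \<kappa> \<mu> * flag_functional U (hl_sym q \<mu>) =
        strip_weight q \<kappa> \<mu> * signed_weight q (tl \<mu>) * chain_count U \<mu>" by simp
  qed
  then show ?case
    using eq unfolding sum.remove[OF finite_strips mem] by simp
qed

end

theorem corollary6p5:
  fixes \<Delta> :: "'k::{field, finite} ^ 'n ^ 'n::finite"
    and n t q m :: nat
  assumes "CARD('n) = n" and "CARD('k) = q"
    and "t > 0" and "m * (t + 1) \<le> n"
  shows "of_nat (card {W :: ('k ^ 'n) set. anti_invariant t \<Delta> W \<and> vec.dim W = m}) =
    (- 1) ^ (m * t) * of_nat q ^ (t * (m choose 2)) *
    hall (omega (flag_gf \<Delta>))
      (hall_littlewood (of_nat q) (replicate m (t + 1) @ replicate (n - m * (t + 1)) 1))"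
proof -
  interpret finite_operator \<Delta> "of_nat q" by unfold_locales (simp add: assms(2))
  \<comment> \<open>Conjugation: the partition has n - m t parts, and exactly m of them exceed i for
    each i from 1 to t.\<close>
  let ?\<nu> = "(n - m * t) # replicate t m" and ?\<mu> = "replicate m (t + 1) @ replicate (n - m * (t + 1)) 1"
  have mt: "m * t + m \<le> n" using assms(4) by simp
  have "sorted_wrt (\<ge>) (replicate s k)" for s and k :: nat by (induction s) auto
  then have sorted: "sorted_wrt (\<ge>) ?\<nu>" using mt by auto
  have columns: "column_exponent (replicate s k) i = (if i < k then s else 0)" for s k i
    by (induction s) auto
  have HL: "hall_littlewood (of_nat q) ?\<mu> = hl_sym (of_nat q) ?\<nu>"
  proof (rule hall_littlewood_eq_hl_sym[OF q_gt_1 sorted])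
    show "length ?\<mu> = top_column ?\<nu>" using mt by simp
    show "column_exponent ?\<nu> i = nth_default 0 ?\<mu> i" for i
      using mt by (auto simp: columns nth_default_def nth_append)
  qed
  have "hall (omega (flag_gf \<Delta>)) (hall_littlewood (of_nat q) ?\<mu>) = flag_functional UNIV (hl_sym (of_nat q) ?\<nu>)"
    unfolding HL flag_gf_eq flag_functional_def ..
  also have "\<dots> = signed_weight (of_nat q) (tl ?\<nu>) * chain_count UNIV ?\<nu>"
    by (rule flag_functional_hl_sym[OF sorted])
      (use mt assms(1) in \<open>simp_all add: sum_list_replicate card_cart_basis mult.commute\<close>)
  also have "chain_count UNIV ?\<nu> = of_nat (card {W. anti_invariant t \<Delta> W \<and> vec.dim W = m})"
    using card_anti_invariant[of t m] assms(1,3) mt by simp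
  also have "signed_weight (of_nat q) (tl ?\<nu>) = ((- 1) ^ m / of_nat q ^ (m choose 2)) ^ t"
    by (simp add: signed_weight_def prod_list_replicate)
  finally have eq: "hall (omega (flag_gf \<Delta>)) (hall_littlewood (of_nat q) ?\<mu>) =
    ((- 1) ^ m / of_nat q ^ (m choose 2)) ^ t * of_nat (card {W. anti_invariant t \<Delta> W \<and> vec.dim W = m})" .
  have "(of_nat q :: rat) \<noteq> 0" using q_gt_1 by simp
  \<comment> \<open>The constant of the theorem is the inverse of \<open>signed_weight\<close>; the
    sign is its own inverse.\<close>
  then have "(- 1) ^ (m * t) * of_nat q ^ (t * (m choose 2)) * ((- 1) ^ m / of_nat q ^ (m choose 2)) ^ t = (1 :: rat)"
    by (simp add: power_divide power_mult[symmetric] mult.commute[of t] power_mult_distrib[symmetric])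
  then show ?thesis unfolding eq by (simp only: mult.assoc[symmetric] mult_1)
qed

end
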